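(* Assume: (1) the undirected communication graph $\mathcal G$ is connected; (2) the minimum value $f^*=\min_{x\in\mathbb R^p} f(x)$ is finite; (3) each $f_i$ is smooth with constant $L_f>0$: $\|\nabla f_i(x)-\nabla f_i(y)\|\le L_f\|x-y\|$ for all $x,y\in\mathbb R^p$; (4) the random variables $\{\xi_{i,k}: i\in[n], k\in\mathbb N_0\}$ are independent of each other; (5) $\mathbf E_{\xi_{i,k}}[g_i(x,\xi_{i,k})]=\nabla f_i(x)$ for all $i\in[n]$, $k\in\mathbb N_0$, $x\in\mathbb R^p$; (6) there is a constant $\sigma$ such that $\mathbf E_{\xi_{i,k}}[\|g_i(x,\xi_{i,k})-\nabla f_i(x)\|^2]\le\sigma^2$ for all $i\in[n]$, $k\in\mathbb N_0$, $x\in\mathbb R^p$; (7) $f$ satisfies the Polyak--Łojasiewicz condition with constant $\nu>0$: $\frac12\|\nabla f(x)\|^2\ge\nu(f(x)-f^* )$ for all $x\in\mathbb R^p$. Let $\{x_{i,k}\}$ be generated by the distributed primal--dual SGD algorithm with $$\alpha_k=\alpha=\kappa_1\beta,\quad\beta_k=\beta,\quad\eta_k=\eta=\frac{\kappa_2}{\beta},\quad\forall k\in\mathbb N_0,$$ where $\kappa_1>c_1$, $\kappa_2\in(0,c_2(\kappa_1))$, and $\beta\ge c_0(\kappa_1,\kappa_2)$. Then $$\mathbf E\Big[\frac1n\sum_{i=1}^n\|x_{i,k}-\bar x_k\|^2+f(\bar x_k)-f^*\Big]\le(1-\eta\varepsilon)^kc_4+c_5\eta\sigma^2,\quad\forall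 k\in\mathbb N_+,$$ where $\varepsilon\in(0,1/\eta)$ and $c_4,c_5>0$ are the constants $$\varepsilon=\frac1{\kappa_5}\min\Big\{\frac{\varepsilon_3}\eta,\frac{\varepsilon_4}\eta,\frac\nu2\Big\},\qquad c_4=\frac{W_0}{n\kappa_6},\qquad c_5=\frac{\varepsilon_5+3n}{n\varepsilon\kappa_6}.$$
   Context: Setting. There are $n$ agents, $[n]=\{1,\dots,n\}$; agent $i$ has a differentiable (possibly nonconvex) cost $f_i:\mathbb R^p\to\mathbb R$, and $f=\frac1n\sum_{i=1}^n f_i$. The undirected communication graph is $\mathcal G=(\{1,\dots,n\},\mathcal E)$ with weighted Laplacian $L=(L_{ij})$ (symmetric; for $i\ne j$, $L_{ij}<0$ if $(i,j)\in\mathcal E$ and $L_{ij}=0$ otherwise; $L_{ii}=-\sum_{j\neq i}L_{ij}$). $\rho(\cdot)$ is the spectral radius and $\rho_2(L)$ the smallest positive eigenvalue of $L$. $\|\cdot\|$ is the Euclidean norm, and $\|x\|_A^2=x^\top Ax$ for a square matrix $A$. Distributed primal--dual SGD algorithm. Given deterministic positive parameters $\alpha_k,\beta_k,\eta_k$, deterministic $x_{i,0}\in\mathbb R^p$, and $v_{i,0}=0$, for all $k\in\mathbb N_0$, $i\in[n]$: $$x_{i,k+1}=x_{i,k}-\eta_k\Big(\alpha_k\sum_{j=1}^nL_{ij}x_{j,k}+\beta_kv_{i,k}+g_i(x_{i,k},\xi_{i,k})\Big),\qquad v_{i,k+1}=v_{i,k}+\eta_k\beta_k\sum_{j=1}^nL_{ij}x_{j,k},$$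 where $g_i(x,\xi_{i,k})$ is a stochastic estimate of $\nabla f_i(x)$ and $\xi_{i,k}$ is a random variable. $\bar x_k=\frac1n\sum_{i=1}^nx_{i,k}$. Constants: $c_1=\frac1{\rho_2(L)}+1$, $\varepsilon_1=(\kappa_1-1)\rho_2(L)-1$, $\varepsilon_2=\rho(L)+(2\kappa_1^2+1)\rho(L^2)+1$, $c_2(\kappa_1)=\min\{\varepsilon_1/\varepsilon_2,\,1/5\}$, $\kappa_3=\frac1{\rho_2(L)}+\kappa_1+1$, $\kappa_4=\frac1{\rho_2(L)}+\kappa_1+\frac32$, $\kappa_5=\frac{\kappa_1+1}2+\frac1{2\rho_2(L)}$, $\kappa_6=\min\{\frac1{2\rho(L)},\frac{\kappa_1-1}{2\kappa_1}\}$, $\varepsilon_3=\varepsilon_1\kappa_2-\varepsilon_2\kappa_2^2$, $\varepsilon_4=\frac12(\kappa_2-5\kappa_2^2)$, $\varepsilon_6=\max\{\frac12(2+3L_f^2),\kappa_3\}$, $\varepsilon_5=L_f+\frac{1}{\kappa_2\varepsilon_6}\kappa_3L_f^2+\frac2{\varepsilon_6^2}\kappa_4L_f^2$, $c_0(\kappa_1,\kappa_2)=\max\{4\kappa_2\varepsilon_5,\varepsilon_6\}$. Initial Lyapunov value: with $\boldsymbol x_0=(x_{1,0},\dots,x_{n,0})$ and $\boldsymbol v_0=(v_{1,0},\dots,v_{n,0})$ stacked in $\mathbb R^{np}$, $\boldsymbol g_0^0=(\nabla f_1(\bar x_0),\dots,\nabla f_n(\bar x_0))\in\mathbb R^{np}$,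 $\boldsymbol K=(I_n-\frac1n\mathbf 1_n\mathbf 1_n^\top)\otimes I_p$, $\boldsymbol Q=L^{+}\otimes I_p$ with $L^+=R\Lambda_1^{-1}R^\top$ the Moore--Penrose pseudoinverse of $L$ ($\Lambda_1=\mathrm{diag}(\lambda_2,\dots,\lambda_n)$ the nonzero eigenvalues of $L$, columns of $R$ corresponding orthonormal eigenvectors), $$W_0=\tfrac12\|\boldsymbol x_0\|_{\boldsymbol K}^2+\tfrac12\Big\|\boldsymbol v_0+\tfrac1\beta\boldsymbol g_0^0\Big\|^2_{\boldsymbol Q+\kappa_1\boldsymbol K}+\boldsymbol x_0^\top\boldsymbol K\Big(\boldsymbol v_0+\tfrac1\beta\boldsymbol g_0^0\Big)+n(f(\bar x_0)-f^* ).$$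
   Formalization: n ≥ 2 is assumed (for n = 1, ρ_2(L) does not exist); "c_4 > 0" is replaced by c_4 ≥ 0, with c_4 > 0 unless all x_{i,0} equal x̄_0 and every ∇f_i(x̄_0) = 0, where W_0 = 0 and so c_4 = 0. *)

theory Defs
  imports "HOL-Probability.Probability"
begin

definition eigenvalue :: "('a::field)^'n^'n \<Rightarrow> 'a \<Rightarrow> bool" where
  "eigenvalue A c \<longleftrightarrow> (\<exists>v. v \<noteq> 0 \<and> A *v v = c *s v)"

text \<open>The spectral radius of a real matrix refers to its complex eigenvalues.\<close>

definition spectral_radius :: "real^'n^'n \<Rightarrow> real" where
  "spectral_radius A =
     Max {norm c | c :: complex. eigenvalue (\<chi> i j. complex_of_real (A $ i $ j)) c}"

definition rho2 :: "real^'n^'n \<Rightarrow> real" where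
  "rho2 A = Min {c. 0 < c \<and> eigenvalue A c}"

definition wnorm_sq :: "real^'m^'m \<Rightarrow> real^'m \<Rightarrow> real" where
  "wnorm_sq A x = x \<bullet> (A *v x)"

definition kronecker :: "real^'n^'n \<Rightarrow> real^'p^'p \<Rightarrow> real^('n \<times> 'p)^('n \<times> 'p)" where
  "kronecker A B = (\<chi> r s. A $ fst r $ fst s * B $ snd r $ snd s)"

definition stack :: "('n::finite \<Rightarrow> real^'p) \<Rightarrow> real^('n \<times> 'p)" where
  "stack x = (\<chi> r. x (fst r) $ snd r)"

definition is_pseudoinverse :: "real^'n^'n \<Rightarrow> real^'n^'n \<Rightarrow> bool" where
  "is_pseudoinverse A X \<longleftrightarrow>
     A ** X ** A = A \<and> X ** A ** X = X \<and>
     transpose (A ** X) = A ** X \<and> transpose (X ** A) = X ** A"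

definition pseudoinverse :: "real^'n^'n \<Rightarrow> real^'n^'n" where
  "pseudoinverse A = (THE X. is_pseudoinverse A X)"

lemma is_pseudoinverse_unique:
  assumes X: "is_pseudoinverse A X" and Y: "is_pseudoinverse A Y"
  shows "X = Y"
proof -
  have X1: "A ** X ** A = A" and X2: "X ** A ** X = X"
    and X3: "transpose (A ** X) = A ** X" and X4: "transpose (X ** A) = X ** A"
    using X unfolding is_pseudoinverse_def by blast+
  have Y1: "A ** Y ** A = A" and Y2: "Y ** A ** Y = Y"
    and Y3: "transpose (A ** Y) = A ** Y" and Y4: "transpose (Y ** A) = Y ** A"
    using Y unfolding is_pseudoinverse_def by blast+
  have AXAY: "A ** X = A ** Y"
  proof -
    have "A ** X = A ** Y ** (A ** X)"
      by (simp only: matrix_mul_assoc Y1)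
    then have "transpose (A ** X) = transpose (A ** X) ** transpose (A ** Y)"
      by (metis matrix_transpose_mul)
    also have "\<dots> = A ** X ** (A ** Y)"
      unfolding X3 Y3 ..
    also have "\<dots> = A ** Y"
      by (simp only: matrix_mul_assoc X1)
    finally show ?thesis
      unfolding X3 .
  qed
  have XAYA: "X ** A = Y ** A"
  proof -
    have "X ** A = X ** A ** (Y ** A)"
      using Y1 by (metis matrix_mul_assoc)
    then have "transpose (X ** A) = transpose (Y ** A) ** transpose (X ** A)"
      by (metis matrix_transpose_mul)
    also have "\<dots> = Y ** A ** (X ** A)"
      unfolding X4 Y4 ..
    also have "\<dots> = Y ** A"
      using X1 by (metis matrix_mul_assoc)
    finally show ?thesis
      unfolding X4 .
  qed
  have "X = X ** (A ** X)"
    by (simp only: matrix_mul_assoc X2)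
  also have "\<dots> = X ** A ** Y"
    by (simp only: AXAY matrix_mul_assoc)
  also have "\<dots> = Y"
    by (simp only: XAYA Y2)
  finally show ?thesis .
qed

definition diag_matrix :: "real^'m \<Rightarrow> real^'m^'m" where
  "diag_matrix d = (\<chi> i j. if i = j then d $ i else 0)"

lemma diag_matrix_mult: "diag_matrix a ** diag_matrix b = diag_matrix (\<chi> i. a $ i * b $ i)"
proof -
  have "(\<Sum>k\<in>UNIV. (if i = k then a $ i else 0) * (if k = j then b $ k else 0))
      = (if i = j then a $ i * b $ i else 0)" for i j
  proof -
    have "(\<Sum>k\<in>UNIV. (if i = k then a $ i else 0) * (if k = j then b $ k else 0))
        = (\<Sum>k\<in>UNIV. if i = k then (if i = j then a $ i * b $ i else 0) else 0)"
      by (rule sum.cong) auto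
    then show ?thesis by simp
  qed
  then show ?thesis
    by (simp add: diag_matrix_def matrix_matrix_mult_def vec_eq_iff)
qed

lemma transpose_diag_matrix: "transpose (diag_matrix a) = diag_matrix a"
  by (auto simp: diag_matrix_def transpose_def vec_eq_iff)

text \<open>The usual expression of the pseudoinverse of a symmetric matrix: the columns of \<open>R\<close> are
  orthonormal eigenvectors for the nonzero eigenvalues \<open>d\<close>.\<close>

lemma pseudoinverse_spectral:
  fixes R :: "real^'m^'n" and d :: "real^'m"
  assumes orth: "transpose R ** R = mat 1" and nz: "\<And>i. d $ i \<noteq> 0"
    and A: "A = R ** diag_matrix d ** transpose R"
  shows "pseudoinverse A = R ** diag_matrix (\<chi> i. inverse (d $ i)) ** transpose R"
proof -
  let ?D = "diag_matrix d" and ?E = "diag_matrix (\<chi> i. inverse (d $ i))"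
  let ?X = "R ** ?E ** transpose R"
  have one: "diag_matrix (\<chi> i. 1) = mat 1"
    by (simp add: diag_matrix_def mat_def vec_eq_iff)
  have DE: "?D ** ?E = mat 1" "?E ** ?D = mat 1"
    using nz by (simp_all add: diag_matrix_mult one)
  have collapse: "R ** S ** transpose R ** (R ** T ** transpose R)
      = R ** (S ** T) ** transpose R" for S T
  proof -
    have "R ** S ** transpose R ** (R ** T ** transpose R)
        = R ** S ** (transpose R ** R) ** T ** transpose R"
      by (simp only: matrix_mul_assoc)
    then show ?thesis by (simp add: orth matrix_mul_assoc)
  qed
  have AX: "A ** ?X = R ** transpose R" and XA: "?X ** A = R ** transpose R"
    unfolding A collapse DE by simp_all
  have proj: "R ** transpose R ** (R ** T ** transpose R) = R ** T ** transpose R" for T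
    using collapse[of "mat 1" T] by simp
  have "is_pseudoinverse A ?X"
    unfolding is_pseudoinverse_def AX XA
    by (simp add: proj A matrix_transpose_mul transpose_transpose)
  then show ?thesis
    unfolding pseudoinverse_def using is_pseudoinverse_unique by blast
qed

definition grad :: "('a::real_inner \<Rightarrow> real) \<Rightarrow> 'a \<Rightarrow> 'a" where
  "grad f x = (THE D. GDERIV f x :> D)"

text \<open>An undirected graph on the vertex type is a symmetric relation \<open>E\<close>.\<close>

definition connected_graph :: "('n \<times> 'n) set \<Rightarrow> bool" where
  "connected_graph E \<longleftrightarrow> sym E \<and> (\<forall>i j. (i, j) \<in> E\<^sup>*)"

definition weighted_laplacian :: "('n \<times> 'n) set \<Rightarrow> real^'n^'n \<Rightarrow> bool" where
  "weighted_laplacian E L \<longleftrightarrow>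
     transpose L = L \<and>
     (\<forall>i j. i \<noteq> j \<longrightarrow> (if (i, j) \<in> E then L $ i $ j < 0 else L $ i $ j = 0)) \<and>
     (\<forall>i. L $ i $ i = - (\<Sum>j\<in>UNIV - {i}. L $ i $ j))"

definition avg :: "('n::finite \<Rightarrow> 'b::real_vector) \<Rightarrow> 'b" where
  "avg x = (1 / real CARD('n)) *\<^sub>R (\<Sum>i\<in>UNIV. x i)"

definition favg :: "('n::finite \<Rightarrow> 'b \<Rightarrow> real) \<Rightarrow> 'b \<Rightarrow> real" where
  "favg f x = avg (\<lambda>i. f i x)"

definition primal_dual_sgd ::
  "'w measure \<Rightarrow> real^'n^'n \<Rightarrow> ('n \<Rightarrow> real^'p \<Rightarrow> 's \<Rightarrow> real^'p) \<Rightarrow> ('n \<Rightarrow> nat \<Rightarrow> 'w \<Rightarrow> 's) \<Rightarrow>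
   (nat \<Rightarrow> real) \<Rightarrow> (nat \<Rightarrow> real) \<Rightarrow> (nat \<Rightarrow> real) \<Rightarrow> ('n \<Rightarrow> real^'p) \<Rightarrow>
   ('n \<Rightarrow> nat \<Rightarrow> 'w \<Rightarrow> real^'p) \<Rightarrow> ('n \<Rightarrow> nat \<Rightarrow> 'w \<Rightarrow> real^'p) \<Rightarrow> bool" where
  "primal_dual_sgd M L g \<xi> \<alpha> \<beta> \<eta> x0 x v \<longleftrightarrow>
     (\<forall>\<omega>\<in>space M. \<forall>i.
        x i 0 \<omega> = x0 i \<and> v i 0 \<omega> = 0 \<and>
        (\<forall>k.
          x i (Suc k) \<omega> = x i k \<omega> - \<eta> k *\<^sub>R
            (\<alpha> k *\<^sub>R (\<Sum>j\<in>UNIV. L $ i $ j *\<^sub>R x j k \<omega>) + \<beta> k *\<^sub>R v i k \<omega> + g i (x i k \<omega>) (\<xi> i k \<omega>)) \<and>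
          v i (Suc k) \<omega> = v i k \<omega> + (\<eta> k * \<beta> k) *\<^sub>R (\<Sum>j\<in>UNIV. L $ i $ j *\<^sub>R x j k \<omega>)))"

definition c1 :: "real^'n^'n \<Rightarrow> real" where
  "c1 L = 1 / rho2 L + 1"

definition eps1 :: "real^'n^'n \<Rightarrow> real \<Rightarrow> real" where
  "eps1 L \<kappa>1 = (\<kappa>1 - 1) * rho2 L - 1"

definition eps2 :: "real^'n^'n \<Rightarrow> real \<Rightarrow> real" where
  "eps2 L \<kappa>1 = spectral_radius L + (2 * \<kappa>1^2 + 1) * spectral_radius (L ** L) + 1"

definition c2 :: "real^'n^'n \<Rightarrow> real \<Rightarrow> real" where
  "c2 L \<kappa>1 = min (eps1 L \<kappa>1 / eps2 L \<kappa>1) (1 / 5)"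

definition kappa3 :: "real^'n^'n \<Rightarrow> real \<Rightarrow> real" where
  "kappa3 L \<kappa>1 = 1 / rho2 L + \<kappa>1 + 1"

definition kappa4 :: "real^'n^'n \<Rightarrow> real \<Rightarrow> real" where
  "kappa4 L \<kappa>1 = 1 / rho2 L + \<kappa>1 + 3 / 2"

definition kappa5 :: "real^'n^'n \<Rightarrow> real \<Rightarrow> real" where
  "kappa5 L \<kappa>1 = (\<kappa>1 + 1) / 2 + 1 / (2 * rho2 L)"

definition kappa6 :: "real^'n^'n \<Rightarrow> real \<Rightarrow> real" where
  "kappa6 L \<kappa>1 = min (1 / (2 * spectral_radius L)) ((\<kappa>1 - 1) / (2 * \<kappa>1))"

definition eps3 :: "real^'n^'n \<Rightarrow> real \<Rightarrow> real \<Rightarrow> real" where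
  "eps3 L \<kappa>1 \<kappa>2 = eps1 L \<kappa>1 * \<kappa>2 - eps2 L \<kappa>1 * \<kappa>2^2"

definition eps4 :: "real \<Rightarrow> real" where
  "eps4 \<kappa>2 = 1 / 2 * (\<kappa>2 - 5 * \<kappa>2^2)"

definition eps6 :: "real^'n^'n \<Rightarrow> real \<Rightarrow> real \<Rightarrow> real" where
  "eps6 L Lf \<kappa>1 = max (1 / 2 * (2 + 3 * Lf^2)) (kappa3 L \<kappa>1)"

definition eps5 :: "real^'n^'n \<Rightarrow> real \<Rightarrow> real \<Rightarrow> real \<Rightarrow> real" where
  "eps5 L Lf \<kappa>1 \<kappa>2 = Lf + 1 / (\<kappa>2 * eps6 L Lf \<kappa>1) * kappa3 L \<kappa>1 * Lf^2
     + 2 / (eps6 L Lf \<kappa>1)^2 * kappa4 L \<kappa>1 * Lf^2"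

definition c0 :: "real^'n^'n \<Rightarrow> real \<Rightarrow> real \<Rightarrow> real \<Rightarrow> real" where
  "c0 L Lf \<kappa>1 \<kappa>2 = max (4 * \<kappa>2 * eps5 L Lf \<kappa>1 \<kappa>2) (eps6 L Lf \<kappa>1)"

definition centering :: "real^('n::finite \<times> 'p::finite)^('n \<times> 'p)" where
  "centering = kronecker (mat 1 - (1 / real CARD('n)) *\<^sub>R (\<chi> i j. 1)) (mat 1)"

definition W0 ::
  "real^'n^'n \<Rightarrow> ('n \<Rightarrow> real^'p \<Rightarrow> real) \<Rightarrow> real \<Rightarrow> real \<Rightarrow> real \<Rightarrow>
   ('n \<Rightarrow> real^'p) \<Rightarrow> ('n \<Rightarrow> real^'p) \<Rightarrow> real" where
  "W0 L f fstar \<kappa>1 \<beta> x0 v0 =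
     (let K = centering;
          Q = kronecker (pseudoinverse L) (mat 1);
          u = stack v0 + (1 / \<beta>) *\<^sub>R stack (\<lambda>i. grad (f i) (avg x0))
      in 1 / 2 * wnorm_sq K (stack x0) + 1 / 2 * wnorm_sq (Q + \<kappa>1 *\<^sub>R K) u
         + stack x0 \<bullet> (K *v u) + real CARD('n) * (favg f (avg x0) - fstar))"

end

theory Submission
  imports Defs
begin

text \<open>Write \<open>y\<close> for the centred primal iterate, \<open>g\<close> for the stack of the gradients of the \<open>f i\<close> at the
  average iterate, and \<open>w\<close> for the centring of \<open>v + g / \<beta>\<close>. Expanding \<open>W\<close> at the next iterate, the terms
  of first order in \<open>\<kappa>2\<close>
  that couple \<open>y\<close> and \<open>w\<close> cancel, because \<open>Q L y = y\<close>; what remains is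
  \<open>-(\<kappa>1 - 1) y \<bullet> L y - \<bar>w\<bar>\<^sup>2\<close>, errors controlled by Young's inequality and smoothness, and the
  descent of \<open>f\<close> along the averaged iterate, to which the Polyak-Lojasiewicz condition applies.
  This gives, for every realisation \<open>s\<close> of the gradient noise with average \<open>s\<bar>\<close>,
  \<open>W' \<le> (1 - \<eta>\<epsilon>) W + h \<bullet> s + \<epsilon>5 \<eta>\<^sup>2 n \<bar>s\<bar>\<bar>\<^sup>2 + \<eta>\<^sup>2 \<bar>s\<bar>\<^sup>2\<close>, where \<open>h\<close> depends on the past only.
  In expectation the linear term vanishes and, the agents being independent, the quadratic terms
  are at most \<open>(\<epsilon>5 + n) \<eta>\<^sup>2 \<sigma>\<^sup>2\<close>; iterating gives the bound.\<close>

section \<open>Extremal eigenvalues of the Laplacian\<close>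

text \<open>The noiseless algorithm rests only where the agents agree and \<open>v\<close> balances
  \<open>g / \<beta>\<close>, so \<open>y\<close> and \<open>w\<close> measure the distance from
  such a state. The equation of \<open>w\<close> has no damping of its own; the cross term
  \<open>y \<bullet> w\<close> supplies it, because \<open>y\<close> receives
  \<open>- \<kappa>2 w\<close>. Its price is one \<open>y \<bullet> L y\<close>, hence the factor
  \<kappa>1 - 1. The weight \<kappa>1 on |w|^2 cancels the coupling of \<open>w\<close> with
  \<open>L y\<close> that the cross term creates, and keeps the form positive. The obstacle is that
  \<open>g\<close> moves between steps. Taken at the average, it moves only with the averaged
  stochastic gradient, that is p plus the averaged noise, where p is the average of the local
  gradients. The part of this error due to p is paid by the term -(\<eta>/2) n |p|^2 which the
  descent of \<open>f\<close> leaves over; this is why \<beta> must exceed 4 \<kappa>2 \<epsilon>5.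
  The inequality is proved pathwise, so the probabilistic part only has to justify three moments of
  the noise and the integrability of the potential. Spectral facts come from maximising Rayleigh
  quotients and completing squares.\<close>

lemma symmetric_matrix_inner:
  fixes A :: "real^'n^'n"
  assumes "transpose A = A"
  shows "u \<bullet> (A *v w) = (A *v u) \<bullet> w"
  using assms by (metis dot_lmul_matrix vector_transpose_matrix)

text \<open>Eigenvectors for distinct eigenvalues are orthogonal, so one per eigenvalue forms an
  independent set. Finiteness gives the \<open>Min\<close> and \<open>Max\<close> in
  \<open>rho2\<close> and \<open>spectral_radius\<close> their meaning.\<close>

lemma finite_eigenvalues_symmetric:
  fixes A :: "real^'n^'n"
  assumes sym: "transpose A = A"
  shows "finite {c. eigenvalue A c}"
proof -
  define e where "e c = (SOME v. v \<noteq> 0 \<and> A *v v = c *s v)" for c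
  have e: "e c \<noteq> 0" "A *v e c = c *\<^sub>R e c" if "eigenvalue A c" for c
    using someI_ex[of "\<lambda>v. v \<noteq> 0 \<and> A *v v = c *s v"] that
    unfolding e_def eigenvalue_def by (auto simp: scalar_mult_eq_scaleR)
  have orth: "e c \<bullet> e d = 0" if "eigenvalue A c" "eigenvalue A d" "c \<noteq> d" for c d
  proof -
    have "c * (e c \<bullet> e d) = d * (e c \<bullet> e d)"
      using symmetric_matrix_inner[OF sym, of "e c" "e d"] e that by simp
    then show ?thesis using that(3) by simp
  qed
  have inj: "inj_on e {c. eigenvalue A c}"
    by (intro inj_onI) (metis orth e(1) inner_eq_zero_iff mem_Collect_eq)
  have "independent (e ` {c. eigenvalue A c})"
  proof (rule pairwise_orthogonal_independent)
    show "pairwise orthogonal (e ` {c. eigenvalue A c})"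
      by (auto simp: pairwise_def orthogonal_def intro!: orth)
    show "0 \<notin> e ` {c. eigenvalue A c}" using e by auto
  qed
  then have "finite (e ` {c. eigenvalue A c})"
    by (rule independent_imp_finite)
  then show ?thesis using inj by (rule finite_imageD)
qed

text \<open>First-order optimality on the unit sphere of an invariant subspace produces an
  eigenvector. The subspace allows the application to \<open>- L\<close> on the vectors of mean
  zero.\<close>

lemma rayleigh_maximum:
  fixes A :: "real^'n^'n"
  assumes sym: "transpose A = A" and T: "subspace T" "T \<noteq> {0}"
    and inv: "\<And>u. u \<in> T \<Longrightarrow> A *v u \<in> T"
  obtains u c where "u \<in> T" "norm u = 1" "A *v u = c *\<^sub>R u"
    "\<And>w. w \<in> T \<Longrightarrow> w \<bullet> (A *v w) \<le> c * (norm w)\<^sup>2"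
proof -
  have "compact (T \<inter> sphere 0 1)"
    using T(1) closed_subspace by (metis closed_Int_compact compact_sphere)
  moreover have "T \<inter> sphere 0 1 \<noteq> {}"
  proof -
    obtain w where w: "w \<in> T" "w \<noteq> 0" using T subspace_0 by blast
    then have "(1 / norm w) *\<^sub>R w \<in> T \<inter> sphere 0 1"
      using T(1) by (auto simp: subspace_scale)
    then show ?thesis by blast
  qed
  moreover have "continuous_on (T \<inter> sphere 0 1) (\<lambda>u. u \<bullet> (A *v u))"
    by (intro continuous_on_inner continuous_on_id matrix_vector_mult_linear_continuous_on)
  ultimately obtain u where u: "u \<in> T" "norm u = 1"
    and umax: "\<And>w. w \<in> T \<Longrightarrow> norm w = 1 \<Longrightarrow> w \<bullet> (A *v w) \<le> u \<bullet> (A *v u)"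
    using continuous_attains_sup by fastforce
  define c where "c = u \<bullet> (A *v u)"
  have bound: "w \<bullet> (A *v w) \<le> c * (norm w)\<^sup>2" if "w \<in> T" for w
  proof (cases "w = 0")
    case False
    have "(1 / norm w) *\<^sub>R w \<in> T" "norm ((1 / norm w) *\<^sub>R w) = 1"
      using that T(1) False by (auto simp: subspace_scale)
    from umax[OF this] show ?thesis
      using False by (simp add: c_def matrix_vector_mult_scaleR field_simps power2_eq_square)
  qed auto
  \<comment> \<open>\<open>q\<close> is nonnegative on \<open>T\<close> and vanishes at
    \<open>u\<close>, so it cannot have a nonzero slope at \<open>u\<close> in the direction of the
    residual \<open>r\<close>; invariance keeps \<open>r\<close> in \<open>T\<close>.\<close>
  define r where "r = c *\<^sub>R u - A *v u"
  define q where "q w = c * (norm w)\<^sup>2 - w \<bullet> (A *v w)" for w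
  have rT: "r \<in> T" unfolding r_def using u T(1) inv by (auto intro: subspace_diff subspace_scale)
  have q0: "q w \<ge> 0" if "w \<in> T" for w using bound[OF that] by (simp add: q_def)
  have qu: "q u = 0" by (simp add: q_def c_def u)
  have "q (u + t *\<^sub>R r) = 2 * t * (norm r)\<^sup>2 + t\<^sup>2 * q r" for t
  proof -
    have "q (u + t *\<^sub>R r) = q u + 2 * t * (c * (u \<bullet> r) - (A *v u) \<bullet> r) + t\<^sup>2 * q r"
      using symmetric_matrix_inner[OF sym, of u r]
      unfolding q_def power2_norm_eq_inner
      by (simp add: inner_add matrix_vector_right_distrib
          matrix_vector_mult_scaleR inner_commute algebra_simps power2_eq_square)
    moreover have "c * (u \<bullet> r) - (A *v u) \<bullet> r = (norm r)\<^sup>2"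
      by (simp add: r_def power2_norm_eq_inner inner_diff algebra_simps)
    ultimately show ?thesis using qu by simp
  qed
  moreover have "q (u + t *\<^sub>R r) \<ge> 0" for t
    using u rT T(1) by (intro q0) (auto intro: subspace_add subspace_scale)
  ultimately have pos: "0 \<le> 2 * t * (norm r)\<^sup>2 + t\<^sup>2 * q r" for t by metis
  have "norm r = 0"
  proof (rule ccontr)
    assume "norm r \<noteq> 0"
    then have R: "(norm r)\<^sup>2 > 0" by simp
    have Q: "q r \<ge> 0" by (rule q0[OF rT])
    \<comment> \<open>The summand 1 keeps the denominator positive when \<open>q r = 0\<close>. For
      this negative \<open>t\<close> the expression becomes
      \<open>t * ((norm r)\<^sup>2 - t)\<close>, which is negative.\<close>
    define t where "t = - (norm r)\<^sup>2 / (q r + 1)"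
    have t: "t < 0" using R Q by (simp add: t_def divide_neg_pos)
    have "t * (q r + 1) = - (norm r)\<^sup>2" using Q by (simp add: t_def)
    then have "t * q r = - (norm r)\<^sup>2 - t" by (simp add: algebra_simps)
    then have "t * (2 * (norm r)\<^sup>2 + t * q r) = t * ((norm r)\<^sup>2 - t)" by simp
    then have "2 * t * (norm r)\<^sup>2 + t\<^sup>2 * q r = t * ((norm r)\<^sup>2 - t)"
      by (simp add: power2_eq_square[of t] distrib_left mult.assoc mult.left_commute)
    moreover have "t * ((norm r)\<^sup>2 - t) < 0" using t R by (intro mult_neg_pos) linarith+
    ultimately show False using pos[of t] by simp
  qed
  then have "A *v u = c *\<^sub>R u" by (simp add: r_def)
  with u bound that show thesis by blast
qed

text \<open>For an eigenvector a + ib, equating \<open>a \<bullet> A b\<close> with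
  \<open>A a \<bullet> b\<close> gives Im c (|a|^2 + |b|^2) = 0, and whichever of a, b is nonzero is
  a real eigenvector. The complex definition of \<open>spectral_radius\<close> thereby reduces to
  real eigenvalues.\<close>

lemma complex_eigenvalue_symmetric:
  fixes A :: "real^'n^'n" and c :: complex
  assumes sym: "transpose A = A"
    and c: "eigenvalue (\<chi> i j. complex_of_real (A $ i $ j)) c"
  shows "eigenvalue A (Re c)" "Im c = 0"
proof -
  obtain z where z: "z \<noteq> 0" "(\<chi> i j. complex_of_real (A $ i $ j)) *v z = c *s z"
    using c by (auto simp: eigenvalue_def)
  define a b :: "real^'n" where "a = (\<chi> i. Re (z $ i))" and "b = (\<chi> i. Im (z $ i))"
  have zi: "(\<Sum>j\<in>UNIV. complex_of_real (A $ i $ j) * z $ j) = c * z $ i" for i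
    using z(2) by (simp add: vec_eq_iff matrix_vector_mult_def)
  have Aa: "A *v a = Re c *\<^sub>R a - Im c *\<^sub>R b"
    using arg_cong[OF zi, of Re] by (simp add: vec_eq_iff matrix_vector_mult_def a_def b_def)
  have Ab: "A *v b = Im c *\<^sub>R a + Re c *\<^sub>R b"
    using arg_cong[OF zi, of Im]
    by (simp add: vec_eq_iff matrix_vector_mult_def a_def b_def algebra_simps)
  have ab: "a \<noteq> 0 \<or> b \<noteq> 0"
    using z(1) by (auto simp: vec_eq_iff a_def b_def complex_eq_iff)
  have "Im c * (a \<bullet> a + b \<bullet> b) = 0"
    using symmetric_matrix_inner[OF sym, of a b] unfolding Aa Ab
    by (simp add: inner_add inner_diff inner_commute algebra_simps)
  moreover have "a \<bullet> a + b \<bullet> b > 0"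
    using ab by (metis add_nonneg_pos add_pos_nonneg inner_ge_zero inner_gt_zero_iff)
  ultimately show "Im c = 0" by simp
  with Aa Ab ab show "eigenvalue A (Re c)"
    by (auto simp: eigenvalue_def scalar_mult_eq_scaleR)
qed

lemma eigenvalue_le_spectral_radius:
  fixes A :: "real^'n^'n"
  assumes sym: "transpose A = A" and c: "eigenvalue A c"
  shows "\<bar>c\<bar> \<le> spectral_radius A"
proof -
  let ?C = "\<chi> i j. complex_of_real (A $ i $ j)"
  obtain v where v: "v \<noteq> 0" "A *v v = c *s v" using c by (auto simp: eigenvalue_def)
  have "(\<chi> i. complex_of_real (v $ i)) \<noteq> 0" using v(1) by (auto simp: vec_eq_iff)
  moreover have "?C *v (\<chi> i. complex_of_real (v $ i)) = complex_of_real c *s (\<chi> i. complex_of_real (v $ i))"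
    using v(2) by (auto simp: vec_eq_iff matrix_vector_mult_def simp flip: of_real_mult of_real_sum)
  ultimately have "eigenvalue ?C (complex_of_real c)" unfolding eigenvalue_def by blast
  moreover have "finite {norm c | c. eigenvalue ?C c}"
  proof (rule finite_subset)
    show "{norm c | c. eigenvalue ?C c} \<subseteq> abs ` {c. eigenvalue A c}"
      using complex_eigenvalue_symmetric[OF sym] by (force simp: cmod_def)
    show "finite (abs ` {c. eigenvalue A c})"
      by (intro finite_imageI finite_eigenvalues_symmetric sym)
  qed
  ultimately show ?thesis unfolding spectral_radius_def
    by (intro Max_ge) (auto intro!: exI[of _ "complex_of_real c"])
qed

lemma inner_le_spectral_radius:
  fixes A :: "real^'n^'n"
  assumes sym: "transpose A = A"
  shows "u \<bullet> (A *v u) \<le> spectral_radius A * (norm u)\<^sup>2"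
proof -
  have "(UNIV :: (real^'n) set) \<noteq> {0}"
    by (metis UNIV_I singletonD zero_neq_one)
  then obtain e c where ec: "norm e = 1" "A *v e = c *\<^sub>R e"
    and le: "\<And>w. w \<bullet> (A *v w) \<le> c * (norm w)\<^sup>2"
    using rayleigh_maximum[OF sym, of UNIV] by auto
  have "eigenvalue A c"
    using ec by (auto simp: eigenvalue_def scalar_mult_eq_scaleR intro!: exI[of _ e])
  then have "c \<le> spectral_radius A"
    using eigenvalue_le_spectral_radius[OF sym] by force
  then show ?thesis
    using le[of u] by (meson mult_right_mono order_trans zero_le_power2)
qed

text \<open>With a single vertex \<open>L\<close> is zero and has no positive eigenvalue, so
  \<open>rho2 L\<close> would be a minimum over the empty set; hence two vertices.\<close>

locale connected_laplacian =
  fixes E :: "('n::finite \<times> 'n) set" and L :: "real^'n^'n"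
  assumes laplacian: "weighted_laplacian E L" and conn: "connected_graph E"
    and card: "CARD('n) \<ge> 2"
begin

lemma sym: "transpose L = L"
  using laplacian by (simp add: weighted_laplacian_def)

lemma sym_entry: "L $ i $ j = L $ j $ i"
  using sym by (metis transpose_def vec_lambda_beta)

lemma row_sum: "(\<Sum>j\<in>UNIV. L $ i $ j) = 0"
proof -
  have "(\<Sum>j\<in>UNIV. L $ i $ j) = L $ i $ i + (\<Sum>j\<in>UNIV - {i}. L $ i $ j)"
    by (simp add: sum.remove)
  then show ?thesis using laplacian by (simp add: weighted_laplacian_def)
qed

lemma col_sum: "(\<Sum>i\<in>UNIV. L $ i $ j) = 0"
  using row_sum[of j] by (simp add: sym_entry)

text \<open>After expanding the squares only the mixed terms survive, since all row and column sums
  of \<open>L\<close> are zero.\<close>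

lemma quadratic_form:
  "u \<bullet> (L *v u) = 1 / 2 * (\<Sum>i\<in>UNIV. \<Sum>j\<in>UNIV. - L $ i $ j * (u $ i - u $ j)\<^sup>2)"
proof -
  have "(\<Sum>i\<in>UNIV. \<Sum>j\<in>UNIV. - L $ i $ j * (u $ i - u $ j)\<^sup>2)
    = (\<Sum>i\<in>UNIV. \<Sum>j\<in>UNIV. 2 * (u $ i * (L $ i $ j * u $ j)) - L $ i $ j * (u $ i)\<^sup>2 - L $ i $ j * (u $ j)\<^sup>2)"
    by (intro sum.cong refl) (simp add: algebra_simps power2_eq_square)
  also have "\<dots> = 2 * (u \<bullet> (L *v u)) - (\<Sum>i\<in>UNIV. \<Sum>j\<in>UNIV. L $ i $ j * (u $ i)\<^sup>2)
     - (\<Sum>i\<in>UNIV. \<Sum>j\<in>UNIV. L $ i $ j * (u $ j)\<^sup>2)"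
    by (simp add: sum_subtractf inner_vec_def matrix_vector_mult_def sum_distrib_left)
  also have "(\<Sum>i\<in>UNIV. \<Sum>j\<in>UNIV. L $ i $ j * (u $ i)\<^sup>2) = 0"
    by (simp add: row_sum flip: sum_distrib_right)
  also have "(\<Sum>i\<in>UNIV. \<Sum>j\<in>UNIV. L $ i $ j * (u $ j)\<^sup>2) = 0"
    by (subst sum.swap) (simp add: col_sum flip: sum_distrib_right)
  finally show ?thesis by simp
qed

text \<open>The side condition serves the diagonal: there \<open>- L $ i $ i\<close> is nonpositive,
  and only the vanishing of the square saves the sign.\<close>

lemma quadratic_form_term_nonneg: "- L $ i $ j * (a - b)\<^sup>2 \<ge> 0" if "i = j \<Longrightarrow> a = b"
proof (cases "i = j")
  case True
  then show ?thesis using that by simp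
next
  case False
  then have "- L $ i $ j \<ge> 0"
    using laplacian unfolding weighted_laplacian_def by (metis less_eq_real_def neg_0_le_iff_le)
  then show ?thesis by (intro mult_nonneg_nonneg) auto
qed

lemma laplacian_nonneg: "0 \<le> u \<bullet> (L *v u)"
  unfolding quadratic_form
  by (intro mult_nonneg_nonneg sum_nonneg quadratic_form_term_nonneg) auto

text \<open>A vanishing sum of nonnegative terms forces equality across each edge, and connectedness
  propagates it along paths.\<close>

lemma laplacian_kernel:
  assumes "u \<bullet> (L *v u) = 0"
  shows "u $ i = u $ j"
proof -
  have 0: "- L $ i $ j * (u $ i - u $ j)\<^sup>2 = 0" for i j
  proof -
    have nonneg: "0 \<le> - L $ i $ j * (u $ i - u $ j)\<^sup>2" for i j
      by (rule quadratic_form_term_nonneg) simp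
    have "(\<Sum>i\<in>UNIV. \<Sum>j\<in>UNIV. - L $ i $ j * (u $ i - u $ j)\<^sup>2) = 0"
      using assms unfolding quadratic_form by simp
    then have "(\<Sum>j\<in>UNIV. - L $ i $ j * (u $ i - u $ j)\<^sup>2) = 0"
      by (rule sum_nonneg_0[rotated 2]) (rule finite UNIV_I sum_nonneg nonneg)+
    then show ?thesis
      by (rule sum_nonneg_0[rotated 2]) (rule finite UNIV_I nonneg)+
  qed
  have edge: "u $ i = u $ j" if "(i, j) \<in> E" for i j
  proof (cases "i = j")
    case False
    then have "L $ i $ j < 0" using that laplacian by (auto simp: weighted_laplacian_def)
    then show ?thesis using 0[of i j] by auto
  qed auto
  have "(i, j) \<in> E\<^sup>*" using conn by (auto simp: connected_graph_def)
  then show ?thesis by (induction rule: rtrancl_induct) (auto dest: edge)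
qed

text \<open>Maximising the form of \<open>- L\<close> over mean-zero vectors yields an eigenvalue
  \<open>- c\<close> of \<open>L\<close>. It is positive, because a null vector would be constant
  and of mean zero. Hence it competes in the minimum that defines \<open>rho2\<close>, and
  \<open>rho2 L \<le> - c\<close> is what the bound uses.\<close>

lemma rho2_lower_bound:
  shows "0 < rho2 L"
    and "(\<Sum>i\<in>UNIV. u $ i) = 0 \<Longrightarrow> rho2 L * (norm u)\<^sup>2 \<le> u \<bullet> (L *v u)"
proof -
  define T where "T = {u :: real^'n. (\<Sum>i\<in>UNIV. u $ i) = 0}"
  have subT: "subspace T"
    by (auto simp: T_def subspace_def sum.distrib simp flip: sum_distrib_left)
  have neg: "(- L) *v u = - (L *v u)" for u
    by (simp add: vec_eq_iff matrix_vector_mult_def sum_negf)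
  have inv: "(- L) *v u \<in> T" for u
  proof -
    have "(\<Sum>i\<in>UNIV. (L *v u) $ i) = (\<Sum>j\<in>UNIV. (\<Sum>i\<in>UNIV. L $ i $ j) * u $ j)"
      unfolding matrix_vector_mult_def by (simp add: sum_distrib_right) (rule sum.swap)
    then show ?thesis by (simp add: T_def neg sum_negf col_sum)
  qed
  have "T \<noteq> {0}"
  proof -
    obtain i j :: 'n where ij: "i \<noteq> j"
      using card card_le_Suc0_iff_eq[of "UNIV :: 'n set"] by fastforce
    have "axis i 1 - axis j 1 \<in> T"
      by (simp add: T_def axis_def sum_subtractf)
    moreover have "axis i 1 - axis j 1 \<noteq> (0 :: real^'n)"
      using ij by (simp add: axis_eq_axis)
    ultimately show ?thesis by blast
  qed
  moreover have "transpose (- L) = - L"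
    using sym by (simp add: transpose_def vec_eq_iff)
  ultimately obtain e c where e: "e \<in> T" "norm e = 1" and "(- L) *v e = c *\<^sub>R e"
    and max: "\<And>w. w \<in> T \<Longrightarrow> w \<bullet> ((- L) *v w) \<le> c * (norm w)\<^sup>2"
    using rayleigh_maximum[of "- L" T] subT inv by metis
  then have Le: "L *v e = (- c) *\<^sub>R e"
    by (metis neg minus_equation_iff scaleR_minus_left)
  have ev: "eigenvalue L (- c)"
    using e Le by (auto simp: eigenvalue_def scalar_mult_eq_scaleR intro!: exI[of _ e])
  have eLe: "e \<bullet> (L *v e) = - c" using e by (simp add: Le dot_square_norm)
  have "- c \<noteq> 0"
  proof
    assume "- c = 0"
    then have "e $ i = e $ j" for i j using laplacian_kernel eLe by simp
    then have "(\<Sum>i\<in>UNIV. e $ i) = real CARD('n) * e $ j" for j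
      by (metis sum_constant sum.cong)
    then have "e = 0" using e(1) by (simp add: T_def vec_eq_iff)
    then show False using e(2) by simp
  qed
  then have c: "- c > 0" using laplacian_nonneg[of e] eLe by linarith
  have fin: "finite {c. 0 < c \<and> eigenvalue L c}"
    by (rule finite_subset[OF _ finite_eigenvalues_symmetric[OF sym]]) auto
  have rho: "rho2 L \<le> - c" unfolding rho2_def by (intro Min_le fin) (use ev c in auto)
  have "rho2 L \<in> {c. 0 < c \<and> eigenvalue L c}"
    unfolding rho2_def by (intro Min_in fin) (use ev c in blast)
  then show "0 < rho2 L" by simp
  assume "(\<Sum>i\<in>UNIV. u $ i) = 0"
  then have "- c * (norm u)\<^sup>2 \<le> u \<bullet> (L *v u)" using max[of u] by (simp add: T_def neg)
  moreover have "rho2 L * (norm u)\<^sup>2 \<le> - c * (norm u)\<^sup>2" using rho by (intro mult_right_mono) auto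
  ultimately show "rho2 L * (norm u)\<^sup>2 \<le> u \<bullet> (L *v u)" by linarith
qed

end

section \<open>Matrices acting on families of vectors\<close>

text \<open>The action of \<open>A\<close> tensored with the identity, kept as a family of blocks so
  that inner products and norms of stacked vectors are those of \<open>'b^'n\<close>.\<close>

definition act :: "real^'n^'m \<Rightarrow> 'b::real_vector^'n \<Rightarrow> 'b^'m" where
  "act A x = (\<chi> i. \<Sum>j\<in>UNIV. A $ i $ j *\<^sub>R x $ j)"

lemma linear_act: "linear (act A)"
  by (rule linearI)
    (simp_all add: act_def vec_eq_iff scaleR_right_distrib sum.distrib scaleR_sum_right mult.commute)

lemmas act_add = linear_add[OF linear_act]
  and act_diff = linear_diff[OF linear_act]
  and act_scaleR = linear_scale[OF linear_act]

lemma act_mat_1 [simp]: "act (mat 1) x = x"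
proof -
  have "(\<Sum>j\<in>UNIV. mat 1 $ i $ j *\<^sub>R x $ j) = x $ i" for i
  proof -
    have "(\<Sum>j\<in>UNIV. mat 1 $ i $ j *\<^sub>R x $ j) = (\<Sum>j\<in>UNIV. if i = j then x $ j else 0)"
      by (intro sum.cong) (auto simp: mat_def)
    then show ?thesis by simp
  qed
  then show ?thesis by (simp add: act_def vec_eq_iff)
qed

lemma act_act: "act A (act B x) = act (A ** B) x"
proof -
  have "(\<Sum>j\<in>UNIV. A $ i $ j *\<^sub>R (\<Sum>k\<in>UNIV. B $ j $ k *\<^sub>R x $ k))
    = (\<Sum>k\<in>UNIV. (\<Sum>j\<in>UNIV. A $ i $ j * B $ j $ k) *\<^sub>R x $ k)" for i
    by (simp add: scaleR_sum_right scaleR_sum_left) (rule sum.swap)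
  then show ?thesis by (simp add: act_def matrix_matrix_mult_def vec_eq_iff)
qed

lemma inner_act:
  fixes x :: "'b::real_inner^'n"
  assumes "transpose A = A"
  shows "x \<bullet> act A y = act A x \<bullet> y"
proof -
  have sym: "A $ i $ j = A $ j $ i" for i j
    using arg_cong[OF assms, of "\<lambda>B. B $ i $ j"] by (simp add: transpose_def)
  have "x \<bullet> act A y = (\<Sum>i\<in>UNIV. \<Sum>j\<in>UNIV. A $ i $ j * (x $ i \<bullet> y $ j))"
    by (simp add: inner_vec_def act_def inner_sum_right)
  also have "\<dots> = (\<Sum>j\<in>UNIV. \<Sum>i\<in>UNIV. A $ i $ j * (x $ i \<bullet> y $ j))" by (rule sum.swap)
  also have "\<dots> = act A x \<bullet> y"
    by (simp add: inner_vec_def act_def inner_sum_left sym)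
  finally show ?thesis .
qed

text \<open>Along each basis vector of the block space the form is a scalar form of
  \<open>A\<close>, so spectral bounds for \<open>A\<close> pass to \<open>act A\<close> with the
  same constant.\<close>

lemma inner_act_components:
  fixes x :: "'b::euclidean_space^'n"
  shows "x \<bullet> act A x = (\<Sum>b\<in>Basis. (\<chi> i. x $ i \<bullet> b) \<bullet> (A *v (\<chi> i. x $ i \<bullet> b)))"
proof -
  have "x \<bullet> act A x = (\<Sum>i\<in>UNIV. \<Sum>j\<in>UNIV. A $ i $ j * (x $ i \<bullet> x $ j))"
    by (simp add: inner_vec_def act_def inner_sum_right)
  also have "\<dots> = (\<Sum>i\<in>UNIV. \<Sum>j\<in>UNIV. \<Sum>b\<in>Basis. A $ i $ j * ((x $ i \<bullet> b) * (x $ j \<bullet> b)))"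
    by (subst euclidean_inner) (simp add: sum_distrib_left)
  also have "\<dots> = (\<Sum>i\<in>UNIV. \<Sum>b\<in>Basis. \<Sum>j\<in>UNIV. A $ i $ j * ((x $ i \<bullet> b) * (x $ j \<bullet> b)))"
    by (intro sum.cong refl sum.swap)
  also have "\<dots> = (\<Sum>b\<in>Basis. \<Sum>i\<in>UNIV. \<Sum>j\<in>UNIV. A $ i $ j * ((x $ i \<bullet> b) * (x $ j \<bullet> b)))"
    by (rule sum.swap)
  also have "\<dots> = (\<Sum>b\<in>Basis. (\<chi> i. x $ i \<bullet> b) \<bullet> (A *v (\<chi> i. x $ i \<bullet> b)))"
    by (simp add: inner_vec_def matrix_vector_mult_def sum_distrib_left mult.left_commute)
  finally show ?thesis .
qed

lemma norm_components:
  fixes x :: "'b::euclidean_space^'n"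
  shows "(norm x)\<^sup>2 = (\<Sum>b\<in>Basis. (norm (\<chi> i. x $ i \<bullet> b))\<^sup>2)"
  using inner_act_components[of x "mat 1"] by (simp add: dot_square_norm)

lemma inner_act_le:
  fixes x :: "'b::euclidean_space^'n"
  assumes "\<And>u. u \<bullet> (A *v u) \<le> c * (norm u)\<^sup>2"
  shows "x \<bullet> act A x \<le> c * (norm x)\<^sup>2"
  unfolding inner_act_components norm_components[of x] sum_distrib_left
  by (intro sum_mono assms)

lemma inner_act_nonneg:
  fixes x :: "'b::euclidean_space^'n"
  assumes "\<And>u. 0 \<le> u \<bullet> (A *v u)"
  shows "0 \<le> x \<bullet> act A x"
  unfolding inner_act_components by (intro sum_nonneg assms)

section \<open>Centring and the consensus subspace\<close>

definition cen :: "'b::real_vector^'n \<Rightarrow> 'b^'n" where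
  "cen x = (\<chi> i. x $ i - avg (($) x))"

lemma linear_cen: "linear cen"
  by (rule linearI)
    (simp_all add: cen_def avg_def vec_eq_iff sum.distrib scaleR_right_distrib scaleR_diff_right
      mult.commute flip: scaleR_sum_right)

lemmas cen_add = linear_add[OF linear_cen]
  and cen_diff = linear_diff[OF linear_cen]
  and cen_scaleR = linear_scale[OF linear_cen]

lemma sum_cen [simp]: "(\<Sum>i\<in>UNIV. cen x $ i) = 0"
  by (simp add: cen_def sum_subtractf sum_constant_scaleR) (simp add: avg_def)

lemma cen_ident: "(\<Sum>i\<in>UNIV. x $ i) = 0 \<Longrightarrow> cen x = x"
  by (simp add: cen_def vec_eq_iff avg_def)

lemma inner_cen:
  fixes x :: "'b::real_inner^'n"
  shows "cen x \<bullet> y = cen x \<bullet> cen y"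
proof -
  have "cen x \<bullet> (\<chi> i. c) = 0" for c
    using sum_cen[of x] by (simp add: inner_vec_def flip: inner_sum_left)
  moreover have "y = cen y + (\<chi> i. avg (($) y))" by (simp add: cen_def vec_eq_iff)
  ultimately show ?thesis by (metis add.right_neutral inner_add_right)
qed

text \<open>Pythagoras for the projection onto the consensus subspace. The contraction property of
  centring and Jensen's inequality for the average are both read off from it.\<close>

lemma norm_decomposition:
  fixes x :: "'b::real_inner^'n"
  shows "(norm x)\<^sup>2 = (norm (cen x))\<^sup>2 + real CARD('n) * (norm (avg (($) x)))\<^sup>2"
proof -
  let ?a = "(\<chi> i. avg (($) x)) :: 'b^'n"
  have x: "x = cen x + ?a" by (simp add: cen_def vec_eq_iff)
  have "cen x \<bullet> ?a = 0"
    using sum_cen[of x] by (simp add: inner_vec_def flip: inner_sum_left)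
  then have "(norm x)\<^sup>2 = (norm (cen x))\<^sup>2 + (norm ?a)\<^sup>2"
    by (subst x) (simp add: power2_norm_eq_inner inner_add inner_commute)
  then show ?thesis by (simp add: power2_norm_eq_inner inner_vec_def)
qed

lemma norm_cen_le: "norm (cen x) \<le> norm x" for x :: "'b::real_inner^'n"
  by (rule power2_le_imp_le) (simp_all add: norm_decomposition[of x])

lemma card_norm_avg_le: "real CARD('n) * (norm (avg (($) x)))\<^sup>2 \<le> (norm x)\<^sup>2"
  for x :: "'b::real_inner^'n"
  using norm_decomposition[of x] by simp

text \<open>The first factor of the Kronecker product in \<open>centering\<close>, isolated for the
  identification of \<open>W0\<close>.\<close>

definition cen_matrix :: "real^'n^'n" where
  "cen_matrix = mat 1 - (1 / real CARD('n)) *\<^sub>R (\<chi> i j. 1)"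

lemma act_cen_matrix: "act cen_matrix x = cen x"
proof -
  have "act cen_matrix x = act (mat 1) x - (\<chi> i. avg (($) x))"
    by (simp add: act_def cen_matrix_def vec_eq_iff scaleR_diff_left sum_subtractf avg_def
        scaleR_sum_right del: act_mat_1)
  then show ?thesis by (simp add: cen_def vec_eq_iff)
qed

section \<open>The pseudoinverse of the Laplacian and norm bounds\<close>

context connected_laplacian
begin

lemma cen_act_laplacian [simp]: "cen (act L x) = act L x"
proof (rule cen_ident)
  have "(\<Sum>i\<in>UNIV. act L x $ i) = (\<Sum>j\<in>UNIV. (\<Sum>i\<in>UNIV. L $ i $ j) *\<^sub>R x $ j)"
    unfolding act_def vec_lambda_beta scaleR_sum_left by (rule sum.swap)
  then show "(\<Sum>i\<in>UNIV. act L x $ i) = 0" unfolding col_sum by simp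
qed

lemma act_laplacian_cen [simp]: "act L (cen x) = act L x" for x :: "'b::real_vector^'n"
proof -
  have "act L (\<chi> i. c) = 0" for c :: 'b
    unfolding act_def vec_lambda_beta scaleR_sum_left[symmetric] row_sum by (simp add: vec_eq_iff)
  moreover have "cen x = x - (\<chi> i. avg (($) x))" by (simp add: cen_def vec_eq_iff)
  ultimately show ?thesis by (simp add: act_diff)
qed

text \<open>Adding the averaging projection \<open>P\<close> makes \<open>L\<close> invertible, and
  the inverse \<open>B\<close> of \<open>L + P\<close>, reduced by \<open>P\<close>, is the
  pseudoinverse: \<open>L P = P L = 0\<close> and \<open>B P = P B = P\<close> turn the Penrose
  conditions into matrix algebra.\<close>

lemma pseudoinverse_laplacian:
  "transpose (pseudoinverse L) = pseudoinverse L"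
  "pseudoinverse L ** L = cen_matrix" "L ** pseudoinverse L = cen_matrix"
  "pseudoinverse L ** cen_matrix = pseudoinverse L"
  "cen_matrix ** pseudoinverse L = pseudoinverse L"
proof -
  define P :: "real^'n^'n" where "P = (1 / real CARD('n)) *\<^sub>R (\<chi> i j. 1)"
  have P: "transpose P = P" "P ** P = P" "L ** P = 0" "P ** L = 0"
    by (simp_all add: P_def transpose_def vec_eq_iff matrix_matrix_mult_def row_sum col_sum
        flip: sum_divide_distrib)
  have cen: "cen_matrix = mat 1 - P" by (simp add: cen_matrix_def P_def)
  have sub: "(X - Y) ** Z = X ** Z - Y ** Z" "Z ** (X - Y) = Z ** X - Z ** Y" for X Y Z :: "real^'n^'n"
    by (simp_all add: matrix_matrix_mult_def vec_eq_iff sum_subtractf algebra_simps)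
  have add: "(X + Y) ** Z = X ** Z + Y ** Z" "Z ** (X + Y) = Z ** X + Z ** Y" for X Y Z :: "real^'n^'n"
    by (simp_all add: matrix_matrix_mult_def vec_eq_iff sum.distrib algebra_simps)
  \<comment> \<open>Both forms are nonnegative, so both vanish at \<open>u\<close>: the form of
    \<open>P\<close> gives mean zero, and then the spectral gap gives \<open>u = 0\<close>.\<close>
  have "u = 0" if "(L + P) *v u = 0" for u
  proof -
    have Pu: "u \<bullet> (P *v u) = (\<Sum>i\<in>UNIV. u $ i)\<^sup>2 / real CARD('n)"
      by (simp add: P_def inner_vec_def matrix_vector_mult_def power2_eq_square
          flip: sum_divide_distrib sum_distrib_right)
    have "u \<bullet> (L *v u) + u \<bullet> (P *v u) = 0"
      using that by (metis inner_add_right inner_zero_right matrix_vector_mult_add_rdistrib)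
    moreover have "0 \<le> u \<bullet> (P *v u)" by (simp add: Pu)
    ultimately have L0: "u \<bullet> (L *v u) = 0" and "u \<bullet> (P *v u) = 0"
      using laplacian_nonneg[of u] by auto
    then have s: "(\<Sum>i\<in>UNIV. u $ i) = 0" by (simp add: Pu)
    then have "rho2 L * (norm u)\<^sup>2 \<le> 0" using rho2_lower_bound(2)[OF s] L0 by simp
    then show "u = 0" using rho2_lower_bound(1) by (simp add: mult_le_0_iff)
  qed
  then obtain B where B: "B ** (L + P) = mat 1"
    using matrix_left_invertible_ker[of "L + P"] by blast
  then have B': "(L + P) ** B = mat 1" using matrix_left_right_inverse by blast
  have BP: "B ** P = P"
  proof -
    have "(L + P) ** P = P" using P by (simp add: add)
    then show ?thesis using B by (metis matrix_mul_assoc matrix_mul_lid)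
  qed
  have PB: "P ** B = P"
  proof -
    have "P ** (L + P) = P" using P by (simp add: add)
    then show ?thesis using B' by (metis matrix_mul_assoc matrix_mul_rid)
  qed
  have BT: "transpose B = B"
  proof -
    have T: "transpose (L + P) = L + P"
      using sym P(1) by (simp add: transpose_def vec_eq_iff)
    have "transpose B ** (L + P) = mat 1"
      using arg_cong[OF B', of transpose] by (simp add: matrix_transpose_mul T)
    then have "transpose B ** ((L + P) ** B) = B" by (simp add: matrix_mul_assoc)
    then show ?thesis by (simp add: B')
  qed
  define X where "X = B - P"
  have LB: "L ** B = mat 1 - P" using B' PB by (simp add: add algebra_simps)
  have BL: "B ** L = mat 1 - P" using B BP by (simp add: add algebra_simps)
  have XL: "X ** L = cen_matrix" and LX: "L ** X = cen_matrix"
    by (simp_all add: X_def sub P BL LB cen)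
  have cX: "cen_matrix ** X = X" and Xc: "X ** cen_matrix = X" and cL: "cen_matrix ** L = L"
    by (simp_all add: cen X_def sub P PB BP)
  have tX: "transpose X = X" "transpose cen_matrix = (cen_matrix :: real^'n^'n)"
    using BT P(1) by (simp_all add: X_def cen transpose_def vec_eq_iff mat_def)
  have "is_pseudoinverse L X"
    unfolding is_pseudoinverse_def XL LX using cX Xc cL tX by simp
  then have "pseudoinverse L = X"
    unfolding pseudoinverse_def using is_pseudoinverse_unique by blast
  then show "transpose (pseudoinverse L) = pseudoinverse L"
    "pseudoinverse L ** L = cen_matrix" "L ** pseudoinverse L = cen_matrix"
    "pseudoinverse L ** cen_matrix = pseudoinverse L"
    "cen_matrix ** pseudoinverse L = pseudoinverse L"
    using tX XL LX Xc cX by simp_all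
qed

lemma act_pseudoinverse:
  shows "act (pseudoinverse L) (act L x) = cen x" "act L (act (pseudoinverse L) x) = cen x"
    and "act (pseudoinverse L) (cen x) = act (pseudoinverse L) x"
    and "cen (act (pseudoinverse L) x) = act (pseudoinverse L) x"
  by (simp_all add: act_act pseudoinverse_laplacian flip: act_cen_matrix)

lemma inner_laplacian_lower:
  fixes y :: "'b::euclidean_space^'n"
  assumes "cen y = y"
  shows "rho2 L * (norm y)\<^sup>2 \<le> y \<bullet> act L y"
  unfolding inner_act_components norm_components[of y] sum_distrib_left
proof (intro sum_mono rho2_lower_bound(2))
  have "(\<Sum>i\<in>UNIV. y $ i) = 0" using sum_cen[of y] assms by simp
  then show "(\<Sum>i\<in>UNIV. (\<chi> i. y $ i \<bullet> b) $ i) = 0" for b by (simp flip: inner_sum_left)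
qed

lemma inner_laplacian_upper:
  fixes y :: "'b::euclidean_space^'n"
  shows "y \<bullet> act L y \<le> spectral_radius L * (norm y)\<^sup>2"
  by (intro inner_act_le inner_le_spectral_radius sym)

lemma inner_laplacian_nonneg:
  fixes y :: "'b::euclidean_space^'n"
  shows "0 \<le> y \<bullet> act L y"
  by (intro inner_act_nonneg laplacian_nonneg)

lemma norm_laplacian_upper:
  fixes y :: "'b::euclidean_space^'n"
  shows "(norm (act L y))\<^sup>2 \<le> spectral_radius (L ** L) * (norm y)\<^sup>2"
proof -
  have "(norm (act L y))\<^sup>2 = y \<bullet> act (L ** L) y"
    by (simp add: power2_norm_eq_inner inner_act[OF sym] flip: act_act)
  also have "\<dots> \<le> spectral_radius (L ** L) * (norm y)\<^sup>2"
    by (intro inner_act_le inner_le_spectral_radius) (simp add: matrix_transpose_mul sym)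
  finally show ?thesis .
qed

text \<open>A nonzero mean-zero vector, the difference of two axis vectors, is put into the upper
  bounds. Strict positivity matters because \<open>kappa6\<close> divides by
  \<open>spectral_radius L\<close>.\<close>

lemma spectral_radius_bounds: "0 < spectral_radius L" "0 \<le> spectral_radius (L ** L)"
proof -
  obtain i j :: 'n where ij: "i \<noteq> j"
    using card card_le_Suc0_iff_eq[of "UNIV :: 'n set"] by fastforce
  define e :: "real^'n" where "e = axis i 1 - axis j 1"
  have "(\<Sum>i\<in>UNIV. e $ i) = 0" by (simp add: e_def axis_def sum_subtractf)
  then have "cen e = e" by (rule cen_ident)
  moreover have e: "0 < (norm e)\<^sup>2" using ij by (simp add: e_def axis_eq_axis)
  ultimately have "0 < e \<bullet> act L e"
    using inner_laplacian_lower[of e] rho2_lower_bound(1) by (meson less_le_trans mult_pos_pos)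
  then have "0 < spectral_radius L * (norm e)\<^sup>2"
    using inner_laplacian_upper[of e] by linarith
  then show "0 < spectral_radius L" using e by (simp add: zero_less_mult_iff)
  have "0 \<le> spectral_radius (L ** L) * (norm e)\<^sup>2"
    using norm_laplacian_upper[of e] by (meson order_trans zero_le_power2)
  then show "0 \<le> spectral_radius (L ** L)" using e by (simp add: zero_le_mult_iff)
qed

text \<open>For the image \<open>z\<close> of \<open>w\<close>, the spectral gap bounds \<rho>2
  |z|^2 by \<open>z \<bullet> L z = z \<bullet> cen w\<close>; Cauchy-Schwarz and a division by |z|
  remain.\<close>

lemma norm_pseudoinverse_upper:
  fixes w :: "'b::euclidean_space^'n"
  shows "norm (act (pseudoinverse L) w) \<le> norm w / rho2 L"
proof -
  define z where "z = act (pseudoinverse L) w"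
  have z: "cen z = z" "act L z = cen w" by (simp_all add: z_def act_pseudoinverse)
  have "rho2 L * (norm z)\<^sup>2 \<le> norm z * norm w"
    using inner_laplacian_lower[OF z(1)] norm_cauchy_schwarz[of z "cen w"] norm_cen_le[of w] z(2)
      mult_left_mono[of "norm (cen w)" "norm w" "norm z"] by simp
  then have "norm z * (rho2 L * norm z) \<le> norm z * norm w"
    by (simp add: power2_eq_square mult.left_commute)
  then have "norm z = 0 \<or> rho2 L * norm z \<le> norm w"
    by (auto simp: mult_le_cancel_left)
  then show ?thesis using rho2_lower_bound(1)
    by (auto simp: z_def[symmetric] field_simps)
qed

lemma inner_pseudoinverse_upper:
  fixes w :: "'b::euclidean_space^'n"
  shows "w \<bullet> act (pseudoinverse L) w \<le> (norm w)\<^sup>2 / rho2 L"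
proof -
  have "w \<bullet> act (pseudoinverse L) w \<le> norm w * norm (act (pseudoinverse L) w)"
    by (rule norm_cauchy_schwarz)
  also have "\<dots> \<le> norm w * (norm w / rho2 L)"
    by (intro mult_left_mono norm_pseudoinverse_upper norm_ge_zero)
  finally show ?thesis by (simp add: power2_eq_square)
qed

text \<open>The nonnegative form of \<open>L\<close> is evaluated at \<open>z - r w\<close>, where
  \<open>z\<close> is the image of \<open>w\<close> and \<open>r\<close> the reciprocal of the
  spectral radius. This completes the square in place of a diagonalisation.\<close>

lemma inner_pseudoinverse_lower:
  fixes w :: "'b::euclidean_space^'n"
  assumes "cen w = w"
  shows "(norm w)\<^sup>2 / spectral_radius L \<le> w \<bullet> act (pseudoinverse L) w"
proof -
  define z where "z = act (pseudoinverse L) w"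
  define r where "r = 1 / spectral_radius L"
  have r: "r > 0" using spectral_radius_bounds(1) by (simp add: r_def)
  have Lz: "act L z = w" by (simp add: z_def act_pseudoinverse assms)
  have zw: "z \<bullet> act L w = (norm w)\<^sup>2"
    by (simp add: inner_act[OF sym] Lz power2_norm_eq_inner)
  have "0 \<le> (z - r *\<^sub>R w) \<bullet> act L (z - r *\<^sub>R w)" by (rule inner_laplacian_nonneg)
  also have "\<dots> = w \<bullet> z - 2 * r * (norm w)\<^sup>2 + r * r * (w \<bullet> act L w)"
    by (simp add: act_diff act_scaleR inner_diff Lz zw power2_norm_eq_inner inner_commute algebra_simps)
  also have "r * r * (w \<bullet> act L w) \<le> r * r * (spectral_radius L * (norm w)\<^sup>2)"
    using r by (intro mult_left_mono inner_laplacian_upper) auto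
  also have "r * r * (spectral_radius L * (norm w)\<^sup>2) = r * (norm w)\<^sup>2"
    using spectral_radius_bounds(1) by (simp add: r_def)
  finally show ?thesis by (simp add: r_def z_def[symmetric] algebra_simps)
qed

end

section \<open>Gradients and the quadratic Lyapunov function\<close>

lemma GDERIV_unique: "GDERIV f x :> D \<Longrightarrow> GDERIV f x :> D' \<Longrightarrow> D = D'"
  unfolding gderiv_def using has_derivative_unique by (metis inner_commute vector_eq_rdot)

lemma grad_eqI: "GDERIV f x :> D \<Longrightarrow> grad f x = D"
  unfolding grad_def by (blast intro: GDERIV_unique)

text \<open>The coordinates of the gradient are the values of the derivative on the basis;
  uniqueness identifies this vector with the definite description \<open>grad\<close>.\<close>

lemma GDERIV_grad:
  fixes f :: "'b::euclidean_space \<Rightarrow> real"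
  assumes "f differentiable (at x)"
  shows "GDERIV f x :> grad f x"
proof -
  obtain f' where f': "(f has_derivative f') (at x)"
    using assms by (auto simp: differentiable_def)
  then have lin: "linear f'" using has_derivative_linear by blast
  have "f' h = h \<bullet> (\<Sum>b\<in>Basis. f' b *\<^sub>R b)" for h
  proof -
    have "f' h = f' (\<Sum>b\<in>Basis. (h \<bullet> b) *\<^sub>R b)" by (simp add: euclidean_representation)
    also have "\<dots> = h \<bullet> (\<Sum>b\<in>Basis. f' b *\<^sub>R b)"
      by (simp add: linear_sum[OF lin] linear_scale[OF lin] inner_sum_right mult.commute)
    finally show ?thesis .
  qed
  then have "f' = (\<lambda>h. h \<bullet> (\<Sum>b\<in>Basis. f' b *\<^sub>R b))" by blast
  then have "GDERIV f x :> (\<Sum>b\<in>Basis. f' b *\<^sub>R b)" using f' by (simp add: gderiv_def)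
  then show ?thesis using grad_eqI by metis
qed

lemma GDERIV_favg:
  fixes f :: "'n::finite \<Rightarrow> 'b::euclidean_space \<Rightarrow> real"
  assumes "\<And>i. f i differentiable (at x)"
  shows "GDERIV (favg f) x :> avg (\<lambda>i. grad (f i) x)"
proof -
  have "(f i has_derivative (\<lambda>h. h \<bullet> grad (f i) x)) (at x)" for i
    using GDERIV_grad[OF assms[of i]] by (simp add: gderiv_def)
  then have "((\<lambda>y. (1 / real CARD('n)) *\<^sub>R (\<Sum>i\<in>UNIV. f i y)) has_derivative
      (\<lambda>h. (1 / real CARD('n)) *\<^sub>R (\<Sum>i\<in>UNIV. h \<bullet> grad (f i) x))) (at x)"
    by (intro has_derivative_scaleR_right has_derivative_sum)
  moreover have "favg f = (\<lambda>y. (1 / real CARD('n)) *\<^sub>R (\<Sum>i\<in>UNIV. f i y))"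
    by (simp add: fun_eq_iff favg_def avg_def)
  ultimately show ?thesis
    by (simp add: gderiv_def avg_def inner_sum_right)
qed

text \<open>Along the segment from \<open>y\<close> to \<open>z\<close>, the function minus its
  quadratic model has nonpositive derivative by the Lipschitz bound.\<close>

lemma descent_inequality:
  fixes f :: "'b::euclidean_space \<Rightarrow> real"
  assumes diff: "\<And>y. f differentiable (at y)"
    and lip: "\<And>y z. norm (grad f y - grad f z) \<le> K * norm (y - z)"
  shows "f z \<le> f y + grad f y \<bullet> (z - y) + K / 2 * (norm (z - y))\<^sup>2"
proof -
  define h where "h = z - y"
  define \<phi> where "\<phi> t = f (y + t *\<^sub>R h) - t * (grad f y \<bullet> h) - K / 2 * t\<^sup>2 * (norm h)\<^sup>2" for t
  have "\<phi> 1 \<le> \<phi> 0"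
  proof (rule DERIV_nonpos_imp_nonincreasing[of 0 1 \<phi>])
    fix t :: real assume t: "0 \<le> t" "t \<le> 1"
    have 1: "(f has_derivative (\<lambda>k. k \<bullet> grad f (y + t *\<^sub>R h))) (at (y + t *\<^sub>R h))"
      using GDERIV_grad[OF diff] by (simp add: gderiv_def)
    have "((\<lambda>s. f (y + s *\<^sub>R h)) has_derivative (\<lambda>s. (s *\<^sub>R h) \<bullet> grad f (y + t *\<^sub>R h))) (at t)"
      by (rule has_derivative_compose[where f = "\<lambda>s. y + s *\<^sub>R h" and g = f, OF _ 1]) (auto intro!: derivative_eq_intros)
    then have "((\<lambda>s. f (y + s *\<^sub>R h)) has_field_derivative (grad f (y + t *\<^sub>R h) \<bullet> h)) (at t)"
      by (rule has_derivative_imp_has_field_derivative) (simp add: inner_commute)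
    then have "(\<phi> has_field_derivative (grad f (y + t *\<^sub>R h) \<bullet> h - grad f y \<bullet> h - K * t * (norm h)\<^sup>2)) (at t)"
      unfolding \<phi>_def by (auto intro!: derivative_eq_intros)
    moreover have "grad f (y + t *\<^sub>R h) \<bullet> h - grad f y \<bullet> h \<le> K * t * (norm h)\<^sup>2"
    proof -
      have "grad f (y + t *\<^sub>R h) \<bullet> h - grad f y \<bullet> h \<le> norm (grad f (y + t *\<^sub>R h) - grad f y) * norm h"
        using norm_cauchy_schwarz by (simp add: inner_diff_left[symmetric])
      also have "\<dots> \<le> (K * norm (t *\<^sub>R h)) * norm h"
        using lip[of "y + t *\<^sub>R h" y] by (intro mult_right_mono) auto
      finally show ?thesis using t by (simp add: power2_eq_square mult.assoc)
    qed
    ultimately show "\<exists>d. (\<phi> has_field_derivative d) (at t) \<and> d \<le> 0" by force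
  qed simp
  then show ?thesis by (simp add: \<phi>_def h_def)
qed

text \<open>A gradient step of length 1 / K lowers \<open>f\<close> by at least |grad f y|^2 / (2
  K), and the result still lies above \<open>m\<close>. In particular, gradients vanish at
  minimisers.\<close>

lemma norm_grad_le_gap:
  fixes f :: "'b::euclidean_space \<Rightarrow> real"
  assumes "\<And>y. f differentiable (at y)" "\<And>y z. norm (grad f y - grad f z) \<le> K * norm (y - z)"
    and K: "K > 0" and min: "\<And>y. m \<le> f y"
  shows "(norm (grad f y))\<^sup>2 \<le> 2 * K * (f y - m)"
proof -
  let ?g = "grad f y"
  have "m \<le> f (y - (1 / K) *\<^sub>R ?g)" by (rule min)
  also have "\<dots> \<le> f y + ?g \<bullet> (- ((1 / K) *\<^sub>R ?g)) + K / 2 * (norm (- ((1 / K) *\<^sub>R ?g)))\<^sup>2"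
    using descent_inequality[OF assms(1,2), of "y - (1 / K) *\<^sub>R ?g" y] by simp
  also have "\<dots> = f y - 1 / (2 * K) * (norm ?g)\<^sup>2"
    using K by (simp add: power_mult_distrib power_divide dot_square_norm field_simps power2_eq_square)
  finally show ?thesis using K by (simp add: field_simps)
qed

lemma avg_diff: "avg x - avg y = avg (\<lambda>i. x i - y i)"
  by (simp add: avg_def sum_subtractf scaleR_diff_right)

lemma norm_avg_le:
  fixes x :: "'n::finite \<Rightarrow> 'b::real_normed_vector"
  assumes "\<And>i. norm (x i) \<le> c"
  shows "norm (avg x) \<le> c"
proof -
  have "norm (\<Sum>i\<in>UNIV. x i) \<le> (\<Sum>i\<in>(UNIV :: 'n set). c)"
    by (intro order_trans[OF norm_sum] sum_mono assms)
  then show ?thesis by (simp add: avg_def field_simps)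
qed

lemma inner_const_vec:
  fixes x :: "'b::real_inner^'n"
  shows "(\<chi> i. c) \<bullet> x = real CARD('n) * (c \<bullet> avg (($) x))"
proof -
  have "(\<chi> i. c) \<bullet> x = c \<bullet> (\<Sum>i\<in>UNIV. x $ i)" by (simp add: inner_vec_def inner_sum_right)
  then show ?thesis by (simp add: avg_def)
qed

definition lyap_quad :: "real^'n^'n \<Rightarrow> real \<Rightarrow> 'b::real_inner^'n \<Rightarrow> 'b^'n \<Rightarrow> real" where
  "lyap_quad L \<kappa>1 y w = 1 / 2 * (norm y)\<^sup>2 + 1 / 2 * (w \<bullet> act (pseudoinverse L) w)
     + \<kappa>1 / 2 * (norm w)\<^sup>2 + y \<bullet> w"

text \<open>\<open>l\<close>, \<open>qw\<close>, \<open>q\<delta>\<close> stand for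
  \<open>L y\<close>, \<open>Q w\<close>, \<open>Q \<delta>\<close>. The three hypotheses are all
  that is used about them, which leaves bilinear algebra. \<open>z\<close> collects what is linear
  in \<open>\<delta>\<close> apart from the noise; it contains no \<open>l\<close>, because the
  \<kappa>1 |w|^2 term and the cross term contribute opposite multiples.\<close>

lemma lyap_quad_expansion:
  fixes y w e s l \<delta> qw q\<delta> :: "'v::real_inner" and \<kappa>1 \<kappa>2 \<eta> :: real
  assumes "l \<bullet> qw = y \<bullet> w" "l \<bullet> q\<delta> = y \<bullet> \<delta>" "w \<bullet> q\<delta> = \<delta> \<bullet> qw"
  defines "a \<equiv> y - \<kappa>2 *\<^sub>R (\<kappa>1 *\<^sub>R l + w + e)"
    and "z \<equiv> qw + (\<kappa>1 - \<kappa>2) *\<^sub>R w + (1 + \<kappa>2) *\<^sub>R y - \<kappa>2 *\<^sub>R e"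
    and "y' \<equiv> y - \<kappa>2 *\<^sub>R (\<kappa>1 *\<^sub>R l + w + e) - \<eta> *\<^sub>R s"
    and "w' \<equiv> w + \<kappa>2 *\<^sub>R l + \<delta>"
  shows "1 / 2 * (y' \<bullet> y') + 1 / 2 * (w' \<bullet> (qw + \<kappa>2 *\<^sub>R y + q\<delta>)) + \<kappa>1 / 2 * (w' \<bullet> w') + y' \<bullet> w'
    = 1 / 2 * (y \<bullet> y) + 1 / 2 * (w \<bullet> qw) + \<kappa>1 / 2 * (w \<bullet> w) + y \<bullet> w
      + \<kappa>2 * (- ((\<kappa>1 - 1) * (y \<bullet> l)) - y \<bullet> e - w \<bullet> w - e \<bullet> w)
      + \<kappa>2\<^sup>2 * (1 / 2 * (\<kappa>1\<^sup>2 - \<kappa>1) * (l \<bullet> l) + 1 / 2 * (y \<bullet> l) + 1 / 2 * (w \<bullet> w) + 1 / 2 * (e \<bullet> e)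
          + (\<kappa>1 - 1) * (l \<bullet> w) + (\<kappa>1 - 1) * (l \<bullet> e) + w \<bullet> e)
      + \<delta> \<bullet> z - \<eta> * (s \<bullet> \<delta>) + 1 / 2 * (\<delta> \<bullet> q\<delta>) + \<kappa>1 / 2 * (\<delta> \<bullet> \<delta>)
      - \<eta> * (s \<bullet> (a + w + \<kappa>2 *\<^sub>R l)) + 1 / 2 * \<eta>\<^sup>2 * (s \<bullet> s)"
proof -
  have c: "w \<bullet> l = l \<bullet> w" "e \<bullet> l = l \<bullet> e" "s \<bullet> l = l \<bullet> s" "\<delta> \<bullet> l = l \<bullet> \<delta>" "y \<bullet> l = l \<bullet> y"
    "w \<bullet> y = y \<bullet> w" "e \<bullet> y = y \<bullet> e" "s \<bullet> y = y \<bullet> s" "\<delta> \<bullet> y = y \<bullet> \<delta>"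
    "e \<bullet> w = w \<bullet> e" "s \<bullet> w = w \<bullet> s" "\<delta> \<bullet> w = w \<bullet> \<delta>" "s \<bullet> e = e \<bullet> s" "\<delta> \<bullet> e = e \<bullet> \<delta>" "s \<bullet> \<delta> = \<delta> \<bullet> s"
    by (simp_all add: inner_commute)
  show ?thesis
    unfolding a_def z_def y'_def w'_def inner_add_left inner_add_right inner_diff_left inner_diff_right
      inner_scaleR_left inner_scaleR_right assms(1-3) c
    by (simp add: field_simps power2_eq_square)
qed

lemma young: "0 < c \<Longrightarrow> x \<bullet> y \<le> c * (norm x)\<^sup>2 + (norm y)\<^sup>2 / (4 * c)" for x y :: "'a::real_inner"
proof -
  assume c: "0 < c"
  have "x \<bullet> y \<le> norm x * norm y" by (rule norm_cauchy_schwarz)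
  moreover have "0 \<le> (2 * c * norm x - norm y)\<^sup>2 / (4 * c)" using c by simp
  moreover have "(2 * c * norm x - norm y)\<^sup>2 / (4 * c)
      = c * (norm x)\<^sup>2 + (norm y)\<^sup>2 / (4 * c) - norm x * norm y"
    using c by (simp add: power2_eq_square field_simps)
  ultimately show ?thesis by linarith
qed

lemma young_neg: "0 < c \<Longrightarrow> - (x \<bullet> y) \<le> c * (norm x)\<^sup>2 + (norm y)\<^sup>2 / (4 * c)" for x y :: "'a::real_inner"
  using young[of c "- x" y] by simp

section \<open>The deterministic part of a step\<close>

locale pd_system = connected_laplacian E L
  for E :: "('n::finite \<times> 'n) set" and L :: "real^'n^'n" +
  fixes f :: "'n \<Rightarrow> 'b::euclidean_space \<Rightarrow> real"
    and fstar Lf \<nu> \<kappa>1 \<kappa>2 \<beta> \<eta> \<epsilon> :: real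
  assumes diff: "f i differentiable (at y)"
    and minimizer: "\<exists>y. favg f y = fstar" and minimum: "fstar \<le> favg f y"
    and Lf: "Lf > 0"
    and smooth: "norm (grad (f i) y - grad (f i) z) \<le> Lf * norm (y - z)"
    and nu: "\<nu> > 0"
    and PL: "\<nu> * (favg f y - fstar) \<le> 1 / 2 * (norm (grad (favg f) y))\<^sup>2"
    and kappa1: "\<kappa>1 > c1 L"
    and kappa2: "0 < \<kappa>2" "\<kappa>2 < c2 L \<kappa>1"
    and beta: "\<beta> \<ge> c0 L Lf \<kappa>1 \<kappa>2"
    and eta: "\<eta> = \<kappa>2 / \<beta>"
    and eps: "\<epsilon> = 1 / kappa5 L \<kappa>1 * Min {eps3 L \<kappa>1 \<kappa>2 / \<eta>, eps4 \<kappa>2 / \<eta>, \<nu> / 2}"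
begin

section \<open>Positivity and the conditions on the parameters\<close>

abbreviation "\<rho> \<equiv> spectral_radius L"
abbreviation "\<rho>2 \<equiv> rho2 L"
abbreviation "\<rho>LL \<equiv> spectral_radius (L ** L)"
abbreviation "\<epsilon>5 \<equiv> eps5 L Lf \<kappa>1 \<kappa>2"
abbreviation "\<epsilon>6 \<equiv> eps6 L Lf \<kappa>1"

lemma rho2_pos: "0 < \<rho>2"
  by (rule rho2_lower_bound)

lemma kappa1_gt: "1 + 1 / \<rho>2 < \<kappa>1" "1 < \<kappa>1"
proof -
  show "1 + 1 / \<rho>2 < \<kappa>1" using kappa1 by (simp add: c1_def)
  moreover have "0 < 1 / \<rho>2" using rho2_pos by simp
  ultimately show "1 < \<kappa>1" by linarith
qed

lemma kappa3_bounds: "2 < kappa3 L \<kappa>1" "kappa3 L \<kappa>1 = 1 / \<rho>2 + \<kappa>1 + 1"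
  "kappa4 L \<kappa>1 = kappa3 L \<kappa>1 + 1 / 2"
proof -
  have "0 < 1 / \<rho>2" using rho2_pos by simp
  then show "2 < kappa3 L \<kappa>1" using kappa1_gt unfolding kappa3_def by linarith
qed (simp_all add: kappa3_def kappa4_def)

lemma kappa5_ge: "1 \<le> kappa5 L \<kappa>1"
proof -
  have "0 < 1 / (2 * \<rho>2)" using rho2_pos by simp
  then show ?thesis using kappa1_gt unfolding kappa5_def by argo
qed

lemma kappa6_bounds: "0 < kappa6 L \<kappa>1" "kappa6 L \<kappa>1 \<le> (\<kappa>1 - 1) / (2 * \<kappa>1)"
  "kappa6 L \<kappa>1 \<le> 1"
proof -
  show "0 < kappa6 L \<kappa>1" and 1: "kappa6 L \<kappa>1 \<le> (\<kappa>1 - 1) / (2 * \<kappa>1)"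
    using kappa1_gt spectral_radius_bounds by (simp_all add: kappa6_def)
  note 1
  also have "(\<kappa>1 - 1) / (2 * \<kappa>1) \<le> 1" using kappa1_gt by (simp add: field_simps)
  finally show "kappa6 L \<kappa>1 \<le> 1" .
qed

lemma eps2_pos: "0 < eps2 L \<kappa>1"
proof -
  have "0 \<le> (2 * \<kappa>1\<^sup>2 + 1) * \<rho>LL" using spectral_radius_bounds by simp
  then show ?thesis using spectral_radius_bounds unfolding eps2_def by linarith
qed

lemma kappa2_lt: "\<kappa>2 < 1 / 5" "\<kappa>2 * eps2 L \<kappa>1 < eps1 L \<kappa>1"
  using kappa2 eps2_pos by (auto simp: c2_def field_simps)

text \<open>For positive \<kappa>2, the two bounds inside \<open>c2\<close> are exactly the
  positivity of these two decay coefficients.\<close>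

lemma eps34_pos: "0 < eps3 L \<kappa>1 \<kappa>2" "0 < eps4 \<kappa>2"
proof -
  have "eps3 L \<kappa>1 \<kappa>2 = \<kappa>2 * (eps1 L \<kappa>1 - \<kappa>2 * eps2 L \<kappa>1)"
    by (simp add: eps3_def power2_eq_square algebra_simps)
  then show "0 < eps3 L \<kappa>1 \<kappa>2" using kappa2 kappa2_lt by simp
  have "eps4 \<kappa>2 = 5 / 2 * (\<kappa>2 * (1 / 5 - \<kappa>2))"
    by (simp add: eps4_def power2_eq_square algebra_simps)
  also have "\<dots> > 0" using kappa2 kappa2_lt by (intro mult_pos_pos) auto
  finally show "0 < eps4 \<kappa>2" .
qed

lemma eps6_bounds: "1 + 3 / 2 * Lf\<^sup>2 \<le> \<epsilon>6" "kappa3 L \<kappa>1 \<le> \<epsilon>6"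
  by (simp_all add: eps6_def le_max_iff_disj)

lemma beta_bounds: "\<epsilon>6 \<le> \<beta>" "4 * \<kappa>2 * \<epsilon>5 \<le> \<beta>" "1 + 3 / 2 * Lf\<^sup>2 \<le> \<beta>" "kappa3 L \<kappa>1 \<le> \<beta>" "0 < \<beta>"
proof -
  show "\<epsilon>6 \<le> \<beta>" "4 * \<kappa>2 * \<epsilon>5 \<le> \<beta>" using beta by (simp_all add: c0_def)
  then show "1 + 3 / 2 * Lf\<^sup>2 \<le> \<beta>" "kappa3 L \<kappa>1 \<le> \<beta>" "0 < \<beta>"
    using eps6_bounds kappa3_bounds by linarith+
qed

text \<open>The last bound restates \<open>4 * \<kappa>2 * \<epsilon>5 \<le> \<beta>\<close> in the
  form in which the descent of \<open>f\<close> absorbs the error caused by the averaged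
  gradient.\<close>

lemma eta_bounds: "0 < \<eta>" "\<eta> * \<beta> = \<kappa>2" "\<eta> * \<epsilon>5 \<le> 1 / 4"
  using beta_bounds kappa2 by (simp_all add: eta field_simps)

text \<open>The three summands are the costs, per \<eta>^2 n |averaged stochastic gradient|^2, of
  the smoothness remainder of \<open>f\<close>, of Young's inequality for
  \<open>\<delta> \<bullet> z\<close>, and of the terms quadratic in \<open>\<delta>\<close>.
  \<open>eps5\<close> states them with \<open>eps6\<close>, which is at most \<beta>, and generously
  in the first and last summand.\<close>

lemma eps5_ge: "0 < \<epsilon>5"
  "Lf / 2 + kappa3 L \<kappa>1 * Lf\<^sup>2 / (\<kappa>2 * \<beta>) + kappa4 L \<kappa>1 * Lf\<^sup>2 / (2 * \<beta>\<^sup>2) \<le> \<epsilon>5"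
proof -
  have e6: "0 < \<epsilon>6" using eps6_bounds kappa3_bounds by linarith
  have 3: "0 < kappa3 L \<kappa>1" "0 < kappa4 L \<kappa>1" using kappa3_bounds by linarith+
  have "kappa3 L \<kappa>1 * Lf\<^sup>2 / (\<kappa>2 * \<beta>) \<le> kappa3 L \<kappa>1 * Lf\<^sup>2 / (\<kappa>2 * \<epsilon>6)"
    using 3 e6 beta_bounds kappa2 by (intro divide_left_mono mult_left_mono) auto
  moreover have "kappa4 L \<kappa>1 * Lf\<^sup>2 / (2 * \<beta>\<^sup>2) \<le> kappa4 L \<kappa>1 * Lf\<^sup>2 / (1 / 2 * \<epsilon>6\<^sup>2)"
  proof (intro divide_left_mono)
    have "\<epsilon>6\<^sup>2 \<le> \<beta>\<^sup>2" using e6 beta_bounds by (intro power_mono) auto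
    moreover have "0 \<le> \<beta>\<^sup>2" by simp
    ultimately show "1 / 2 * \<epsilon>6\<^sup>2 \<le> 2 * \<beta>\<^sup>2" by linarith
  qed (use 3 e6 beta_bounds in auto)
  moreover have "\<epsilon>5 = Lf + kappa3 L \<kappa>1 * Lf\<^sup>2 / (\<kappa>2 * \<epsilon>6) + kappa4 L \<kappa>1 * Lf\<^sup>2 / (1 / 2 * \<epsilon>6\<^sup>2)"
    by (simp add: eps5_def ac_simps)
  ultimately show "Lf / 2 + kappa3 L \<kappa>1 * Lf\<^sup>2 / (\<kappa>2 * \<beta>) + kappa4 L \<kappa>1 * Lf\<^sup>2 / (2 * \<beta>\<^sup>2) \<le> \<epsilon>5"
    using Lf by linarith
  have "0 \<le> kappa3 L \<kappa>1 * Lf\<^sup>2 / (\<kappa>2 * \<beta>)" "0 \<le> kappa4 L \<kappa>1 * Lf\<^sup>2 / (2 * \<beta>\<^sup>2)"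
    using 3 beta_bounds kappa2 by simp_all
  with \<open>_ \<le> \<epsilon>5\<close> show "0 < \<epsilon>5" using Lf by linarith
qed

text \<open>\<open>\<epsilon> * kappa5 L \<kappa>1\<close> is the minimum itself, so each of the
  three sources of decrease can pay its share of the upper bound on the potential.
  \<open>\<eta> * \<epsilon> < 1\<close> comes from \<open>eps4 < 1\<close> and
  \<open>kappa5 \<ge> 1\<close>; the bound by \<eta> \<nu> has a factor 2 to spare.\<close>

lemma rate_bounds:
  "0 < \<epsilon>" "\<eta> * \<epsilon> < 1" "\<eta> * \<epsilon> * kappa5 L \<kappa>1 \<le> eps3 L \<kappa>1 \<kappa>2"
  "\<eta> * \<epsilon> * kappa5 L \<kappa>1 \<le> eps4 \<kappa>2" "\<eta> * \<epsilon> * kappa5 L \<kappa>1 \<le> \<eta> * \<nu>"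
proof -
  define m where "m = Min {eps3 L \<kappa>1 \<kappa>2 / \<eta>, eps4 \<kappa>2 / \<eta>, \<nu> / 2}"
  have k5: "0 < kappa5 L \<kappa>1" using kappa5_ge by linarith
  have em: "\<epsilon> * kappa5 L \<kappa>1 = m" using k5 by (simp add: eps m_def)
  have m: "m \<le> eps3 L \<kappa>1 \<kappa>2 / \<eta>" "m \<le> eps4 \<kappa>2 / \<eta>" "m \<le> \<nu> / 2"
    unfolding m_def by (rule Min_le; simp)+
  have "0 < m" using eps34_pos eta_bounds nu by (simp add: m_def)
  then show e: "0 < \<epsilon>" using em k5 by (metis zero_less_mult_pos2)
  have me: "\<eta> * \<epsilon> * kappa5 L \<kappa>1 = \<eta> * m" using em by (simp add: mult.assoc)
  show "\<eta> * \<epsilon> * kappa5 L \<kappa>1 \<le> eps3 L \<kappa>1 \<kappa>2" and 4: "\<eta> * \<epsilon> * kappa5 L \<kappa>1 \<le> eps4 \<kappa>2"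
    using m(1,2) eta_bounds(1) unfolding me by (simp_all add: pos_le_divide_eq mult.commute)
  have "\<eta> * m \<le> \<eta> * (\<nu> / 2)" using m(3) eta_bounds(1) by (intro mult_left_mono) auto
  then show "\<eta> * \<epsilon> * kappa5 L \<kappa>1 \<le> \<eta> * \<nu>" using nu eta_bounds(1) unfolding me by simp
  have "\<eta> * \<epsilon> \<le> \<eta> * \<epsilon> * kappa5 L \<kappa>1" using e eta_bounds(1) kappa5_ge by simp
  also note 4
  also have "eps4 \<kappa>2 < 1" using kappa2_lt zero_le_power2[of \<kappa>2] unfolding eps4_def by argo
  finally show "\<eta> * \<epsilon> < 1" .
qed

text \<open>With \<open>\<beta> \<ge> 1 + 3/2 Lf\<^sup>2\<close>, the first two summands are at most 0.61 and the last one at most 1/6.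
  The term in \<open>z\<close> of the next lemma costs a further 0.2113, so the total stays below 1.\<close>

lemma first_order_coefficient:
  "Lf / \<beta> + Lf\<^sup>2 / (2 * \<beta>) + (Lf / \<beta>)\<^sup>2 \<le> 7768 / 10000" "Lf / \<beta> \<le> 41 / 100"
  "(Lf / \<beta>)\<^sup>2 \<le> 1 / 6"
proof -
  have b: "0 < \<beta>" "1 + 3 / 2 * Lf\<^sup>2 \<le> \<beta>" using beta_bounds by simp_all
  have 1: "6 * Lf\<^sup>2 \<le> \<beta>\<^sup>2"
  proof -
    \<comment> \<open>This is (1 + a)^2 \<ge> 4 a with a = 3/2 Lf^2.\<close>
    have "6 * Lf\<^sup>2 \<le> (1 + 3 / 2 * Lf\<^sup>2)\<^sup>2"
      using zero_le_power2[of "1 - 3 / 2 * Lf\<^sup>2"] by (simp add: power2_eq_square algebra_simps)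
    also have "\<dots> \<le> \<beta>\<^sup>2" using b by (intro power_mono) auto
    finally show ?thesis .
  qed
  then show 6: "(Lf / \<beta>)\<^sup>2 \<le> 1 / 6" using b by (simp add: power_divide field_simps)
  \<comment> \<open>The difference is 0.415 Lf^2 - Lf + 0.61, a quadratic without real zeros whose
    vertex lies at 100/83.\<close>
  have 2: "Lf + Lf\<^sup>2 / 2 \<le> 61 / 100 * (1 + 3 / 2 * Lf\<^sup>2)"
    using zero_le_power2[of "Lf - 100 / 83"] by (simp add: power2_eq_square algebra_simps)
  have 3: "61 / 100 * (1 + 3 / 2 * Lf\<^sup>2) \<le> 61 / 100 * \<beta>" using b by simp
  have "(Lf + Lf\<^sup>2 / 2) / \<beta> \<le> 61 / 100" using 2 3 b by (simp add: pos_divide_le_eq)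
  then show "Lf / \<beta> + Lf\<^sup>2 / (2 * \<beta>) + (Lf / \<beta>)\<^sup>2 \<le> 7768 / 10000"
    using 6 by (simp add: add_divide_distrib)
  show "Lf / \<beta> \<le> 41 / 100"
    using 6 by (intro power2_le_imp_le[of "Lf / \<beta>"]) (auto simp: power2_eq_square)
qed

text \<open>The vector that the expansion pairs with the noise: the noiseless next value of
  \<open>y + w\<close>, except for the change \<open>\<delta>\<close> of the gradients.\<close>

definition "deterministic_part y w e = y - \<kappa>2 *\<^sub>R (\<kappa>1 *\<^sub>R act L y + w + e) + w + \<kappa>2 *\<^sub>R act L y"

text \<open>The budget in |y|^2 is the 1 subtracted in \<open>eps1\<close>; the budget in |w|^2 is
  one half, of which \<open>e \<bullet> w\<close> and the term in \<open>z\<close> take a quarter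
  each. The summand with Lf^2 / (2 \<beta>) is a reserve, spent later on the disagreement of the
  gradients in the descent of \<open>f\<close>.\<close>

lemma first_order_bound:
  fixes y w e :: "'b^'n"
  assumes e: "norm e \<le> Lf / \<beta> * norm y"
  defines "z \<equiv> act (pseudoinverse L) w + (\<kappa>1 - \<kappa>2) *\<^sub>R w + (1 + \<kappa>2) *\<^sub>R y - \<kappa>2 *\<^sub>R e"
  shows "- (y \<bullet> e) - (norm w)\<^sup>2 - e \<bullet> w + (norm z)\<^sup>2 / (4 * kappa3 L \<kappa>1 * \<beta>)
    + Lf\<^sup>2 / (2 * \<beta>) * (norm y)\<^sup>2 \<le> (norm y)\<^sup>2 - 1 / 2 * (norm w)\<^sup>2"
proof -
  let ?t = "Lf / \<beta>" and ?k = "kappa3 L \<kappa>1" and ?Y = "norm y" and ?W = "norm w"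
  have b: "0 < \<beta>" "?k \<le> \<beta>" using beta_bounds by simp_all
  have k: "2 < ?k" by (rule kappa3_bounds)
  have ye: "- (y \<bullet> e) \<le> ?t * ?Y\<^sup>2"
  proof -
    have "- (y \<bullet> e) \<le> ?Y * norm e" using norm_cauchy_schwarz[of "- y" e] by simp
    also have "\<dots> \<le> ?Y * (?t * ?Y)" using e by (intro mult_left_mono) auto
    finally show ?thesis by (simp add: power2_eq_square mult.left_commute)
  qed
  have ew: "- (e \<bullet> w) \<le> ?t\<^sup>2 * ?Y\<^sup>2 + 1 / 4 * ?W\<^sup>2"
    using young_neg[of 1 e w] power_mono[OF e norm_ge_zero, of 2] unfolding power_mult_distrib by linarith
  \<comment> \<open>\<open>kappa3 - 1\<close> is 1/\<rho>2 + \<kappa>1. The factor 13/10 is 6/5 from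
    \<open>1 + \<kappa>2\<close> plus 1/10 from \<kappa>2 Lf / \<beta> \<le> 0.082.\<close>
  have nz: "norm z \<le> (?k - 1) * ?W + 13 / 10 * ?Y"
  proof -
    have "norm z \<le> norm (act (pseudoinverse L) w) + norm ((\<kappa>1 - \<kappa>2) *\<^sub>R w) + norm ((1 + \<kappa>2) *\<^sub>R y) + norm (\<kappa>2 *\<^sub>R e)"
      unfolding z_def by (meson norm_triangle_le norm_triangle_le_diff order_refl add_mono)
    moreover have "norm ((\<kappa>1 - \<kappa>2) *\<^sub>R w) \<le> \<kappa>1 * ?W"
      using kappa1_gt kappa2_lt kappa2 by (simp add: mult_right_mono)
    moreover have "norm (act (pseudoinverse L) w) \<le> 1 / \<rho>2 * ?W"
      using norm_pseudoinverse_upper[of w] by simp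
    moreover have "norm ((1 + \<kappa>2) *\<^sub>R y) \<le> 6 / 5 * ?Y"
    proof -
      have "(1 + \<kappa>2) * ?Y \<le> 6 / 5 * ?Y" using kappa2_lt by (intro mult_right_mono) auto
      then show ?thesis using kappa2 by simp
    qed
    moreover have "norm (\<kappa>2 *\<^sub>R e) \<le> 1 / 10 * ?Y"
    proof -
      have "norm e \<le> 41 / 100 * ?Y" using e first_order_coefficient(2)
        by (meson mult_right_mono norm_ge_zero order_trans)
      then have "\<kappa>2 * norm e \<le> 1 / 5 * (41 / 100 * ?Y)"
        using kappa2_lt kappa2 by (intro mult_mono) auto
      moreover have "norm (\<kappa>2 *\<^sub>R e) = \<kappa>2 * norm e" using kappa2 by simp
      ultimately show ?thesis using norm_ge_zero[of y] by linarith
    qed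
    ultimately have "norm z \<le> 1 / \<rho>2 * ?W + \<kappa>1 * ?W + 6 / 5 * ?Y + 1 / 10 * ?Y" by linarith
    also have "\<dots> = (?k - 1) * ?W + 13 / 10 * ?Y" by (simp add: kappa3_bounds(2) algebra_simps)
    finally show ?thesis .
  qed
  \<comment> \<open>Cauchy-Schwarz with weights \<open>kappa3 - 1\<close> and 1, whose sum
    \<open>kappa3\<close> cancels against the denominator.\<close>
  have "(norm z)\<^sup>2 \<le> ?k * ((?k - 1) * ?W\<^sup>2 + 169 / 100 * ?Y\<^sup>2)"
  proof -
    have "(norm z)\<^sup>2 \<le> ((?k - 1) * ?W + 13 / 10 * ?Y)\<^sup>2" using nz by (intro power_mono) auto
    also have "\<dots> = ?k * ((?k - 1) * ?W\<^sup>2 + 169 / 100 * ?Y\<^sup>2) - (?k - 1) * (?W - 13 / 10 * ?Y)\<^sup>2"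
      by (simp add: power2_eq_square field_simps)
    also have "\<dots> \<le> ?k * ((?k - 1) * ?W\<^sup>2 + 169 / 100 * ?Y\<^sup>2)" using k by simp
    finally show ?thesis .
  qed
  then have "(norm z)\<^sup>2 / (4 * ?k * \<beta>) \<le> ?k * ((?k - 1) * ?W\<^sup>2 + 169 / 100 * ?Y\<^sup>2) / (4 * ?k * \<beta>)"
    using b k by (intro divide_right_mono) auto
  also have "\<dots> = ((?k - 1) * ?W\<^sup>2 + 169 / 100 * ?Y\<^sup>2) / (4 * \<beta>)" using b k by simp
  \<comment> \<open>The first summand uses \<open>kappa3 \<le> \<beta>\<close>, the second \<beta> >
    2: 1.69 / 8 \<le> 0.2113.\<close>
  also have "\<dots> \<le> 1 / 4 * ?W\<^sup>2 + 2113 / 10000 * ?Y\<^sup>2"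
  proof -
    have "(?k - 1) * ?W\<^sup>2 \<le> \<beta> * ?W\<^sup>2" using b by (intro mult_right_mono) auto
    moreover have "2 * ?Y\<^sup>2 \<le> \<beta> * ?Y\<^sup>2" using b k by (intro mult_right_mono) auto
    moreover have "0 \<le> ?Y\<^sup>2" by simp
    ultimately have "(?k - 1) * ?W\<^sup>2 + 169 / 100 * ?Y\<^sup>2 \<le> \<beta> * ?W\<^sup>2 + 8452 / 10000 * (\<beta> * ?Y\<^sup>2)"
      by linarith
    then show ?thesis using b by (simp add: pos_divide_le_eq algebra_simps)
  qed
  finally have z: "(norm z)\<^sup>2 / (4 * ?k * \<beta>) \<le> 1 / 4 * ?W\<^sup>2 + 2113 / 10000 * ?Y\<^sup>2" .
  have "(?t + Lf\<^sup>2 / (2 * \<beta>) + ?t\<^sup>2) * ?Y\<^sup>2 \<le> 7768 / 10000 * ?Y\<^sup>2"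
    by (intro mult_right_mono first_order_coefficient(1)) auto
  then have "?t * ?Y\<^sup>2 + Lf\<^sup>2 / (2 * \<beta>) * ?Y\<^sup>2 + ?t\<^sup>2 * ?Y\<^sup>2 \<le> 7768 / 10000 * ?Y\<^sup>2"
    by (simp only: distrib_right)
  moreover have "0 \<le> ?Y\<^sup>2" by simp
  ultimately show ?thesis using ye ew z by linarith
qed

text \<open>The two mixed terms with \<open>l\<close> cost (\<kappa>1 - 1)^2 |l|^2 together, which
  the factor 2 \<kappa>1^2 + 1 in \<open>eps2\<close> covers along with the square of
  \<open>l\<close>. The \<open>e\<close> terms add up to 3/2 |e|^2 \<le> 1/4 |y|^2, within the final
  1 of \<open>eps2\<close>. The 5/2 is the one inside \<open>eps4\<close>.\<close>

lemma second_order_bound: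
  fixes y w e :: "'b^'n"
  assumes e: "norm e \<le> Lf / \<beta> * norm y"
  defines "l \<equiv> act L y"
  shows "1 / 2 * (\<kappa>1\<^sup>2 - \<kappa>1) * (norm l)\<^sup>2 + 1 / 2 * (y \<bullet> l) + 1 / 2 * (norm w)\<^sup>2 + 1 / 2 * (norm e)\<^sup>2
      + (\<kappa>1 - 1) * (l \<bullet> w) + (\<kappa>1 - 1) * (l \<bullet> e) + w \<bullet> e
    \<le> eps2 L \<kappa>1 * (norm y)\<^sup>2 + 5 / 2 * (norm w)\<^sup>2"
proof -
  have "(norm e)\<^sup>2 \<le> (Lf / \<beta>)\<^sup>2 * (norm y)\<^sup>2"
    using power_mono[OF e norm_ge_zero, of 2] unfolding power_mult_distrib .
  also have "\<dots> \<le> 1 / 6 * (norm y)\<^sup>2" by (intro mult_right_mono first_order_coefficient(3)) auto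
  finally have ee: "(norm e)\<^sup>2 \<le> 1 / 6 * (norm y)\<^sup>2" .
  have l1: "y \<bullet> l \<le> \<rho> * (norm y)\<^sup>2" "0 \<le> y \<bullet> l"
    by (simp_all add: l_def inner_laplacian_upper inner_laplacian_nonneg)
  have l2: "(norm l)\<^sup>2 \<le> \<rho>LL * (norm y)\<^sup>2" by (simp add: l_def norm_laplacian_upper)
  have kl: "(\<kappa>1 - 1) * (l \<bullet> u) \<le> 1 / 2 * ((\<kappa>1 - 1)\<^sup>2 * (norm l)\<^sup>2) + 1 / 2 * (norm u)\<^sup>2" for u
    using young[of "1 / 2" "(\<kappa>1 - 1) *\<^sub>R l" u] by (simp add: power_mult_distrib)
  have we: "w \<bullet> e \<le> 1 / 2 * (norm w)\<^sup>2 + 1 / 2 * (norm e)\<^sup>2"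
    using young[of "1 / 2" w e] by simp
  have "(1 / 2 * (\<kappa>1\<^sup>2 - \<kappa>1) + (\<kappa>1 - 1)\<^sup>2) * (norm l)\<^sup>2 \<le> (2 * \<kappa>1\<^sup>2 + 1) * (norm l)\<^sup>2"
    using kappa1_gt zero_le_power2[of \<kappa>1]
    by (intro mult_right_mono) (auto simp: power2_diff algebra_simps simp del: zero_le_power2)
  also have "\<dots> \<le> (2 * \<kappa>1\<^sup>2 + 1) * (\<rho>LL * (norm y)\<^sup>2)" by (intro mult_left_mono l2) auto
  finally have "1 / 2 * (\<kappa>1\<^sup>2 - \<kappa>1) * (norm l)\<^sup>2 + (\<kappa>1 - 1)\<^sup>2 * (norm l)\<^sup>2
      \<le> (2 * \<kappa>1\<^sup>2 + 1) * \<rho>LL * (norm y)\<^sup>2" by (simp add: algebra_simps)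
  moreover have "0 \<le> (norm y)\<^sup>2" "0 \<le> (norm w)\<^sup>2" by simp_all
  moreover have "eps2 L \<kappa>1 * (norm y)\<^sup>2 = \<rho> * (norm y)\<^sup>2 + (2 * \<kappa>1\<^sup>2 + 1) * \<rho>LL * (norm y)\<^sup>2 + (norm y)\<^sup>2"
    by (simp add: eps2_def algebra_simps)
  ultimately show ?thesis using kl[of w] kl[of e] we ee l1 by linarith
qed

text \<open>The extra term on the left keeps the reserve for the descent of \<open>f\<close>. Of
  \<eta>^2 |s|^2, one half is the square from the expansion and one half pays for the pairing of
  \<open>s\<close> with \<open>\<delta>\<close>.\<close>

lemma lyap_quad_step:
  fixes y w e s \<delta> :: "'b^'n"
  assumes y: "cen y = y" and w: "cen w = w" and \<delta>: "cen \<delta> = \<delta>"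
    and e: "norm e \<le> Lf / \<beta> * norm y"
  defines "y' \<equiv> y - \<kappa>2 *\<^sub>R (\<kappa>1 *\<^sub>R act L y + w + e) - \<eta> *\<^sub>R s"
    and "w' \<equiv> w + \<kappa>2 *\<^sub>R act L y + \<delta>"
  shows "lyap_quad L \<kappa>1 y' w' + \<kappa>2 * Lf\<^sup>2 / (2 * \<beta>) * (norm y)\<^sup>2
    \<le> lyap_quad L \<kappa>1 y w - eps3 L \<kappa>1 \<kappa>2 * (norm y)\<^sup>2 - eps4 \<kappa>2 * (norm w)\<^sup>2
      + (kappa3 L \<kappa>1 * \<beta> / \<kappa>2 + kappa4 L \<kappa>1 / 2) * (norm \<delta>)\<^sup>2
      - \<eta> * (s \<bullet> deterministic_part y w e) + \<eta>\<^sup>2 * (norm s)\<^sup>2"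
proof -
  let ?Q = "act (pseudoinverse L)" and ?l = "act L y" and ?k = "kappa3 L \<kappa>1"
  define z where "z = ?Q w + (\<kappa>1 - \<kappa>2) *\<^sub>R w + (1 + \<kappa>2) *\<^sub>R y - \<kappa>2 *\<^sub>R e"
  have Ql: "?Q ?l = y" by (simp add: act_pseudoinverse y)
  note symQ = inner_act[OF pseudoinverse_laplacian(1)]
  have Qw': "?Q w' = ?Q w + \<kappa>2 *\<^sub>R y + ?Q \<delta>" by (simp add: w'_def act_add act_scaleR Ql)
  have h: "?l \<bullet> ?Q w = y \<bullet> w" "?l \<bullet> ?Q \<delta> = y \<bullet> \<delta>" "w \<bullet> ?Q \<delta> = \<delta> \<bullet> ?Q w"
    using symQ[of ?l w] symQ[of ?l \<delta>] symQ[of w \<delta>] by (simp_all add: Ql inner_commute)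
  have k: "2 < ?k" "0 < \<beta>" "0 < \<kappa>2" using kappa3_bounds beta_bounds kappa2 by simp_all
  have main: "lyap_quad L \<kappa>1 y' w' = lyap_quad L \<kappa>1 y w
      + \<kappa>2 * (- ((\<kappa>1 - 1) * (y \<bullet> ?l)) - y \<bullet> e - (norm w)\<^sup>2 - e \<bullet> w)
      + \<kappa>2\<^sup>2 * (1 / 2 * (\<kappa>1\<^sup>2 - \<kappa>1) * (norm ?l)\<^sup>2 + 1 / 2 * (y \<bullet> ?l) + 1 / 2 * (norm w)\<^sup>2 + 1 / 2 * (norm e)\<^sup>2
          + (\<kappa>1 - 1) * (?l \<bullet> w) + (\<kappa>1 - 1) * (?l \<bullet> e) + w \<bullet> e)
      + \<delta> \<bullet> z - \<eta> * (s \<bullet> \<delta>) + 1 / 2 * (\<delta> \<bullet> ?Q \<delta>) + \<kappa>1 / 2 * (norm \<delta>)\<^sup>2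
      - \<eta> * (s \<bullet> deterministic_part y w e) + 1 / 2 * \<eta>\<^sup>2 * (norm s)\<^sup>2"
    using lyap_quad_expansion[OF h, of \<kappa>2 \<kappa>1 e \<eta> s]
    unfolding lyap_quad_def Qw' power2_norm_eq_inner z_def deterministic_part_def y'_def[symmetric] w'_def[symmetric]
    by linarith
  have "\<kappa>2 * (- ((\<kappa>1 - 1) * (y \<bullet> ?l)) - y \<bullet> e - (norm w)\<^sup>2 - e \<bullet> w)
      + \<kappa>2 * ((norm z)\<^sup>2 / (4 * ?k * \<beta>)) + \<kappa>2 * (Lf\<^sup>2 / (2 * \<beta>) * (norm y)\<^sup>2)
      \<le> \<kappa>2 * (- eps1 L \<kappa>1 * (norm y)\<^sup>2 - 1 / 2 * (norm w)\<^sup>2)"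
  proof -
    have "(\<kappa>1 - 1) * (\<rho>2 * (norm y)\<^sup>2) \<le> (\<kappa>1 - 1) * (y \<bullet> ?l)"
      using kappa1_gt by (intro mult_left_mono inner_laplacian_lower y) auto
    moreover have "eps1 L \<kappa>1 * (norm y)\<^sup>2 = (\<kappa>1 - 1) * (\<rho>2 * (norm y)\<^sup>2) - (norm y)\<^sup>2"
      by (simp add: eps1_def algebra_simps)
    ultimately have "- ((\<kappa>1 - 1) * (y \<bullet> ?l)) - y \<bullet> e - (norm w)\<^sup>2 - e \<bullet> w
      + (norm z)\<^sup>2 / (4 * ?k * \<beta>) + Lf\<^sup>2 / (2 * \<beta>) * (norm y)\<^sup>2
      \<le> - eps1 L \<kappa>1 * (norm y)\<^sup>2 - 1 / 2 * (norm w)\<^sup>2"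
      using first_order_bound[OF e, of w] unfolding z_def by simp
    then show ?thesis unfolding distrib_left[symmetric] using k by (intro mult_left_mono) auto
  qed
  moreover have "\<kappa>2\<^sup>2 * (1 / 2 * (\<kappa>1\<^sup>2 - \<kappa>1) * (norm ?l)\<^sup>2 + 1 / 2 * (y \<bullet> ?l) + 1 / 2 * (norm w)\<^sup>2
      + 1 / 2 * (norm e)\<^sup>2 + (\<kappa>1 - 1) * (?l \<bullet> w) + (\<kappa>1 - 1) * (?l \<bullet> e) + w \<bullet> e)
      \<le> \<kappa>2\<^sup>2 * (eps2 L \<kappa>1 * (norm y)\<^sup>2 + 5 / 2 * (norm w)\<^sup>2)"
    by (intro mult_left_mono second_order_bound e) auto
  \<comment> \<open>The weight is inversely proportional to \<kappa>2, so the \<open>z\<close> part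
    is of first order in \<kappa>2 and fits \<open>first_order_bound\<close>. The large factor falls
    on |\<delta>|^2, which carries \<eta>^2 / \<beta>^2.\<close>
  moreover have "\<delta> \<bullet> z \<le> ?k * \<beta> / \<kappa>2 * (norm \<delta>)\<^sup>2 + \<kappa>2 * ((norm z)\<^sup>2 / (4 * ?k * \<beta>))"
    using young[of "?k * \<beta> / \<kappa>2" \<delta> z] k by (simp add: field_simps)
  moreover have "- \<eta> * (s \<bullet> \<delta>) \<le> 1 / 2 * \<eta>\<^sup>2 * (norm s)\<^sup>2 + 1 / 2 * (norm \<delta>)\<^sup>2"
    using young_neg[of "1 / 2" "\<eta> *\<^sub>R s" \<delta>] by (simp add: power_mult_distrib)
  moreover have "1 / 2 * (\<delta> \<bullet> ?Q \<delta>) + \<kappa>1 / 2 * (norm \<delta>)\<^sup>2 + 1 / 2 * (norm \<delta>)\<^sup>2 \<le> kappa4 L \<kappa>1 / 2 * (norm \<delta>)\<^sup>2"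
  proof -
    have "kappa4 L \<kappa>1 / 2 * (norm \<delta>)\<^sup>2 = 1 / 2 * ((norm \<delta>)\<^sup>2 / \<rho>2) + \<kappa>1 / 2 * (norm \<delta>)\<^sup>2 + 3 / 4 * (norm \<delta>)\<^sup>2"
      by (simp add: kappa4_def algebra_simps)
    moreover have "0 \<le> (norm \<delta>)\<^sup>2" by simp
    ultimately show ?thesis using inner_pseudoinverse_upper[of \<delta>] by linarith
  qed
  moreover have "\<kappa>2 * (- eps1 L \<kappa>1 * (norm y)\<^sup>2 - 1 / 2 * (norm w)\<^sup>2)
      + \<kappa>2\<^sup>2 * (eps2 L \<kappa>1 * (norm y)\<^sup>2 + 5 / 2 * (norm w)\<^sup>2)
      = - eps3 L \<kappa>1 \<kappa>2 * (norm y)\<^sup>2 - eps4 \<kappa>2 * (norm w)\<^sup>2"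
    by (simp add: eps3_def eps4_def algebra_simps)
  moreover have "(?k * \<beta> / \<kappa>2 + kappa4 L \<kappa>1 / 2) * (norm \<delta>)\<^sup>2
      = ?k * \<beta> / \<kappa>2 * (norm \<delta>)\<^sup>2 + kappa4 L \<kappa>1 / 2 * (norm \<delta>)\<^sup>2"
    by (rule distrib_right)
  moreover have "\<kappa>2 * (Lf\<^sup>2 / (2 * \<beta>) * (norm y)\<^sup>2) = \<kappa>2 * Lf\<^sup>2 / (2 * \<beta>) * (norm y)\<^sup>2" by simp
  ultimately show ?thesis using main by linarith
qed

end

section \<open>One step of the iteration\<close>

lemma linear_avg: "linear (\<lambda>x :: 'b::real_vector^'n. avg (($) x))"
  by (rule linearI) (simp_all add: avg_def sum.distrib scaleR_right_distrib scaleR_sum_right mult.commute)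

lemmas avg_add = linear_add[OF linear_avg]
  and avg_minus = linear_diff[OF linear_avg]
  and avg_scaleR = linear_scale[OF linear_avg]

lemma avg_eq_0:
  fixes x :: "'b::real_vector^'n"
  assumes "cen x = x"
  shows "avg (($) x) = 0"
  using sum_cen[of x] unfolding assms by (simp add: avg_def)

lemma norm_le_lipschitz_componentwise:
  fixes x y :: "'b::real_inner^'n"
  assumes "\<And>i. norm (x $ i) \<le> c * norm (y $ i)" "0 \<le> c"
  shows "norm x \<le> c * norm y"
proof -
  have "norm x \<le> norm (c *\<^sub>R y)"
    using assms by (intro norm_le_componentwise_cart) simp
  then show ?thesis using assms(2) by simp
qed

lemma norm_const_vec: "(norm (\<chi> i. c :: 'b::real_inner^'n))\<^sup>2 = real CARD('n) * (norm c)\<^sup>2"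
  for c :: "'b::real_inner"
  by (simp add: power2_norm_eq_inner inner_vec_def)

context pd_system
begin

definition grads :: "'b^'n \<Rightarrow> 'b^'n" where
  "grads x = (\<chi> i. grad (f i) (x $ i))"

definition grads0 :: "'b^'n \<Rightarrow> 'b^'n" where
  "grads0 x = (\<chi> i. grad (f i) (avg (($) x)))"

text \<open>The deviation of \<open>v\<close> from its equilibrium
  \<open>- grads0 x / \<beta>\<close>; centring discards the mean gradient, which drives the average
  instead.\<close>

definition dual :: "'b^'n \<Rightarrow> 'b^'n \<Rightarrow> 'b^'n" where
  "dual x v = cen (v + (1 / \<beta>) *\<^sub>R grads0 x)"

definition lyap :: "'b^'n \<Rightarrow> 'b^'n \<Rightarrow> real" where
  "lyap x v = lyap_quad L \<kappa>1 (cen x) (dual x v) + real CARD('n) * (favg f (avg (($) x)) - fstar)"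

text \<open>All terms of one step that are linear in the noise. The first block is constant over the
  agents and meets only the averaged noise; its factor 2 comes from the cross term in the square of
  averaged gradient plus averaged noise.\<close>

definition drift :: "'b^'n \<Rightarrow> 'b^'n \<Rightarrow> 'b^'n" where
  "drift x v =
     (\<chi> i. (2 * \<epsilon>5 * \<eta>\<^sup>2) *\<^sub>R avg (($) (grads x)) - \<eta> *\<^sub>R grad (favg f) (avg (($) x)))
     - \<eta> *\<^sub>R cen (deterministic_part (cen x) (dual x v) ((1 / \<beta>) *\<^sub>R cen (grads x - grads0 x)))"

lemma favg_differentiable: "favg f differentiable (at y)"
  using GDERIV_favg[of f y] diff by (auto simp: gderiv_def differentiable_def)

lemma grad_favg: "grad (favg f) y = avg (\<lambda>i. grad (f i) y)"
  using GDERIV_favg[of f y] diff by (intro grad_eqI) auto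

lemma favg_smooth: "norm (grad (favg f) y - grad (favg f) z) \<le> Lf * norm (y - z)"
  unfolding grad_favg avg_diff by (intro norm_avg_le smooth)

lemma cen_cen [simp]: "cen (cen x) = cen x" for x :: "'b^'n"
  by (rule cen_ident) simp

text \<open>Young's inequality with weight 1 / (2 \<kappa>1) lets the cross term use up exactly
  \<kappa>1/2 |w|^2; the coefficients that remain are the two entries of
  \<open>kappa6\<close>.\<close>

lemma lyap_quad_lower:
  fixes y w :: "'b^'n"
  assumes "cen w = w"
  shows "(\<kappa>1 - 1) / (2 * \<kappa>1) * (norm y)\<^sup>2 + 1 / (2 * \<rho>) * (norm w)\<^sup>2 \<le> lyap_quad L \<kappa>1 y w"
proof -
  have k: "0 < \<kappa>1" using kappa1_gt by simp
  have "- (y \<bullet> w) \<le> 1 / (2 * \<kappa>1) * (norm y)\<^sup>2 + \<kappa>1 / 2 * (norm w)\<^sup>2"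
    using young_neg[of "1 / (2 * \<kappa>1)" y w] k by (simp add: mult.commute)
  moreover have "(\<kappa>1 - 1) / (2 * \<kappa>1) * (norm y)\<^sup>2 = 1 / 2 * (norm y)\<^sup>2 - 1 / (2 * \<kappa>1) * (norm y)\<^sup>2"
    using k by (simp add: field_simps)
  moreover have "1 / (2 * \<rho>) * (norm w)\<^sup>2 \<le> 1 / 2 * (w \<bullet> act (pseudoinverse L) w)"
    using inner_pseudoinverse_lower[OF assms] by simp
  ultimately show ?thesis unfolding lyap_quad_def by linarith
qed

text \<open>With the cross term split evenly, the coefficient of |w|^2 is exactly
  \<open>kappa5\<close>, and that of |y|^2 is 1, hence at most \<open>kappa5\<close>.\<close>

lemma lyap_quad_upper:
  fixes y w :: "'b^'n"
  shows "lyap_quad L \<kappa>1 y w \<le> kappa5 L \<kappa>1 * ((norm y)\<^sup>2 + (norm w)\<^sup>2)"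
proof -
  have "y \<bullet> w \<le> 1 / 2 * (norm y)\<^sup>2 + 1 / 2 * (norm w)\<^sup>2" using young[of "1 / 2" y w] by simp
  moreover have "1 / 2 * (w \<bullet> act (pseudoinverse L) w) \<le> 1 / (2 * \<rho>2) * (norm w)\<^sup>2"
    using inner_pseudoinverse_upper[of w] by simp
  moreover have "1 * (norm y)\<^sup>2 \<le> kappa5 L \<kappa>1 * (norm y)\<^sup>2"
    using kappa5_ge by (intro mult_right_mono) auto
  moreover have "kappa5 L \<kappa>1 * ((norm y)\<^sup>2 + (norm w)\<^sup>2) = kappa5 L \<kappa>1 * (norm y)\<^sup>2
      + \<kappa>1 / 2 * (norm w)\<^sup>2 + 1 / 2 * (norm w)\<^sup>2 + 1 / (2 * \<rho>2) * (norm w)\<^sup>2"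
    unfolding kappa5_def by (simp add: algebra_simps add_divide_distrib)
  ultimately show ?thesis unfolding lyap_quad_def by linarith
qed

lemma norm_grads_diff_le: "norm (grads x - grads z) \<le> Lf * norm (x - z)"
  using Lf by (intro norm_le_lipschitz_componentwise) (auto simp: grads_def smooth)

lemma norm_grads_grads0_le: "norm (grads x - grads0 x) \<le> Lf * norm (cen x)"
  using Lf by (intro norm_le_lipschitz_componentwise) (auto simp: grads_def grads0_def cen_def smooth)

lemma norm_grads0_diff_le:
  "(norm (grads0 x - grads0 z))\<^sup>2 \<le> Lf\<^sup>2 * (real CARD('n) * (norm (avg (($) x) - avg (($) z)))\<^sup>2)"
proof -
  have "norm (grads0 x - grads0 z) \<le> Lf * norm ((\<chi> i. avg (($) x) - avg (($) z)) :: 'b^'n)"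
    using Lf by (intro norm_le_lipschitz_componentwise) (auto simp: grads0_def smooth)
  from power_mono[OF this norm_ge_zero, of 2] show ?thesis
    by (simp add: power_mult_distrib norm_const_vec)
qed

lemma avg_grads0: "avg (($) (grads0 x)) = grad (favg f) (avg (($) x))"
  by (simp add: grads0_def grad_favg avg_def)

lemma gap_nonneg: "0 \<le> favg f y - fstar"
  using minimum[of y] by simp

lemma lyap_lower:
  "(\<kappa>1 - 1) / (2 * \<kappa>1) * (norm (cen x))\<^sup>2 + 1 / (2 * \<rho>) * (norm (dual x v))\<^sup>2
     + real CARD('n) * (favg f (avg (($) x)) - fstar) \<le> lyap x v"
  unfolding lyap_def using lyap_quad_lower[of "dual x v" "cen x"] by (simp add: dual_def)

lemma lyap_upper:
  "lyap x v \<le> kappa5 L \<kappa>1 * ((norm (cen x))\<^sup>2 + (norm (dual x v))\<^sup>2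
     + real CARD('n) * (favg f (avg (($) x)) - fstar))"
proof -
  have "real CARD('n) * (favg f (avg (($) x)) - fstar)
      \<le> kappa5 L \<kappa>1 * (real CARD('n) * (favg f (avg (($) x)) - fstar))"
    using gap_nonneg[of "avg (($) x)"] kappa5_ge
    by (metis mult_le_cancel_right1 mult_nonneg_nonneg not_le of_nat_0_le_iff)
  then show ?thesis
    unfolding lyap_def distrib_left using lyap_quad_upper[of "cen x" "dual x v"]
    unfolding distrib_left by linarith
qed

lemma lyap_controls_error:
  "kappa6 L \<kappa>1 * ((norm (cen x))\<^sup>2 + real CARD('n) * (favg f (avg (($) x)) - fstar)) \<le> lyap x v"
proof -
  have "kappa6 L \<kappa>1 * (norm (cen x))\<^sup>2 \<le> (\<kappa>1 - 1) / (2 * \<kappa>1) * (norm (cen x))\<^sup>2"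
    by (intro mult_right_mono kappa6_bounds) auto
  moreover have "kappa6 L \<kappa>1 * (real CARD('n) * (favg f (avg (($) x)) - fstar))
      \<le> 1 * (real CARD('n) * (favg f (avg (($) x)) - fstar))"
    using gap_nonneg by (intro mult_right_mono kappa6_bounds) auto
  moreover have "0 \<le> 1 / (2 * \<rho>) * (norm (dual x v))\<^sup>2"
    using spectral_radius_bounds by simp
  ultimately show ?thesis using lyap_lower[of x v] unfolding distrib_left by linarith
qed

lemma lyap_nonneg: "0 \<le> lyap x v"
proof -
  have "0 \<le> (norm (cen x))\<^sup>2 + real CARD('n) * (favg f (avg (($) x)) - fstar)"
    using gap_nonneg by simp
  then show ?thesis using lyap_controls_error[of x v] kappa6_bounds(1)
    by (meson less_imp_le mult_nonneg_nonneg order_trans)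
qed

text \<open>If the potential vanished, so would its three parts: the agents would agree, a zero gap
  would make the mean gradient zero by \<open>norm_grad_le_gap\<close>, and a zero dual deviation
  would make every local gradient equal to that mean.\<close>

lemma lyap_pos:
  assumes "x \<noteq> (\<chi> i. avg (($) x)) \<or> grads0 x \<noteq> 0"
  shows "0 < lyap x 0"
proof (rule ccontr)
  let ?gap = "favg f (avg (($) x)) - fstar"
  assume "\<not> 0 < lyap x 0"
  moreover have "0 < (\<kappa>1 - 1) / (2 * \<kappa>1)" "0 < 1 / (2 * \<rho>)" "0 < real CARD('n)"
    using kappa1_gt spectral_radius_bounds by simp_all
  moreover from this have "0 \<le> (\<kappa>1 - 1) / (2 * \<kappa>1) * (norm (cen x))\<^sup>2"
    "0 \<le> 1 / (2 * \<rho>) * (norm (dual x 0))\<^sup>2" "0 \<le> real CARD('n) * ?gap"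
    using gap_nonneg by (intro mult_nonneg_nonneg; force)+
  ultimately have "(\<kappa>1 - 1) / (2 * \<kappa>1) * (norm (cen x))\<^sup>2 = 0"
    "1 / (2 * \<rho>) * (norm (dual x 0))\<^sup>2 = 0" "real CARD('n) * ?gap = 0"
    using lyap_lower[of x 0] by linarith+
  then have y: "cen x = 0" and w: "dual x 0 = 0" and gap: "?gap = 0"
    using kappa1_gt spectral_radius_bounds by auto
  have "x = (\<chi> i. avg (($) x))" using y by (simp add: cen_def vec_eq_iff)
  moreover have "grads0 x = 0"
  proof -
    have "cen (grads0 x) = 0" using w beta_bounds by (simp add: dual_def cen_scaleR)
    moreover have "avg (($) (grads0 x)) = 0"
      using norm_grad_le_gap[OF favg_differentiable favg_smooth Lf minimum, of "avg (($) x)"] gap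
      by (simp add: avg_grads0)
    ultimately show ?thesis by (simp add: cen_def vec_eq_iff)
  qed
  ultimately show False using assms by simp
qed

text \<open>Polarisation replaces the pairing of the gradient with \<open>p\<close> by squares. The
  term in |p|^2 is kept because it later absorbs the quadratic error caused by
  \<open>p\<close>.\<close>

lemma favg_step:
  assumes "x = a - \<eta> *\<^sub>R (p + s)"
  shows "favg f x \<le> favg f a - \<eta> / 2 * (norm (grad (favg f) a))\<^sup>2 - \<eta> / 2 * (norm p)\<^sup>2
    + \<eta> / 2 * (norm (p - grad (favg f) a))\<^sup>2 - \<eta> * (grad (favg f) a \<bullet> s)
    + Lf / 2 * \<eta>\<^sup>2 * (norm (p + s))\<^sup>2"
proof -
  let ?g = "grad (favg f) a"
  have "favg f x \<le> favg f a + ?g \<bullet> (- (\<eta> *\<^sub>R (p + s))) + Lf / 2 * (norm (- (\<eta> *\<^sub>R (p + s))))\<^sup>2"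
    using descent_inequality[OF favg_differentiable favg_smooth, of x a] by (simp add: assms)
  also have "\<dots> = favg f a - \<eta> * (?g \<bullet> p) - \<eta> * (?g \<bullet> s) + Lf / 2 * \<eta>\<^sup>2 * (norm (p + s))\<^sup>2"
    unfolding norm_minus_cancel norm_scaleR inner_minus_right inner_scaleR_right inner_add_right
      power_mult_distrib power2_abs by (simp add: algebra_simps)
  finally have "favg f x \<le> favg f a - \<eta> * (?g \<bullet> p) - \<eta> * (?g \<bullet> s) + Lf / 2 * \<eta>\<^sup>2 * (norm (p + s))\<^sup>2" .
  moreover have "- \<eta> * (?g \<bullet> p) = - \<eta> / 2 * (norm ?g)\<^sup>2 - \<eta> / 2 * (norm p)\<^sup>2 + \<eta> / 2 * (norm (p - ?g))\<^sup>2"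
    by (simp add: power2_norm_eq_inner inner_diff inner_commute algebra_simps)
  ultimately show ?thesis by simp
qed

lemma lyap_step:
  fixes x v s :: "'b^'n"
  assumes v: "cen v = v"
  defines "x' \<equiv> x - \<eta> *\<^sub>R ((\<kappa>1 * \<beta>) *\<^sub>R act L x + \<beta> *\<^sub>R v + (grads x + s))"
    and "v' \<equiv> v + (\<eta> * \<beta>) *\<^sub>R act L x"
  shows "lyap x' v' \<le> (1 - \<eta> * \<epsilon>) * lyap x v + drift x v \<bullet> s
    + \<epsilon>5 * \<eta>\<^sup>2 * (real CARD('n) * (norm (avg (($) s)))\<^sup>2) + \<eta>\<^sup>2 * (norm s)\<^sup>2"
proof -
  define n where "n = real CARD('n)"
  define a where "a = avg (($) x)"
  define p where "p = avg (($) (grads x))"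
  define sb where "sb = avg (($) s)"
  define G where "G = grad (favg f) a"
  define y where "y = cen x"
  define w where "w = dual x v"
  define e where "e = (1 / \<beta>) *\<^sub>R cen (grads x - grads0 x)"
  define \<delta> where "\<delta> = (1 / \<beta>) *\<^sub>R cen (grads0 x' - grads0 x)"
  define P where "P = n * (norm (p + sb))\<^sup>2"
  have n: "0 < n" by (simp add: n_def)
  have b: "0 < \<beta>" by (rule beta_bounds)
  \<comment> \<open>Neither the dual variable nor the Laplacian term moves the average; only the
    averaged stochastic gradient does.\<close>
  have avg0: "avg (($) v) = 0" "avg (($) (act L x)) = 0"
    using v by (intro avg_eq_0; simp)+
  have a': "avg (($) x') = a - \<eta> *\<^sub>R (p + sb)"
    unfolding x'_def a_def p_def sb_def by (simp add: avg_minus avg_add avg_scaleR avg0)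
  have cy: "cen y = y" and cw: "cen w = w" and c\<delta>: "cen \<delta> = \<delta>"
    by (simp_all add: y_def w_def dual_def \<delta>_def cen_scaleR)
  have w_eq: "w = v + (1 / \<beta>) *\<^sub>R cen (grads0 x)"
    by (simp add: w_def dual_def cen_add cen_scaleR v)
  have Ly: "act L y = act L x" by (simp add: y_def)
  have kb: "\<kappa>2 = \<eta> * \<beta>" using eta_bounds by simp
  \<comment> \<open>Centring \<open>\<beta> v + grads x\<close> gives
    \<open>\<beta> (w + e)\<close>: the gradient at the average enters \<open>w\<close>, and the
    remainder is \<open>e\<close>.\<close>
  have y': "cen x' = y - \<kappa>2 *\<^sub>R (\<kappa>1 *\<^sub>R act L y + w + e) - \<eta> *\<^sub>R cen s"
    unfolding x'_def w_eq e_def Ly kb using b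
    by (simp add: cen_diff cen_add cen_scaleR v scaleR_right_distrib scaleR_diff_right y_def mult.assoc)
  have w': "dual x' v' = w + \<kappa>2 *\<^sub>R act L y + \<delta>"
    unfolding w_eq \<delta>_def Ly kb v'_def dual_def
    by (simp add: cen_diff cen_add cen_scaleR v scaleR_diff_right)
  have e: "norm e \<le> Lf / \<beta> * norm y"
  proof -
    have "norm e = 1 / \<beta> * norm (cen (grads x - grads0 x))" using b by (simp add: e_def)
    also have "\<dots> \<le> 1 / \<beta> * (Lf * norm y)"
      using b norm_cen_le[of "grads x - grads0 x"] norm_grads_grads0_le[of x]
      unfolding y_def by (intro mult_left_mono) auto
    finally show ?thesis by simp
  qed
  have quad: "lyap_quad L \<kappa>1 (cen x') (dual x' v') + \<kappa>2 * Lf\<^sup>2 / (2 * \<beta>) * (norm y)\<^sup>2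
    \<le> lyap_quad L \<kappa>1 y w - eps3 L \<kappa>1 \<kappa>2 * (norm y)\<^sup>2 - eps4 \<kappa>2 * (norm w)\<^sup>2
      + (kappa3 L \<kappa>1 * \<beta> / \<kappa>2 + kappa4 L \<kappa>1 / 2) * (norm \<delta>)\<^sup>2
      - \<eta> * (cen s \<bullet> deterministic_part y w e) + \<eta>\<^sup>2 * (norm (cen s))\<^sup>2"
    unfolding y' w' by (rule lyap_quad_step[OF cy cw c\<delta> e])
  have cs: "\<eta>\<^sup>2 * (norm (cen s))\<^sup>2 \<le> \<eta>\<^sup>2 * (norm s)\<^sup>2"
    by (intro mult_left_mono power_mono norm_cen_le) auto
  \<comment> \<open>\<open>\<delta>\<close> sees only the motion \<open>\<eta> (p + sb)\<close> of
    the average, so it is measured by the same \<open>P\<close> as the smoothness remainder of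
    \<open>f\<close>.\<close>
  have "(kappa3 L \<kappa>1 * \<beta> / \<kappa>2 + kappa4 L \<kappa>1 / 2) * (norm \<delta>)\<^sup>2
      \<le> (kappa3 L \<kappa>1 * \<beta> / \<kappa>2 + kappa4 L \<kappa>1 / 2) * (Lf\<^sup>2 * \<eta>\<^sup>2 * P / \<beta>\<^sup>2)"
  proof (rule mult_left_mono)
    have "(norm \<delta>)\<^sup>2 = (norm (cen (grads0 x' - grads0 x)))\<^sup>2 / \<beta>\<^sup>2"
      by (simp add: \<delta>_def power_divide)
    also have "\<dots> \<le> (norm (grads0 x' - grads0 x))\<^sup>2 / \<beta>\<^sup>2"
      by (intro divide_right_mono power_mono norm_cen_le) auto
    also have "\<dots> \<le> Lf\<^sup>2 * (n * (norm (avg (($) x') - a))\<^sup>2) / \<beta>\<^sup>2"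
      unfolding n_def a_def by (intro divide_right_mono norm_grads0_diff_le) auto
    also have "\<dots> = Lf\<^sup>2 * \<eta>\<^sup>2 * P / \<beta>\<^sup>2"
      by (simp add: a' P_def power_mult_distrib)
    finally show "(norm \<delta>)\<^sup>2 \<le> Lf\<^sup>2 * \<eta>\<^sup>2 * P / \<beta>\<^sup>2" .
    show "0 \<le> kappa3 L \<kappa>1 * \<beta> / \<kappa>2 + kappa4 L \<kappa>1 / 2"
      using kappa3_bounds b kappa2 by simp
  qed
  also have "\<dots> = (kappa3 L \<kappa>1 * Lf\<^sup>2 / (\<kappa>2 * \<beta>) + kappa4 L \<kappa>1 * Lf\<^sup>2 / (2 * \<beta>\<^sup>2)) * (\<eta>\<^sup>2 * P)"
    using b kappa2 by (simp add: field_simps power2_eq_square)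
  finally have \<delta>: "(kappa3 L \<kappa>1 * \<beta> / \<kappa>2 + kappa4 L \<kappa>1 / 2) * (norm \<delta>)\<^sup>2
      \<le> (kappa3 L \<kappa>1 * Lf\<^sup>2 / (\<kappa>2 * \<beta>) + kappa4 L \<kappa>1 * Lf\<^sup>2 / (2 * \<beta>\<^sup>2)) * (\<eta>\<^sup>2 * P)" .
  have P0: "0 \<le> \<eta>\<^sup>2 * P" using n by (simp add: P_def)
  have "(Lf / 2 + kappa3 L \<kappa>1 * Lf\<^sup>2 / (\<kappa>2 * \<beta>) + kappa4 L \<kappa>1 * Lf\<^sup>2 / (2 * \<beta>\<^sup>2)) * (\<eta>\<^sup>2 * P)
      \<le> \<epsilon>5 * (\<eta>\<^sup>2 * P)"
    by (intro mult_right_mono eps5_ge P0)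
  then have coef: "Lf / 2 * (\<eta>\<^sup>2 * P) + (kappa3 L \<kappa>1 * Lf\<^sup>2 / (\<kappa>2 * \<beta>) + kappa4 L \<kappa>1 * Lf\<^sup>2 / (2 * \<beta>\<^sup>2)) * (\<eta>\<^sup>2 * P)
      \<le> \<epsilon>5 * (\<eta>\<^sup>2 * P)" by (simp only: distrib_right)
  have "n * (favg f (avg (($) x')) - fstar) \<le> n * (favg f a - \<eta> / 2 * (norm G)\<^sup>2 - \<eta> / 2 * (norm p)\<^sup>2
      + \<eta> / 2 * (norm (p - G))\<^sup>2 - \<eta> * (G \<bullet> sb) + Lf / 2 * \<eta>\<^sup>2 * (norm (p + sb))\<^sup>2 - fstar)"
    using favg_step[OF a'] n unfolding G_def by (intro mult_left_mono) auto
  also have "\<dots> = n * (favg f a - fstar) - \<eta> * (n * (1 / 2 * (norm G)\<^sup>2)) - \<eta> / 2 * (n * (norm p)\<^sup>2)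
      + \<eta> / 2 * (n * (norm (p - G))\<^sup>2) - \<eta> * (n * (G \<bullet> sb)) + Lf / 2 * (\<eta>\<^sup>2 * P)"
    by (simp add: P_def algebra_simps)
  finally have fx: "n * (favg f (avg (($) x')) - fstar) \<le> n * (favg f a - fstar) - \<eta> * (n * (1 / 2 * (norm G)\<^sup>2))
      - \<eta> / 2 * (n * (norm p)\<^sup>2) + \<eta> / 2 * (n * (norm (p - G))\<^sup>2) - \<eta> * (n * (G \<bullet> sb)) + Lf / 2 * (\<eta>\<^sup>2 * P)" .
  have pl: "\<eta> * (n * (\<nu> * (favg f a - fstar))) \<le> \<eta> * (n * (1 / 2 * (norm G)\<^sup>2))"
    using eta_bounds n unfolding G_def by (intro mult_left_mono PL) auto
  \<comment> \<open>Jensen's inequality and smoothness; after multiplication by \<eta> / 2 the bound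
    equals the reserve on the left of \<open>quad\<close>.\<close>
  have "n * (norm (p - G))\<^sup>2 \<le> (norm (grads x - grads0 x))\<^sup>2"
    using card_norm_avg_le[of "grads x - grads0 x"]
    by (simp only: avg_minus avg_grads0 p_def G_def n_def a_def)
  also have "\<dots> \<le> (Lf * norm y)\<^sup>2"
    unfolding y_def by (intro power_mono norm_grads_grads0_le) auto
  finally have "\<eta> / 2 * (n * (norm (p - G))\<^sup>2) \<le> \<eta> / 2 * (Lf * norm y)\<^sup>2"
    using eta_bounds by (intro mult_left_mono) auto
  also have "\<dots> = \<kappa>2 * Lf\<^sup>2 / (2 * \<beta>) * (norm y)\<^sup>2"
    using b by (simp add: eta power_mult_distrib)
  finally have pG: "\<eta> / 2 * (n * (norm (p - G))\<^sup>2) \<le> \<kappa>2 * Lf\<^sup>2 / (2 * \<beta>) * (norm y)\<^sup>2" .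
  \<comment> \<open>The part in |p|^2 is absorbed by the descent of \<open>f\<close>, the cross part
    joins \<open>drift\<close>, and the part in |sb|^2 survives as noise.\<close>
  have Pexp: "\<epsilon>5 * (\<eta>\<^sup>2 * P) = \<eta> * \<epsilon>5 * (\<eta> * (n * (norm p)\<^sup>2)) + 2 * \<epsilon>5 * \<eta>\<^sup>2 * (n * (p \<bullet> sb))
      + \<epsilon>5 * \<eta>\<^sup>2 * (n * (norm sb)\<^sup>2)"
    by (simp add: P_def power2_norm_eq_inner inner_add inner_commute algebra_simps)
       (simp add: power2_eq_square algebra_simps)
  have "\<eta> * \<epsilon>5 * (\<eta> * (n * (norm p)\<^sup>2)) \<le> 1 / 4 * (\<eta> * (n * (norm p)\<^sup>2))"
    using eta_bounds n by (intro mult_right_mono) auto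
  moreover have "0 \<le> \<eta> * (n * (norm p)\<^sup>2)" using eta_bounds n by simp
  ultimately have p4: "\<eta> * \<epsilon>5 * (\<eta> * (n * (norm p)\<^sup>2)) \<le> \<eta> / 2 * (n * (norm p)\<^sup>2)" by linarith
  have drift: "drift x v \<bullet> s = 2 * \<epsilon>5 * \<eta>\<^sup>2 * (n * (p \<bullet> sb)) - \<eta> * (n * (G \<bullet> sb))
      - \<eta> * (cen s \<bullet> deterministic_part y w e)"
  proof -
    have "cen (deterministic_part y w e) \<bullet> s = cen s \<bullet> deterministic_part y w e"
      by (metis inner_cen inner_commute)
    then show ?thesis
      unfolding drift_def inner_diff_left inner_const_vec y_def[symmetric] w_def[symmetric] e_def[symmetric]
        p_def[symmetric] a_def[symmetric] G_def[symmetric] sb_def[symmetric] n_def[symmetric]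
      by (simp add: algebra_simps)
  qed
  have "\<eta> * \<epsilon> * lyap x v \<le> \<eta> * \<epsilon> * (kappa5 L \<kappa>1 * ((norm y)\<^sup>2 + (norm w)\<^sup>2 + n * (favg f a - fstar)))"
    unfolding y_def w_def n_def a_def using eta_bounds rate_bounds
    by (intro mult_left_mono lyap_upper) auto
  also have "\<dots> = \<eta> * \<epsilon> * kappa5 L \<kappa>1 * (norm y)\<^sup>2 + \<eta> * \<epsilon> * kappa5 L \<kappa>1 * (norm w)\<^sup>2
      + \<eta> * \<epsilon> * kappa5 L \<kappa>1 * (n * (favg f a - fstar))"
    by (simp add: distrib_left mult.assoc)
  also have "\<dots> \<le> eps3 L \<kappa>1 \<kappa>2 * (norm y)\<^sup>2 + eps4 \<kappa>2 * (norm w)\<^sup>2 + \<eta> * \<nu> * (n * (favg f a - fstar))"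
    using n gap_nonneg by (intro add_mono mult_right_mono rate_bounds) auto
  also have "\<eta> * \<nu> * (n * (favg f a - fstar)) = \<eta> * (n * (\<nu> * (favg f a - fstar)))"
    by (simp add: ac_simps)
  finally have rate: "\<eta> * \<epsilon> * lyap x v \<le> eps3 L \<kappa>1 \<kappa>2 * (norm y)\<^sup>2 + eps4 \<kappa>2 * (norm w)\<^sup>2
      + \<eta> * (n * (\<nu> * (favg f a - fstar)))" .
  have "lyap x' v' = lyap_quad L \<kappa>1 (cen x') (dual x' v') + n * (favg f (avg (($) x')) - fstar)"
    "lyap x v = lyap_quad L \<kappa>1 y w + n * (favg f a - fstar)"
    by (simp_all add: lyap_def n_def y_def w_def a_def)
  moreover have "(1 - \<eta> * \<epsilon>) * lyap x v = lyap x v - \<eta> * \<epsilon> * lyap x v" by (simp add: left_diff_distrib)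
  ultimately show ?thesis
    using quad cs \<delta> coef fx pl pG Pexp p4 drift rate unfolding n_def[symmetric] sb_def[symmetric] by linarith
qed

end

section \<open>Independent noise\<close>

lemma borel_measurable_vec_lambda:
  fixes F :: "'n::finite \<Rightarrow> 'w \<Rightarrow> 'b::euclidean_space"
  assumes "\<And>i. F i \<in> borel_measurable M"
  shows "(\<lambda>\<omega>. \<chi> i. F i \<omega>) \<in> borel_measurable M"
proof -
  have "(\<lambda>\<omega>. (\<chi> i. F i \<omega>) \<bullet> axis j u) \<in> borel_measurable M" for j u
  proof -
    have "(\<lambda>\<omega>. (\<chi> i. F i \<omega>) \<bullet> axis j u) = (\<lambda>\<omega>. F j \<omega> \<bullet> u)"
      by (simp add: fun_eq_iff inner_axis)
    then show ?thesis using assms[of j] by simp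
  qed
  then show ?thesis
    by (subst borel_measurable_euclidean_space) (auto simp: Basis_vec_def)
qed

context prob_space
begin

text \<open>The sigma-algebra generated by the variables with index in \<open>K\<close>. As a
  pullback from the product space, its sets are preimages of product-measurable sets, to which
  independence of disjoint index blocks applies.\<close>

definition gen_by :: "('i \<Rightarrow> 's measure) \<Rightarrow> ('i \<Rightarrow> 'a \<Rightarrow> 's) \<Rightarrow> 'i set \<Rightarrow> 'a measure" where
  "gen_by T X K = vimage_algebra (space M) (\<lambda>\<omega>. \<lambda>i\<in>K. X i \<omega>) (PiM K T)"

lemma subalgebra_gen_by:
  assumes "\<And>i. i \<in> K \<Longrightarrow> X i \<in> measurable M (T i)"
  shows "subalgebra M (gen_by T X K)"
proof -
  have "(\<lambda>\<omega>. \<lambda>i\<in>K. X i \<omega>) \<in> measurable M (PiM K T)"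
    using assms by (rule measurable_restrict)
  then have "sets (gen_by T X K) \<subseteq> sets M"
    unfolding gen_by_def sets_vimage_algebra
    by (intro sets.sigma_sets_subset) (auto intro: measurable_sets)
  then show ?thesis by (simp add: subalgebra_def gen_by_def)
qed

lemma measurable_gen_by:
  assumes "\<And>i. i \<in> K \<Longrightarrow> X i \<in> measurable M (T i)" "j \<in> K"
  shows "X j \<in> measurable (gen_by T X K) (T j)"
proof -
  have "(\<lambda>\<omega>. \<lambda>i\<in>K. X i \<omega>) \<in> measurable (gen_by T X K) (PiM K T)"
    unfolding gen_by_def using measurable_space[OF measurable_restrict[of K X M T]] assms(1)
    by (intro measurable_vimage_algebra1 funcsetI) blast
  from measurable_compose[OF this measurable_component_singleton[OF assms(2)]]
  show ?thesis using assms(2) by simp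
qed

text \<open>Independence of the past and \<open>X q\<close> as a product law, checked on rectangles.
  The first component keeps the outcome itself, so that any past-measurable function can be
  inserted.\<close>

lemma joint_distr_gen_by:
  assumes ind: "indep_vars T X UNIV" and q: "q \<notin> K"
  defines "F \<equiv> gen_by T X K"
  shows "distr M F (\<lambda>\<omega>. \<omega>) \<Otimes>\<^sub>M distr M (T q) (X q) = distr M (F \<Otimes>\<^sub>M T q) (\<lambda>\<omega>. (\<omega>, X q \<omega>))"
proof -
  have rv: "X i \<in> measurable M (T i)" for i
    using ind by (auto simp: indep_vars_def)
  define Y where "Y \<omega> = (\<lambda>i\<in>K. X i \<omega>)" for \<omega>
  have Y: "Y \<in> measurable M (PiM K T)" unfolding Y_def by (rule measurable_restrict) (rule rv)
  have setsF: "sets F = {Y -` A \<inter> space M | A. A \<in> sets (PiM K T)}"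
    unfolding F_def gen_by_def using measurable_space[OF Y]
    by (subst sets_vimage_algebra2) (auto simp: Y_def)
  have F: "subalgebra M F" unfolding F_def by (rule subalgebra_gen_by) (rule rv)
  have id: "(\<lambda>\<omega>. \<omega>) \<in> measurable M F"
    using F by (intro measurableI) (auto simp: subalgebra_def dest: sets.sets_into_space)
  have pair: "(\<lambda>\<omega>. (\<omega>, X q \<omega>)) \<in> measurable M (F \<Otimes>\<^sub>M T q)"
    by (intro measurable_Pair id rv)
  interpret P: prob_space "distr M F (\<lambda>\<omega>. \<omega>)" by (rule prob_space_distr[OF id])
  interpret D: prob_space "distr M (T q) (X q)" by (rule prob_space_distr[OF rv])
  show ?thesis
  proof (rule pair_measure_eqI)
    show "sigma_finite_measure (distr M F (\<lambda>\<omega>. \<omega>))" "sigma_finite_measure (distr M (T q) (X q))" ..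
    show "sets (distr M F (\<lambda>\<omega>. \<omega>) \<Otimes>\<^sub>M distr M (T q) (X q)) = sets (distr M (F \<Otimes>\<^sub>M T q) (\<lambda>\<omega>. (\<omega>, X q \<omega>)))"
      unfolding sets_distr by (intro sets_pair_measure_cong sets_distr)
  next
    fix A B assume "A \<in> sets (distr M F (\<lambda>\<omega>. \<omega>))" and "B \<in> sets (distr M (T q) (X q))"
    then have A: "A \<in> sets F" and B: "B \<in> sets (T q)" by simp_all
    then obtain A' where A': "A' \<in> sets (PiM K T)" "A = Y -` A' \<inter> space M"
      unfolding setsF by blast
    \<comment> \<open>\<open>indep_var_restrict\<close> speaks of restrictions to index sets, so
      \<open>B\<close> is lifted to the one-point index set \<open>{q}\<close>.\<close>
    define B' where "B' = (\<lambda>y. y q) -` B \<inter> space (PiM {q} T)"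
    have B': "B' \<in> sets (PiM {q} T)"
      unfolding B'_def
      by (rule measurable_sets[OF measurable_component_singleton[where i = q]]) (simp_all add: B)
    have "indep_var (PiM K T) Y (PiM {q} T) (\<lambda>\<omega>. \<lambda>i\<in>{q}. X i \<omega>)"
      unfolding Y_def using q by (intro indep_var_restrict[OF ind]) auto
    from indep_varD[OF this A'(1) B'] have
      "prob ((\<lambda>\<omega>. (Y \<omega>, \<lambda>i\<in>{q}. X i \<omega>)) -` (A' \<times> B') \<inter> space M)
        = prob (Y -` A' \<inter> space M) * prob ((\<lambda>\<omega>. \<lambda>i\<in>{q}. X i \<omega>) -` B' \<inter> space M)" .
    moreover have "(\<lambda>\<omega>. \<lambda>i\<in>{q}. X i \<omega>) -` B' \<inter> space M = X q -` B \<inter> space M"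
      using measurable_space[OF rv] by (auto simp: B'_def space_PiM)
    moreover from this have "(\<lambda>\<omega>. (Y \<omega>, \<lambda>i\<in>{q}. X i \<omega>)) -` (A' \<times> B') \<inter> space M = A \<inter> (X q -` B \<inter> space M)"
      using A'(2) by auto
    ultimately have *: "prob (A \<inter> (X q -` B \<inter> space M)) = prob A * prob (X q -` B \<inter> space M)"
      using A'(2) by simp
    have "A \<in> sets M" using A F by (auto simp: subalgebra_def)
    then have AM: "A \<inter> space M = A" by (simp add: Int_absorb2 sets.sets_into_space)
    have "emeasure (distr M (F \<Otimes>\<^sub>M T q) (\<lambda>\<omega>. (\<omega>, X q \<omega>))) (A \<times> B)
        = emeasure M (A \<inter> (X q -` B \<inter> space M))"
      using A B by (subst emeasure_distr[OF pair]) (auto intro!: arg_cong[where f = "emeasure M"])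
    moreover have "emeasure (distr M F (\<lambda>\<omega>. \<omega>)) A = emeasure M A"
      using A AM by (subst emeasure_distr[OF id]) auto
    moreover have "emeasure (distr M (T q) (X q)) B = emeasure M (X q -` B \<inter> space M)"
      using B by (subst emeasure_distr[OF rv]) auto
    ultimately show "emeasure (distr M F (\<lambda>\<omega>. \<omega>)) A * emeasure (distr M (T q) (X q)) B
        = emeasure (distr M (F \<Otimes>\<^sub>M T q) (\<lambda>\<omega>. (\<omega>, X q \<omega>))) (A \<times> B)"
      using * by (simp add: emeasure_eq_measure ennreal_mult')
  qed
qed

text \<open>Measurability refers to \<open>F\<close>, integrability always to \<open>M\<close>; with
  a past sigma-algebra for \<open>F\<close>, this describes square-integrable vectors determined by
  the past.\<close>

definition L2 :: "'a measure \<Rightarrow> ('a \<Rightarrow> 'b::euclidean_space) \<Rightarrow> bool" where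
  "L2 F Y \<longleftrightarrow> Y \<in> borel_measurable F \<and> integrable M (\<lambda>\<omega>. (norm (Y \<omega>))\<^sup>2)"

lemma L2_dominated:
  assumes "subalgebra M F" "Y \<in> borel_measurable F"
    and "integrable M b" "\<And>\<omega>. \<omega> \<in> space M \<Longrightarrow> (norm (Y \<omega>))\<^sup>2 \<le> b \<omega>"
  shows "L2 F Y"
  unfolding L2_def
proof
  have "Y \<in> borel_measurable M" using assms(1,2) by (rule measurable_from_subalg)
  then show "integrable M (\<lambda>\<omega>. (norm (Y \<omega>))\<^sup>2)"
    using assms(4) by (intro Bochner_Integration.integrable_bound[OF assms(3)] AE_I2) fastforce+
qed fact

lemma L2_cong:
  fixes Y Z :: "'a \<Rightarrow> 'b::euclidean_space"
  assumes "L2 M Z" "\<And>\<omega>. \<omega> \<in> space M \<Longrightarrow> Y \<omega> = Z \<omega>"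
  shows "L2 M Y"
proof -
  have "Y \<in> borel_measurable M \<longleftrightarrow> Z \<in> borel_measurable M"
    by (rule measurable_cong) (rule assms(2))
  moreover have "integrable M (\<lambda>\<omega>. (norm (Y \<omega>))\<^sup>2) \<longleftrightarrow> integrable M (\<lambda>\<omega>. (norm (Z \<omega>))\<^sup>2)"
    by (rule Bochner_Integration.integrable_cong) (simp_all add: assms(2))
  ultimately show ?thesis using assms(1) by (simp add: L2_def)
qed

lemma subalgebra_self: "subalgebra M M"
  by (simp add: subalgebra_def)

lemma L2_const: "subalgebra M F \<Longrightarrow> L2 F (\<lambda>\<omega>. c)"
  by (simp add: L2_def)

lemma L2_add:
  assumes F: "subalgebra M F" and "L2 F Y" "L2 F Z"
  shows "L2 F (\<lambda>\<omega>. Y \<omega> + Z \<omega>)"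
proof (rule L2_dominated[OF F])
  show "(\<lambda>\<omega>. Y \<omega> + Z \<omega>) \<in> borel_measurable F"
    using assms by (auto simp: L2_def)
  show "integrable M (\<lambda>\<omega>. 2 * (norm (Y \<omega>))\<^sup>2 + 2 * (norm (Z \<omega>))\<^sup>2)"
    using assms by (auto simp: L2_def)
  fix \<omega>
  have "(norm (Y \<omega> + Z \<omega>))\<^sup>2 \<le> (norm (Y \<omega>) + norm (Z \<omega>))\<^sup>2"
    by (intro power_mono norm_triangle_ineq) auto
  also have "\<dots> \<le> 2 * (norm (Y \<omega>))\<^sup>2 + 2 * (norm (Z \<omega>))\<^sup>2"
    using sum_squares_bound[of "norm (Y \<omega>)" "norm (Z \<omega>)"] by (simp add: power2_sum)
  finally show "(norm (Y \<omega> + Z \<omega>))\<^sup>2 \<le> 2 * (norm (Y \<omega>))\<^sup>2 + 2 * (norm (Z \<omega>))\<^sup>2" .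
qed

lemma L2_scaleR: "L2 F Y \<Longrightarrow> L2 F (\<lambda>\<omega>. c *\<^sub>R Y \<omega>)"
  by (auto simp: L2_def power_mult_distrib)

lemma L2_diff: "subalgebra M F \<Longrightarrow> L2 F Y \<Longrightarrow> L2 F Z \<Longrightarrow> L2 F (\<lambda>\<omega>. Y \<omega> - Z \<omega>)"
  using L2_add[of F Y "\<lambda>\<omega>. (- 1) *\<^sub>R Z \<omega>"] L2_scaleR[of F Z "- 1"] by simp

text \<open>A Lipschitz map grows at most linearly, so square integrability survives; this carries
  the gradients through the iteration.\<close>

lemma L2_lipschitz:
  assumes F: "subalgebra M F" and Y: "L2 F Y"
    and lip: "\<And>x y. norm (\<phi> x - \<phi> y) \<le> K * norm (x - y)"
  shows "L2 F (\<lambda>\<omega>. \<phi> (Y \<omega>))"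
proof (rule L2_dominated[OF F])
  have "continuous_on UNIV \<phi>"
  proof (rule lipschitz_on_continuous_on)
    show "\<bar>K\<bar>-lipschitz_on UNIV \<phi>"
      unfolding lipschitz_on_def dist_norm
      by (auto intro!: order_trans[OF lip] mult_right_mono)
  qed
  then show "(\<lambda>\<omega>. \<phi> (Y \<omega>)) \<in> borel_measurable F"
    using Y by (intro borel_measurable_continuous_on[of \<phi> Y]) (simp_all add: L2_def)
  show "integrable M (\<lambda>\<omega>. 2 * (norm (\<phi> 0))\<^sup>2 + 2 * (K\<^sup>2 * (norm (Y \<omega>))\<^sup>2))"
    using Y by (auto simp: L2_def)
  fix \<omega>
  have "norm (\<phi> (Y \<omega>)) \<le> norm (\<phi> 0) + norm (\<phi> (Y \<omega>) - \<phi> 0)" by (rule norm_triangle_sub)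
  also have "\<dots> \<le> norm (\<phi> 0) + K * norm (Y \<omega>)" using lip[of "Y \<omega>" 0] by simp
  finally have "(norm (\<phi> (Y \<omega>)))\<^sup>2 \<le> (norm (\<phi> 0) + K * norm (Y \<omega>))\<^sup>2"
    by (intro power_mono) auto
  also have "\<dots> \<le> 2 * (norm (\<phi> 0))\<^sup>2 + 2 * (K\<^sup>2 * (norm (Y \<omega>))\<^sup>2)"
    using sum_squares_bound[of "norm (\<phi> 0)" "K * norm (Y \<omega>)"]
    by (simp add: power2_sum power_mult_distrib)
  finally show "(norm (\<phi> (Y \<omega>)))\<^sup>2 \<le> 2 * (norm (\<phi> 0))\<^sup>2 + 2 * (K\<^sup>2 * (norm (Y \<omega>))\<^sup>2)" .
qed

lemma L2_linear:
  assumes "subalgebra M F" "L2 F Y" "linear \<phi>"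
  shows "L2 F (\<lambda>\<omega>. \<phi> (Y \<omega>))"
proof -
  obtain K where K: "\<And>x. norm (\<phi> x) \<le> K * norm x"
    using linear_bounded[OF assms(3)] by auto
  show ?thesis
  proof (rule L2_lipschitz[OF assms(1,2)])
    show "norm (\<phi> x - \<phi> y) \<le> K * norm (x - y)" for x y
      using K[of "x - y"] by (simp only: linear_diff[OF assms(3)])
  qed
qed

lemma L2_inner_integrable:
  assumes "L2 M Y" "L2 M Z"
  shows "integrable M (\<lambda>\<omega>. Y \<omega> \<bullet> Z \<omega>)"
proof (rule Bochner_Integration.integrable_bound)
  show "integrable M (\<lambda>\<omega>. (norm (Y \<omega>))\<^sup>2 + (norm (Z \<omega>))\<^sup>2)"
    using assms by (auto simp: L2_def)
  show "(\<lambda>\<omega>. Y \<omega> \<bullet> Z \<omega>) \<in> borel_measurable M" using assms by (auto simp: L2_def)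
  have "\<bar>Y \<omega> \<bullet> Z \<omega>\<bar> \<le> (norm (Y \<omega>))\<^sup>2 + (norm (Z \<omega>))\<^sup>2" for \<omega>
  proof -
    have "\<bar>Y \<omega> \<bullet> Z \<omega>\<bar> \<le> norm (Y \<omega>) * norm (Z \<omega>)" by (rule Cauchy_Schwarz_ineq2)
    also have "\<dots> \<le> (norm (Y \<omega>))\<^sup>2 + (norm (Z \<omega>))\<^sup>2"
      using sum_squares_bound[of "norm (Y \<omega>)" "norm (Z \<omega>)"]
        mult_nonneg_nonneg[OF norm_ge_zero norm_ge_zero, of "Y \<omega>" "Z \<omega>"] by linarith
    finally show ?thesis .
  qed
  then show "AE \<omega> in M. norm (Y \<omega> \<bullet> Z \<omega>) \<le> norm ((norm (Y \<omega>))\<^sup>2 + (norm (Z \<omega>))\<^sup>2)" by simp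
qed

lemma L2_mono: "subalgebra M F \<Longrightarrow> L2 F Y \<Longrightarrow> L2 M Y"
  unfolding L2_def using measurable_from_subalg by blast

text \<open>The identity map from \<open>M\<close> to \<open>F\<close> is independent of \<open>X\<close>, so Fubini's theorem replaces
  conditioning on \<open>F\<close> by integrating out \<open>X\<close>.\<close>

lemma independent_noise:
  fixes h :: "'a \<Rightarrow> 's \<Rightarrow> 'b::euclidean_space"
  assumes F: "subalgebra M F" and X: "X \<in> measurable M T"
    and ind: "distr M F (\<lambda>\<omega>. \<omega>) \<Otimes>\<^sub>M distr M T X = distr M (F \<Otimes>\<^sub>M T) (\<lambda>\<omega>. (\<omega>, X \<omega>))"
    and h: "(\<lambda>(\<omega>, s). h \<omega> s) \<in> borel_measurable (F \<Otimes>\<^sub>M T)"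
    and mean: "\<And>\<omega>. \<omega> \<in> space M \<Longrightarrow> has_bochner_integral M (\<lambda>\<omega>'. h \<omega> (X \<omega>')) 0"
    and var: "\<And>\<omega>. \<omega> \<in> space M \<Longrightarrow> integrable M (\<lambda>\<omega>'. (norm (h \<omega> (X \<omega>')))\<^sup>2) \<and>
        (\<integral>\<omega>'. (norm (h \<omega> (X \<omega>')))\<^sup>2 \<partial>M) \<le> c"
  shows "L2 M (\<lambda>\<omega>. h \<omega> (X \<omega>))" and "(\<integral>\<omega>. (norm (h \<omega> (X \<omega>)))\<^sup>2 \<partial>M) \<le> c"
    and "L2 F u \<Longrightarrow> (\<integral>\<omega>. u \<omega> \<bullet> h \<omega> (X \<omega>) \<partial>M) = 0"
proof -
  define P where "P = distr M F (\<lambda>\<omega>. \<omega>)"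
  define D where "D = distr M T X"
  have joint: "P \<Otimes>\<^sub>M D = distr M (F \<Otimes>\<^sub>M T) (\<lambda>\<omega>. (\<omega>, X \<omega>))"
    using ind by (simp add: P_def D_def)
  have id: "(\<lambda>\<omega>. \<omega>) \<in> measurable M F"
    using F by (intro measurableI) (auto simp: subalgebra_def dest: sets.sets_into_space)
  interpret P: prob_space P unfolding P_def by (rule prob_space_distr[OF id])
  interpret D: prob_space D unfolding D_def by (rule prob_space_distr[OF X])
  interpret PD: pair_prob_space P D ..
  have spP: "space P = space M" using F by (simp add: P_def subalgebra_def)
  have [measurable_cong]: "sets P = sets F" "sets D = sets T" by (simp_all add: P_def D_def)
  note [measurable] = id X
  have pair [measurable]: "(\<lambda>\<omega>. (\<omega>, X \<omega>)) \<in> measurable M (F \<Otimes>\<^sub>M T)" by measurable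
  have hM: "(\<lambda>\<omega>. h \<omega> (X \<omega>)) \<in> borel_measurable M"
    using measurable_compose[OF pair h] by simp
  have h' [measurable]: "(\<lambda>z. h (fst z) (snd z)) \<in> borel_measurable (F \<Otimes>\<^sub>M T)"
    using h by (simp add: split_beta')
  have hsec: "(\<lambda>s. h \<omega> s) \<in> borel_measurable T" if "\<omega> \<in> space M" for \<omega>
    using measurable_Pair2[OF h, of \<omega>] that F by (simp add: subalgebra_def)
  have c: "0 \<le> c"
  proof -
    obtain \<omega> where "\<omega> \<in> space M" using not_empty by blast
    have "0 \<le> (\<integral>\<omega>'. (norm (h \<omega> (X \<omega>')))\<^sup>2 \<partial>M)" by simp
    also have "\<dots> \<le> c" using var[OF \<open>\<omega> \<in> space M\<close>] by blast
    finally show ?thesis .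
  qed
  have "(\<integral>\<^sup>+\<omega>. ennreal ((norm (h \<omega> (X \<omega>)))\<^sup>2) \<partial>M)
      = (\<integral>\<^sup>+z. ennreal ((norm (h (fst z) (snd z)))\<^sup>2) \<partial>(P \<Otimes>\<^sub>M D))"
    unfolding joint by (subst nn_integral_distr) auto
  also have "\<dots> = (\<integral>\<^sup>+\<omega>. (\<integral>\<^sup>+s. ennreal ((norm (h \<omega> s))\<^sup>2) \<partial>D) \<partial>P)"
    by (subst D.nn_integral_fst[symmetric]) auto
  also have "\<dots> \<le> (\<integral>\<^sup>+\<omega>. ennreal c \<partial>P)"
  proof (rule nn_integral_mono)
    fix \<omega> assume "\<omega> \<in> space P"
    then have \<omega>: "\<omega> \<in> space M" by (simp add: spP)
    have "(\<integral>\<^sup>+s. ennreal ((norm (h \<omega> s))\<^sup>2) \<partial>D) = (\<integral>\<^sup>+\<omega>'. ennreal ((norm (h \<omega> (X \<omega>')))\<^sup>2) \<partial>M)"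
      unfolding D_def using hsec[OF \<omega>] by (subst nn_integral_distr) auto
    also have "\<dots> = ennreal (\<integral>\<omega>'. (norm (h \<omega> (X \<omega>')))\<^sup>2 \<partial>M)"
      using var[OF \<omega>] by (intro nn_integral_eq_integral) auto
    finally show "(\<integral>\<^sup>+s. ennreal ((norm (h \<omega> s))\<^sup>2) \<partial>D) \<le> ennreal c"
      using var[OF \<omega>] by (simp add: ennreal_leI)
  qed
  also have "\<dots> = ennreal c" by (simp add: P.emeasure_space_1)
  finally have le: "(\<integral>\<^sup>+\<omega>. ennreal ((norm (h \<omega> (X \<omega>)))\<^sup>2) \<partial>M) \<le> ennreal c" .
  \<comment> \<open>Tonelli's theorem for the nonnegative square supplies the integrability on which
    Fubini's theorem for the signed pairing below relies.\<close>
  have int: "integrable M (\<lambda>\<omega>. (norm (h \<omega> (X \<omega>)))\<^sup>2)"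
    using hM le by (intro integrableI_bounded) (auto simp: le_less_trans[OF _ ennreal_less_top])
  then show L2h: "L2 M (\<lambda>\<omega>. h \<omega> (X \<omega>))" using hM by (simp add: L2_def)
  show "(\<integral>\<omega>. (norm (h \<omega> (X \<omega>)))\<^sup>2 \<partial>M) \<le> c"
    using le c int by (simp add: nn_integral_eq_integral)
  assume u: "L2 F u"
  then have [measurable]: "u \<in> borel_measurable F" by (simp add: L2_def)
  have m: "(\<lambda>z. u (fst z) \<bullet> h (fst z) (snd z)) \<in> borel_measurable (F \<Otimes>\<^sub>M T)" by measurable
  have "integrable M (\<lambda>\<omega>. u \<omega> \<bullet> h \<omega> (X \<omega>))"
    by (intro L2_inner_integrable L2_mono[OF F u] L2h)
  then have "integrable (P \<Otimes>\<^sub>M D) (\<lambda>(\<omega>, s). u \<omega> \<bullet> h \<omega> s)"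
    unfolding joint using integrable_distr_eq[OF pair m] by (simp add: split_beta')
  then have "(\<integral>z. u (fst z) \<bullet> h (fst z) (snd z) \<partial>(P \<Otimes>\<^sub>M D)) = (\<integral>\<omega>. (\<integral>s. u \<omega> \<bullet> h \<omega> s \<partial>D) \<partial>P)"
    by (subst PD.integral_fst'[symmetric]) (auto simp: split_beta')
  also have "\<dots> = (\<integral>\<omega>. 0 \<partial>P)"
  proof (rule Bochner_Integration.integral_cong[OF refl])
    fix \<omega> assume "\<omega> \<in> space P"
    then have \<omega>: "\<omega> \<in> space M" by (simp add: spP)
    have "(\<integral>s. u \<omega> \<bullet> h \<omega> s \<partial>D) = (\<integral>\<omega>'. u \<omega> \<bullet> h \<omega> (X \<omega>') \<partial>M)"
      unfolding D_def using hsec[OF \<omega>] by (subst integral_distr) auto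
    also have "\<dots> = u \<omega> \<bullet> (\<integral>\<omega>'. h \<omega> (X \<omega>') \<partial>M)"
      using mean[OF \<omega>] by (intro integral_inner_right) (auto simp: has_bochner_integral_iff)
    finally show "(\<integral>s. u \<omega> \<bullet> h \<omega> s \<partial>D) = 0" using mean[OF \<omega>] by (simp add: has_bochner_integral_iff)
  qed
  finally show "(\<integral>\<omega>. u \<omega> \<bullet> h \<omega> (X \<omega>) \<partial>M) = 0"
    unfolding joint using integral_distr[OF pair m] by simp
qed

end

section \<open>The stochastic process\<close>

locale sgd_process = pd_system E L f fstar Lf \<nu> \<kappa>1 \<kappa>2 \<beta> \<eta> \<epsilon> + prob_space M
  for E :: "('n::finite \<times> 'n) set" and L :: "real^'n^'n"
    and f :: "'n \<Rightarrow> real^'p::finite \<Rightarrow> real" and fstar Lf \<nu> \<kappa>1 \<kappa>2 \<beta> \<eta> \<epsilon>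
    and M :: "'w measure" +
  fixes S :: "'n \<Rightarrow> 's measure" and g :: "'n \<Rightarrow> real^'p \<Rightarrow> 's \<Rightarrow> real^'p"
    and \<xi> :: "'n \<Rightarrow> nat \<Rightarrow> 'w \<Rightarrow> 's" and \<sigma> :: real
    and x0 :: "'n \<Rightarrow> real^'p" and x v :: "'n \<Rightarrow> nat \<Rightarrow> 'w \<Rightarrow> real^'p"
  assumes g_meas: "(\<lambda>(y, s). g i y s) \<in> borel_measurable (borel \<Otimes>\<^sub>M S i)"
    and indep: "indep_vars (\<lambda>(i, k). S i) (\<lambda>(i, k). \<xi> i k) UNIV"
    and unbiased: "has_bochner_integral M (\<lambda>\<omega>. g i y (\<xi> i k \<omega>)) (grad (f i) y)"
    and variance: "integrable M (\<lambda>\<omega>. (norm (g i y (\<xi> i k \<omega>) - grad (f i) y))\<^sup>2) \<and>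
          (\<integral>\<omega>. (norm (g i y (\<xi> i k \<omega>) - grad (f i) y))\<^sup>2 \<partial>M) \<le> \<sigma>\<^sup>2"
    and alg: "primal_dual_sgd M L g \<xi> (\<lambda>k. \<kappa>1 * \<beta>) (\<lambda>k. \<beta>) (\<lambda>k. \<eta>) x0 x v"
begin

definition X :: "nat \<Rightarrow> 'w \<Rightarrow> (real^'p)^'n" where
  "X k \<omega> = (\<chi> i. x i k \<omega>)"

definition V :: "nat \<Rightarrow> 'w \<Rightarrow> (real^'p)^'n" where
  "V k \<omega> = (\<chi> i. v i k \<omega>)"

definition noise :: "nat \<Rightarrow> 'w \<Rightarrow> (real^'p)^'n" where
  "noise k \<omega> = (\<chi> i. g i (x i k \<omega>) (\<xi> i k \<omega>) - grad (f i) (x i k \<omega>))"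

abbreviation past :: "('n \<times> nat) set \<Rightarrow> 'w measure" where
  "past K \<equiv> gen_by (\<lambda>(i, k). S i) (\<lambda>(i, k). \<xi> i k) K"

lemma alg_init:
  assumes "\<omega> \<in> space M"
  shows "x i 0 \<omega> = x0 i" "v i 0 \<omega> = 0"
  using alg assms by (auto simp: primal_dual_sgd_def)

lemma alg_step:
  assumes "\<omega> \<in> space M"
  shows "x i (Suc k) \<omega> = x i k \<omega> - \<eta> *\<^sub>R ((\<kappa>1 * \<beta>) *\<^sub>R (\<Sum>j\<in>UNIV. L $ i $ j *\<^sub>R x j k \<omega>)
      + \<beta> *\<^sub>R v i k \<omega> + g i (x i k \<omega>) (\<xi> i k \<omega>))"
    and "v i (Suc k) \<omega> = v i k \<omega> + (\<eta> * \<beta>) *\<^sub>R (\<Sum>j\<in>UNIV. L $ i $ j *\<^sub>R x j k \<omega>)"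
  using alg assms by (auto simp: primal_dual_sgd_def)

lemma X_0: "\<omega> \<in> space M \<Longrightarrow> X 0 \<omega> = (\<chi> i. x0 i)"
  by (simp add: X_def alg_init)

lemma V_0: "\<omega> \<in> space M \<Longrightarrow> V 0 \<omega> = 0"
  by (simp add: V_def alg_init vec_eq_iff)

lemma X_Suc:
  "\<omega> \<in> space M \<Longrightarrow> X (Suc k) \<omega> = X k \<omega> - \<eta> *\<^sub>R ((\<kappa>1 * \<beta>) *\<^sub>R act L (X k \<omega>) + \<beta> *\<^sub>R V k \<omega>
     + (grads (X k \<omega>) + noise k \<omega>))"
  by (simp add: X_def V_def noise_def grads_def act_def alg_step vec_eq_iff)

lemma V_Suc: "\<omega> \<in> space M \<Longrightarrow> V (Suc k) \<omega> = V k \<omega> + (\<eta> * \<beta>) *\<^sub>R act L (X k \<omega>)"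
  by (simp add: X_def V_def act_def alg_step vec_eq_iff)

lemma cen_V: "\<omega> \<in> space M \<Longrightarrow> cen (V k \<omega>) = V k \<omega>"
proof (induction k)
  case 0
  then show ?case by (simp add: V_0 cen_ident)
next
  case (Suc k)
  then show ?case by (simp add: V_Suc cen_add cen_scaleR)
qed

lemma xi_measurable: "\<xi> i k \<in> measurable M (S i)"
  using indep by (auto simp: indep_vars_def split: prod.splits dest: spec[of _ i])

lemma subalgebra_past: "subalgebra M (past K)"
  by (rule subalgebra_gen_by) (auto simp: xi_measurable)

lemma space_past [simp]: "space (past K) = space M"
  by (simp add: gen_by_def)

lemma xi_past: "(i, k) \<in> K \<Longrightarrow> \<xi> i k \<in> measurable (past K) (S i)"
  using measurable_gen_by[of K "\<lambda>(i, k). \<xi> i k" "\<lambda>(i, k). S i" "(i, k)"] by (auto simp: xi_measurable)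

lemma sample_measurable:
  assumes "Y \<in> borel_measurable F" "Z \<in> measurable F (S i)"
  shows "(\<lambda>\<omega>. g i (Y \<omega>) (Z \<omega>)) \<in> borel_measurable F"
  using measurable_compose[OF measurable_Pair[OF assms] g_meas] by simp

lemma grad_measurable: "grad (f i) \<in> borel_measurable borel"
proof (rule borel_measurable_continuous_onI, rule lipschitz_on_continuous_on)
  show "Lf-lipschitz_on UNIV (grad (f i))"
    using Lf smooth by (auto simp: lipschitz_on_def dist_norm)
qed

text \<open>Only samples of times before \<open>k\<close> enter. \<open>K\<close> may be larger,
  since the comparison of two agents also admits samples of time \<open>k\<close>. The recursion is
  known on \<open>space M\<close> only, hence the passage through
  \<open>measurable_cong\<close>.\<close>

lemma iterates_past:
  assumes "{(j, t). t < k} \<subseteq> K"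
  shows "x i k \<in> borel_measurable (past K)" "v i k \<in> borel_measurable (past K)"
proof -
  have "\<forall>i. x i k \<in> borel_measurable (past K) \<and> v i k \<in> borel_measurable (past K)"
    using assms
  proof (induction k)
    case 0
    have "x i 0 \<in> borel_measurable (past K) \<longleftrightarrow> (\<lambda>\<omega>. x0 i) \<in> borel_measurable (past K)"
      "v i 0 \<in> borel_measurable (past K) \<longleftrightarrow> (\<lambda>\<omega>. 0 :: real^'p) \<in> borel_measurable (past K)" for i
      by (intro measurable_cong; simp add: alg_init)+
    then show ?case by simp
  next
    case (Suc k)
    from Suc.prems have "{(j, t). t < k} \<subseteq> K" by auto
    from Suc.IH[OF this]
    have [measurable]: "x i k \<in> borel_measurable (past K)" "v i k \<in> borel_measurable (past K)" for i
      by auto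
    have "\<xi> i k \<in> measurable (past K) (S i)" for i
      using Suc.prems by (intro xi_past) auto
    then have [measurable]: "(\<lambda>\<omega>. g i (x i k \<omega>) (\<xi> i k \<omega>)) \<in> borel_measurable (past K)" for i
      by (intro sample_measurable) auto
    have "x i (Suc k) \<in> borel_measurable (past K) \<longleftrightarrow>
        (\<lambda>\<omega>. x i k \<omega> - \<eta> *\<^sub>R ((\<kappa>1 * \<beta>) *\<^sub>R (\<Sum>j\<in>UNIV. L $ i $ j *\<^sub>R x j k \<omega>)
          + \<beta> *\<^sub>R v i k \<omega> + g i (x i k \<omega>) (\<xi> i k \<omega>))) \<in> borel_measurable (past K)"
      "v i (Suc k) \<in> borel_measurable (past K) \<longleftrightarrow>
        (\<lambda>\<omega>. v i k \<omega> + (\<eta> * \<beta>) *\<^sub>R (\<Sum>j\<in>UNIV. L $ i $ j *\<^sub>R x j k \<omega>)) \<in> borel_measurable (past K)" for i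
      by (intro measurable_cong; simp add: alg_step)+
    then show ?case by (simp add: borel_measurable_sum)
  qed
  then show "x i k \<in> borel_measurable (past K)" "v i k \<in> borel_measurable (past K)" by auto
qed

definition before :: "nat \<Rightarrow> ('n \<times> nat) set" where
  "before k = {(j, t). t < k}"

lemma X_past: "before k \<subseteq> K \<Longrightarrow> X k \<in> borel_measurable (past K)"
  unfolding X_def before_def by (intro borel_measurable_vec_lambda iterates_past)

lemma V_past: "before k \<subseteq> K \<Longrightarrow> V k \<in> borel_measurable (past K)"
  unfolding V_def before_def by (intro borel_measurable_vec_lambda iterates_past)

text \<open>As \<open>K\<close> may contain the samples that the other agents draw at time \<open>k\<close>, the orthogonality of
  the noise of two agents is an instance.\<close>

lemma noise_component:
  assumes K: "before k \<subseteq> K" "(i, k) \<notin> K"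
  shows "L2 M (\<lambda>\<omega>. noise k \<omega> $ i)" "(\<integral>\<omega>. (norm (noise k \<omega> $ i))\<^sup>2 \<partial>M) \<le> \<sigma>\<^sup>2"
    and "L2 (past K) u \<Longrightarrow> (\<integral>\<omega>. u \<omega> \<bullet> noise k \<omega> $ i \<partial>M) = 0"
proof -
  define h where "h \<omega> s = g i (x i k \<omega>) s - grad (f i) (x i k \<omega>)" for \<omega> s
  have noise: "noise k \<omega> $ i = h \<omega> (\<xi> i k \<omega>)" for \<omega> by (simp add: noise_def h_def)
  have x: "x i k \<in> borel_measurable (past K)"
    using K(1) by (intro iterates_past) (simp add: before_def)
  have "(\<lambda>z. (x i k (fst z), snd z)) \<in> measurable (past K \<Otimes>\<^sub>M S i) (borel \<Otimes>\<^sub>M S i)"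
    by (intro measurable_Pair measurable_compose[OF measurable_fst x] measurable_snd)
  from measurable_compose[OF this g_meas[of i]]
  have "(\<lambda>z. g i (x i k (fst z)) (snd z)) \<in> borel_measurable (past K \<Otimes>\<^sub>M S i)" by simp
  moreover have "(\<lambda>z. grad (f i) (x i k (fst z))) \<in> borel_measurable (past K \<Otimes>\<^sub>M S i)"
    by (intro measurable_compose[OF measurable_compose[OF measurable_fst x] grad_measurable])
  ultimately have h: "(\<lambda>(\<omega>, s). h \<omega> s) \<in> borel_measurable (past K \<Otimes>\<^sub>M S i)"
    unfolding h_def split_beta' by (rule borel_measurable_diff)
  have mean: "has_bochner_integral M (\<lambda>\<omega>'. h \<omega> (\<xi> i k \<omega>')) 0" for \<omega>
  proof -
    have "has_bochner_integral M (\<lambda>\<omega>'. grad (f i) (x i k \<omega>)) (grad (f i) (x i k \<omega>))"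
      by (simp add: has_bochner_integral_iff prob_space)
    from has_bochner_integral_diff[OF unbiased[of i "x i k \<omega>" k] this] show ?thesis by (simp add: h_def)
  qed
  have ind: "distr M (past K) (\<lambda>\<omega>. \<omega>) \<Otimes>\<^sub>M distr M (S i) (\<xi> i k)
      = distr M (past K \<Otimes>\<^sub>M S i) (\<lambda>\<omega>. (\<omega>, \<xi> i k \<omega>))"
    using joint_distr_gen_by[OF indep K(2)] by simp
  note * = independent_noise[OF subalgebra_past xi_measurable ind h mean, where c = "\<sigma>\<^sup>2"]
  show "L2 M (\<lambda>\<omega>. noise k \<omega> $ i)" "(\<integral>\<omega>. (norm (noise k \<omega> $ i))\<^sup>2 \<partial>M) \<le> \<sigma>\<^sup>2"
    unfolding noise by (rule *; simp add: h_def variance)+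
  show "(\<integral>\<omega>. u \<omega> \<bullet> noise k \<omega> $ i \<partial>M) = 0" if "L2 (past K) u"
    unfolding noise by (rule *(3)[OF _ that]) (simp add: h_def variance)
qed

lemma noise_orthogonal:
  assumes "L2 (past (before k)) u"
  shows "(\<integral>\<omega>. u \<omega> \<bullet> noise k \<omega> \<partial>M) = 0"
proof -
  have ui: "L2 (past (before k)) (\<lambda>\<omega>. u \<omega> $ i)" for i
    by (rule L2_linear[OF subalgebra_past assms]) (simp add: linear_iff)
  have "(\<integral>\<omega>. u \<omega> \<bullet> noise k \<omega> \<partial>M) = (\<integral>\<omega>. (\<Sum>i\<in>UNIV. u \<omega> $ i \<bullet> noise k \<omega> $ i) \<partial>M)"
    by (simp add: inner_vec_def)
  also have "\<dots> = (\<Sum>i\<in>UNIV. \<integral>\<omega>. u \<omega> $ i \<bullet> noise k \<omega> $ i \<partial>M)"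
    by (intro Bochner_Integration.integral_sum L2_inner_integrable L2_mono[OF subalgebra_past ui]
        noise_component(1)[of k "before k"]) (auto simp: before_def)
  also have "\<dots> = 0"
    using noise_component(3)[of k "before k", OF _ _ ui] by (simp add: before_def)
  finally show ?thesis .
qed

lemma noise_cross:
  assumes "i \<noteq> j"
  shows "(\<integral>\<omega>. noise k \<omega> $ i \<bullet> noise k \<omega> $ j \<partial>M) = 0"
proof -
  \<comment> \<open>\<open>K\<close> contains the sample of \<open>i\<close> at time
    \<open>k\<close> but not that of \<open>j\<close>, so the noise of \<open>i\<close> counts as
    past for \<open>j\<close>.\<close>
  define K where "K = before k \<union> {(l, t). t = k \<and> l \<noteq> j}"
  have K: "before k \<subseteq> K" "(j, k) \<notin> K" "(i, k) \<in> K" using assms by (auto simp: K_def before_def)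
  have x: "x i k \<in> borel_measurable (past K)"
    using K(1) by (intro iterates_past) (simp add: before_def)
  have "(\<lambda>\<omega>. noise k \<omega> $ i) \<in> borel_measurable (past K)"
    unfolding noise_def
    by (simp, intro borel_measurable_diff sample_measurable x xi_past K measurable_compose[OF x grad_measurable])
  moreover have "L2 M (\<lambda>\<omega>. noise k \<omega> $ i)"
    by (rule noise_component[of k "before k"]) (auto simp: before_def)
  ultimately have "L2 (past K) (\<lambda>\<omega>. noise k \<omega> $ i)" by (simp add: L2_def)
  then show ?thesis by (rule noise_component(3)[OF K(1,2)])
qed

lemma noise_L2: "L2 M (noise k)"
proof (rule L2_dominated)
  have i: "L2 M (\<lambda>\<omega>. noise k \<omega> $ i)" for i
    by (rule noise_component[of k "before k"]) (auto simp: before_def)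
  show "subalgebra M M" by (simp add: subalgebra_def)
  have "(\<lambda>\<omega>. \<chi> i. noise k \<omega> $ i) \<in> borel_measurable M"
    using i by (intro borel_measurable_vec_lambda) (simp add: L2_def)
  then show "noise k \<in> borel_measurable M" by simp
  show "integrable M (\<lambda>\<omega>. \<Sum>i\<in>UNIV. (norm (noise k \<omega> $ i))\<^sup>2)"
    using i by (intro Bochner_Integration.integrable_sum) (simp add: L2_def)
  show "(norm (noise k \<omega>))\<^sup>2 \<le> (\<Sum>i\<in>UNIV. (norm (noise k \<omega> $ i))\<^sup>2)" for \<omega>
    by (simp add: power2_norm_eq_inner inner_vec_def)
qed

text \<open>Orthogonality between agents removes the off-diagonal terms, so averaging gains a factor
  \<open>CARD('n)\<close> over what \<open>card_norm_avg_le\<close> and the first bound would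
  give.\<close>

lemma noise_second_moment:
  "(\<integral>\<omega>. (norm (noise k \<omega>))\<^sup>2 \<partial>M) \<le> real CARD('n) * \<sigma>\<^sup>2"
  "(\<integral>\<omega>. real CARD('n) * (norm (avg (($) (noise k \<omega>))))\<^sup>2 \<partial>M) \<le> \<sigma>\<^sup>2"
proof -
  have L: "L2 M (\<lambda>\<omega>. noise k \<omega> $ i)" for i
    by (rule noise_component[of k "before k"]) (auto simp: before_def)
  have var: "(\<integral>\<omega>. noise k \<omega> $ i \<bullet> noise k \<omega> $ i \<partial>M) \<le> \<sigma>\<^sup>2" for i
    using noise_component(2)[of k "before k" i] by (simp add: before_def power2_norm_eq_inner)
  have int: "integrable M (\<lambda>\<omega>. noise k \<omega> $ i \<bullet> noise k \<omega> $ j)" for i j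
    by (intro L2_inner_integrable L)
  have sum: "(\<Sum>i\<in>UNIV. \<integral>\<omega>. noise k \<omega> $ i \<bullet> noise k \<omega> $ i \<partial>M) \<le> real CARD('n) * \<sigma>\<^sup>2"
    using sum_mono[of UNIV "\<lambda>i. \<integral>\<omega>. noise k \<omega> $ i \<bullet> noise k \<omega> $ i \<partial>M" "\<lambda>_. \<sigma>\<^sup>2"] var by simp
  have "(\<integral>\<omega>. (norm (noise k \<omega>))\<^sup>2 \<partial>M) = (\<integral>\<omega>. (\<Sum>i\<in>UNIV. noise k \<omega> $ i \<bullet> noise k \<omega> $ i) \<partial>M)"
    by (simp add: power2_norm_eq_inner inner_vec_def)
  also have "\<dots> = (\<Sum>i\<in>UNIV. \<integral>\<omega>. noise k \<omega> $ i \<bullet> noise k \<omega> $ i \<partial>M)"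
    by (intro Bochner_Integration.integral_sum int)
  finally show "(\<integral>\<omega>. (norm (noise k \<omega>))\<^sup>2 \<partial>M) \<le> real CARD('n) * \<sigma>\<^sup>2" using sum by simp
  have "real CARD('n) * (norm (avg (($) (noise k \<omega>))))\<^sup>2
      = 1 / real CARD('n) * (\<Sum>i\<in>UNIV. \<Sum>j\<in>UNIV. noise k \<omega> $ i \<bullet> noise k \<omega> $ j)" for \<omega>
  proof -
    have "(norm (\<Sum>i\<in>UNIV. noise k \<omega> $ i))\<^sup>2 = (\<Sum>i\<in>UNIV. \<Sum>j\<in>UNIV. noise k \<omega> $ i \<bullet> noise k \<omega> $ j)"
      by (simp add: power2_norm_eq_inner inner_sum_left inner_sum_right) (rule sum.swap)
    then show ?thesis
      by (simp add: avg_def power_divide) (simp add: power2_eq_square)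
  qed
  then have "(\<integral>\<omega>. real CARD('n) * (norm (avg (($) (noise k \<omega>))))\<^sup>2 \<partial>M)
      = 1 / real CARD('n) * (\<integral>\<omega>. (\<Sum>i\<in>UNIV. \<Sum>j\<in>UNIV. noise k \<omega> $ i \<bullet> noise k \<omega> $ j) \<partial>M)"
    by simp
  also have "(\<integral>\<omega>. (\<Sum>i\<in>UNIV. \<Sum>j\<in>UNIV. noise k \<omega> $ i \<bullet> noise k \<omega> $ j) \<partial>M)
      = (\<Sum>i\<in>UNIV. \<Sum>j\<in>UNIV. \<integral>\<omega>. noise k \<omega> $ i \<bullet> noise k \<omega> $ j \<partial>M)"
    by (simp add: Bochner_Integration.integral_sum int)
  also have "\<dots> = (\<Sum>i\<in>UNIV. \<Sum>j\<in>UNIV. if i = j then \<integral>\<omega>. noise k \<omega> $ i \<bullet> noise k \<omega> $ i \<partial>M else 0)"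
    by (intro sum.cong refl) (auto simp: noise_cross)
  also have "\<dots> = (\<Sum>i\<in>UNIV. \<integral>\<omega>. noise k \<omega> $ i \<bullet> noise k \<omega> $ i \<partial>M)" by simp
  also have "1 / real CARD('n) * \<dots> \<le> 1 / real CARD('n) * (real CARD('n) * \<sigma>\<^sup>2)"
    by (intro mult_left_mono sum) auto
  finally show "(\<integral>\<omega>. real CARD('n) * (norm (avg (($) (noise k \<omega>))))\<^sup>2 \<partial>M) \<le> \<sigma>\<^sup>2" by simp
qed

end

section \<open>Convergence in expectation\<close>

lemma stack_inner: "stack x \<bullet> stack y = (\<Sum>i\<in>UNIV. x i \<bullet> y i)"
proof -
  have "stack x \<bullet> stack y = (\<Sum>r\<in>UNIV \<times> UNIV. x (fst r) $ snd r * y (fst r) $ snd r)"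
    by (simp add: inner_vec_def stack_def)
  then show ?thesis by (simp add: inner_vec_def sum.cartesian_product split_beta')
qed

lemma stack_add_scaleR: "stack x + c *\<^sub>R stack y = stack (\<lambda>i. x i + c *\<^sub>R y i)"
  by (simp add: stack_def vec_eq_iff)

text \<open>Turns the Kronecker form in which \<open>W0\<close> is written into the blockwise form
  of the potential.\<close>

lemma kronecker_mat_1_stack:
  "kronecker A (mat 1) *v stack x = stack (($) (act A (\<chi> i. x i)))"
proof -
  have "(\<Sum>s\<in>UNIV. A $ i $ fst s * mat 1 $ a $ snd s * x (fst s) $ snd s)
      = (\<Sum>j\<in>UNIV. A $ i $ j * x j $ a)" for i a
  proof -
    have "(\<Sum>s\<in>UNIV. A $ i $ fst s * mat 1 $ a $ snd s * x (fst s) $ snd s)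
        = (\<Sum>j\<in>UNIV. \<Sum>b\<in>UNIV. A $ i $ j * mat 1 $ a $ b * x j $ b)"
      by (simp add: sum.cartesian_product split_beta' flip: UNIV_Times_UNIV)
    also have "\<dots> = (\<Sum>j\<in>UNIV. \<Sum>b\<in>UNIV. if a = b then A $ i $ j * x j $ b else 0)"
      by (intro sum.cong refl) (simp add: mat_def)
    finally show ?thesis by simp
  qed
  then show ?thesis
    by (simp add: vec_eq_iff kronecker_def stack_def matrix_vector_mult_def act_def)
qed

text \<open>\<open>Q\<close> annihilates the consensus part, so the uncentred \<open>Q\<close> norm
  in \<open>W0\<close> agrees with the centred one in \<open>lyap\<close>.\<close>

lemma (in pd_system) inner_pseudoinverse_cen:
  fixes u :: "'b^'n"
  shows "cen u \<bullet> act (pseudoinverse L) (cen u) = u \<bullet> act (pseudoinverse L) u"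
  by (metis act_pseudoinverse(3,4) inner_cen inner_commute)

context sgd_process
begin

lemma W0_eq_lyap: "W0 L f fstar \<kappa>1 \<beta> x0 (\<lambda>i. 0) = lyap (\<chi> i. x0 i) 0"
proof -
  define u where "u = (\<lambda>i. (1 / \<beta>) *\<^sub>R grad (f i) (avg x0))"
  let ?x = "(\<chi> i. x0 i) :: (real^'p)^'n" and ?u = "(\<chi> i. u i) :: (real^'p)^'n"
  have inner: "stack z \<bullet> stack (($) y) = (\<chi> i. z i) \<bullet> y" for z and y :: "(real^'p)^'n"
    unfolding stack_inner by (simp add: inner_vec_def)
  have cen: "centering *v stack z = stack (($) (cen (\<chi> i. z i)))" for z :: "'n \<Rightarrow> real^'p"
    unfolding centering_def kronecker_mat_1_stack
    by (simp add: cen_matrix_def[symmetric] act_cen_matrix)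
  have inner_cen': "z \<bullet> cen y = cen z \<bullet> cen y" for z y :: "(real^'p)^'n"
    by (metis inner_cen inner_commute)
  have "stack (\<lambda>i. 0) + (1 / \<beta>) *\<^sub>R stack (\<lambda>i. grad (f i) (avg x0)) = stack u"
    by (simp add: stack_add_scaleR u_def)
  moreover have "wnorm_sq centering (stack x0) = (norm (cen ?x))\<^sup>2"
    by (simp add: wnorm_sq_def cen inner power2_norm_eq_inner) (rule inner_cen')
  moreover have "wnorm_sq (kronecker (pseudoinverse L) (mat 1) + \<kappa>1 *\<^sub>R centering) (stack u)
      = cen ?u \<bullet> act (pseudoinverse L) (cen ?u) + \<kappa>1 * (norm (cen ?u))\<^sup>2"
    unfolding wnorm_sq_def matrix_vector_mult_add_rdistrib scaleR_matrix_vector_assoc[symmetric]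
      kronecker_mat_1_stack cen inner_add_right inner_scaleR_right inner inner_pseudoinverse_cen
      power2_norm_eq_inner
    by (simp add: inner_cen'[of ?u ?u])
  moreover have "stack x0 \<bullet> (centering *v stack u) = cen ?x \<bullet> cen ?u"
    unfolding cen inner by (rule inner_cen')
  moreover have ax: "avg (($) ?x) = avg x0" by (simp add: avg_def)
  moreover have "dual ?x 0 = cen ?u"
  proof -
    have "0 + (1 / \<beta>) *\<^sub>R grads0 ?x = ?u" unfolding grads0_def ax u_def by (simp add: vec_eq_iff)
    then show ?thesis by (simp only: dual_def)
  qed
  ultimately show ?thesis
    unfolding W0_def Let_def lyap_def lyap_quad_def by (simp add: algebra_simps)
qed

section \<open>Square integrability of the iterates and of the potential\<close>

lemma L2_act:
  fixes Y :: "'w \<Rightarrow> (real^'p)^'n"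
  shows "subalgebra M F \<Longrightarrow> L2 F Y \<Longrightarrow> L2 F (\<lambda>\<omega>. act A (Y \<omega>))"
  by (rule L2_linear[OF _ _ linear_act])

lemma L2_cen:
  fixes Y :: "'w \<Rightarrow> (real^'p)^'n"
  shows "subalgebra M F \<Longrightarrow> L2 F Y \<Longrightarrow> L2 F (\<lambda>\<omega>. cen (Y \<omega>))"
  by (rule L2_linear[OF _ _ linear_cen])

lemma L2_grads: "subalgebra M F \<Longrightarrow> L2 F Y \<Longrightarrow> L2 F (\<lambda>\<omega>. grads (Y \<omega>))"
  by (rule L2_lipschitz[OF _ _ norm_grads_diff_le])

text \<open>\<open>grads0 z\<close> is \<open>grads\<close> at \<open>z - cen z\<close>, whose
  blocks all equal the average, so it inherits the Lipschitz argument.\<close>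

lemma L2_grads0: "subalgebra M F \<Longrightarrow> L2 F Y \<Longrightarrow> L2 F (\<lambda>\<omega>. grads0 (Y \<omega>))"
proof -
  assume "subalgebra M F" "L2 F Y"
  then have "L2 F (\<lambda>\<omega>. grads (Y \<omega> - cen (Y \<omega>)))" by (intro L2_grads L2_diff L2_cen)
  moreover have "grads (z - cen z) = grads0 z" for z
    by (simp add: grads_def grads0_def cen_def)
  ultimately show ?thesis by simp
qed

lemma L2_dual: "subalgebra M F \<Longrightarrow> L2 F Y \<Longrightarrow> L2 F Z \<Longrightarrow> L2 F (\<lambda>\<omega>. dual (Y \<omega>) (Z \<omega>))"
  unfolding dual_def by (intro L2_cen L2_add L2_scaleR L2_grads0)

lemma L2_drift:
  assumes "subalgebra M F" "L2 F Y" "L2 F Z"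
  shows "L2 F (\<lambda>\<omega>. drift (Y \<omega>) (Z \<omega>))"
proof -
  \<comment> \<open>Constant blocks are written as \<open>u - cen u\<close>, which leaves only
    operations that preserve \<open>L2\<close>.\<close>
  have "drift y z = (2 * \<epsilon>5 * \<eta>\<^sup>2) *\<^sub>R (grads y - cen (grads y)) - \<eta> *\<^sub>R (grads0 y - cen (grads0 y))
     - \<eta> *\<^sub>R cen (deterministic_part (cen y) (dual y z) ((1 / \<beta>) *\<^sub>R cen (grads y - grads0 y)))" for y z
    unfolding drift_def by (simp add: cen_def vec_eq_iff avg_grads0)
  then show ?thesis
    unfolding deterministic_part_def using assms
    by (simp, intro L2_diff L2_add L2_scaleR L2_cen L2_act L2_dual L2_grads L2_grads0) auto
qed

text \<open>The noise is square integrable whatever the iterates are, because the variance bound is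
  uniform in the point; the rest of a step is linear or Lipschitz.\<close>

lemma iterates_L2: "L2 M (X k)" "L2 M (V k)"
proof -
  have "L2 M (X k) \<and> L2 M (V k)"
  proof (induction k)
    case 0
    then show ?case
      by (auto intro!: L2_cong[OF L2_const[OF subalgebra_self] X_0] L2_cong[OF L2_const[OF subalgebra_self] V_0])
  next
    case (Suc k)
    then have X: "L2 M (X k)" and V: "L2 M (V k)" by auto
    show ?case
    proof
      show "L2 M (X (Suc k))"
        by (rule L2_cong[OF _ X_Suc])
          (intro L2_diff L2_add L2_scaleR L2_act L2_grads subalgebra_self X V noise_L2)
      show "L2 M (V (Suc k))"
        by (rule L2_cong[OF _ V_Suc]) (intro L2_add L2_scaleR L2_act subalgebra_self X V)
    qed
  qed
  then show "L2 M (X k)" "L2 M (V k)" by auto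
qed

lemma iterates_L2_past: "L2 (past (before k)) (X k)" "L2 (past (before k)) (V k)"
  using iterates_L2[of k] by (simp_all add: L2_def X_past V_past)

lemma favg_avg_measurable: "(\<lambda>\<omega>. favg f (avg (($) (X k \<omega>)))) \<in> borel_measurable M"
proof -
  have "continuous_on UNIV (favg f)"
    by (intro continuous_at_imp_continuous_on ballI differentiable_imp_continuous_within favg_differentiable)
  moreover have "L2 M (\<lambda>\<omega>. avg (($) (X k \<omega>)))"
    by (rule L2_linear[OF subalgebra_self iterates_L2(1) linear_avg])
  ultimately show ?thesis
    by (intro borel_measurable_continuous_on[of "favg f"]) (simp_all add: L2_def)
qed

text \<open>The gradient vanishes at a minimiser, so the descent inequality there bounds the gap by
  a quadratic. This makes the potential integrable.\<close>

lemma gap_upper: "\<exists>C. \<forall>x :: (real^'p)^'n. real CARD('n) * (favg f (avg (($) x)) - fstar) \<le> Lf * (norm x)\<^sup>2 + C"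
proof -
  obtain y where y: "favg f y = fstar" using minimizer by blast
  have g: "grad (favg f) y = 0"
    using norm_grad_le_gap[OF favg_differentiable favg_smooth Lf minimum, of y] y by simp
  have "real CARD('n) * (favg f (avg (($) x)) - fstar) \<le> Lf * (norm x)\<^sup>2 + Lf * (real CARD('n) * (norm y)\<^sup>2)"
    for x :: "(real^'p)^'n"
  proof -
    let ?a = "avg (($) x)"
    have "favg f ?a - fstar \<le> Lf / 2 * (norm (?a - y))\<^sup>2"
      using descent_inequality[OF favg_differentiable favg_smooth, of ?a y] g y by simp
    also have "\<dots> \<le> Lf / 2 * (2 * (norm ?a)\<^sup>2 + 2 * (norm y)\<^sup>2)"
    proof (intro mult_left_mono)
      have "(norm (?a - y))\<^sup>2 \<le> (norm ?a + norm y)\<^sup>2"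
        by (intro power_mono norm_triangle_ineq4) auto
      then show "(norm (?a - y))\<^sup>2 \<le> 2 * (norm ?a)\<^sup>2 + 2 * (norm y)\<^sup>2"
        using sum_squares_bound[of "norm ?a" "norm y"] by (simp add: power2_sum)
    qed (use Lf in auto)
    finally have "real CARD('n) * (favg f ?a - fstar) \<le> real CARD('n) * (Lf / 2 * (2 * (norm ?a)\<^sup>2 + 2 * (norm y)\<^sup>2))"
      by (intro mult_left_mono) auto
    also have "\<dots> = Lf * (real CARD('n) * (norm ?a)\<^sup>2) + Lf * (real CARD('n) * (norm y)\<^sup>2)"
      by (simp add: algebra_simps)
    also have "Lf * (real CARD('n) * (norm ?a)\<^sup>2) \<le> Lf * (norm x)\<^sup>2"
      using Lf by (intro mult_left_mono card_norm_avg_le) auto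
    finally show ?thesis by simp
  qed
  then show ?thesis by blast
qed

lemma lyap_integrable: "integrable M (\<lambda>\<omega>. lyap (X k \<omega>) (V k \<omega>))"
proof -
  obtain C where C: "\<And>x :: (real^'p)^'n. real CARD('n) * (favg f (avg (($) x)) - fstar) \<le> Lf * (norm x)\<^sup>2 + C"
    using gap_upper by blast
  have cen: "L2 M (\<lambda>\<omega>. cen (X k \<omega>))" and dual: "L2 M (\<lambda>\<omega>. dual (X k \<omega>) (V k \<omega>))"
    by (intro L2_cen L2_dual subalgebra_self iterates_L2)+
  have Q: "L2 M (\<lambda>\<omega>. act (pseudoinverse L) (dual (X k \<omega>) (V k \<omega>)))"
    by (intro L2_act subalgebra_self dual)
  note [measurable] = favg_avg_measurable cen[unfolded L2_def, THEN conjunct1]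
    dual[unfolded L2_def, THEN conjunct1] Q[unfolded L2_def, THEN conjunct1]
  show ?thesis
  proof (rule Bochner_Integration.integrable_bound)
    show "integrable M (\<lambda>\<omega>. kappa5 L \<kappa>1 * ((norm (cen (X k \<omega>)))\<^sup>2 + (norm (dual (X k \<omega>) (V k \<omega>)))\<^sup>2
        + (Lf * (norm (X k \<omega>))\<^sup>2 + C)))"
      using cen dual iterates_L2(1)[of k] by (auto simp: L2_def)
    show "(\<lambda>\<omega>. lyap (X k \<omega>) (V k \<omega>)) \<in> borel_measurable M"
      unfolding lyap_def lyap_quad_def by measurable
    have "lyap (X k \<omega>) (V k \<omega>) \<le> kappa5 L \<kappa>1 * ((norm (cen (X k \<omega>)))\<^sup>2 + (norm (dual (X k \<omega>) (V k \<omega>)))\<^sup>2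
        + (Lf * (norm (X k \<omega>))\<^sup>2 + C))" for \<omega>
      using kappa5_ge C by (intro order_trans[OF lyap_upper] mult_left_mono add_mono) auto
    then show "AE \<omega> in M. norm (lyap (X k \<omega>) (V k \<omega>)) \<le> norm (kappa5 L \<kappa>1 * ((norm (cen (X k \<omega>)))\<^sup>2
        + (norm (dual (X k \<omega>) (V k \<omega>)))\<^sup>2 + (Lf * (norm (X k \<omega>))\<^sup>2 + C)))"
      using lyap_nonneg by (intro AE_I2) (smt (verit) real_norm_def)
  qed
qed

lemma lyap_recurrence:
  "(\<integral>\<omega>. lyap (X (Suc k) \<omega>) (V (Suc k) \<omega>) \<partial>M) \<le> (1 - \<eta> * \<epsilon>) * (\<integral>\<omega>. lyap (X k \<omega>) (V k \<omega>) \<partial>M)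
     + (\<epsilon>5 + 3 * real CARD('n)) * \<eta>\<^sup>2 * \<sigma>\<^sup>2"
proof -
  define A where "A \<omega> = real CARD('n) * (norm (avg (($) (noise k \<omega>))))\<^sup>2" for \<omega>
  have drift_past: "L2 (past (before k)) (\<lambda>\<omega>. drift (X k \<omega>) (V k \<omega>))"
    by (intro L2_drift subalgebra_past iterates_L2_past)
  have int: "integrable M (\<lambda>\<omega>. (1 - \<eta> * \<epsilon>) * lyap (X k \<omega>) (V k \<omega>))"
    "integrable M (\<lambda>\<omega>. drift (X k \<omega>) (V k \<omega>) \<bullet> noise k \<omega>)"
    "integrable M (\<lambda>\<omega>. \<epsilon>5 * \<eta>\<^sup>2 * A \<omega>)" "integrable M (\<lambda>\<omega>. \<eta>\<^sup>2 * (norm (noise k \<omega>))\<^sup>2)"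
  proof -
    show "integrable M (\<lambda>\<omega>. (1 - \<eta> * \<epsilon>) * lyap (X k \<omega>) (V k \<omega>))"
      by (intro integrable_mult_right lyap_integrable)
    show "integrable M (\<lambda>\<omega>. drift (X k \<omega>) (V k \<omega>) \<bullet> noise k \<omega>)"
      by (intro L2_inner_integrable L2_mono[OF subalgebra_past drift_past] noise_L2)
    have "L2 M (\<lambda>\<omega>. avg (($) (noise k \<omega>)))"
      by (rule L2_linear[OF subalgebra_self noise_L2 linear_avg])
    then show "integrable M (\<lambda>\<omega>. \<epsilon>5 * \<eta>\<^sup>2 * A \<omega>)" by (auto simp: A_def L2_def)
    show "integrable M (\<lambda>\<omega>. \<eta>\<^sup>2 * (norm (noise k \<omega>))\<^sup>2)" using noise_L2[of k] by (simp add: L2_def)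
  qed
  have "(\<integral>\<omega>. lyap (X (Suc k) \<omega>) (V (Suc k) \<omega>) \<partial>M)
      \<le> (\<integral>\<omega>. (1 - \<eta> * \<epsilon>) * lyap (X k \<omega>) (V k \<omega>) + drift (X k \<omega>) (V k \<omega>) \<bullet> noise k \<omega>
          + \<epsilon>5 * \<eta>\<^sup>2 * A \<omega> + \<eta>\<^sup>2 * (norm (noise k \<omega>))\<^sup>2 \<partial>M)"
  proof (rule integral_mono[OF lyap_integrable])
    show "integrable M (\<lambda>\<omega>. (1 - \<eta> * \<epsilon>) * lyap (X k \<omega>) (V k \<omega>) + drift (X k \<omega>) (V k \<omega>) \<bullet> noise k \<omega>
          + \<epsilon>5 * \<eta>\<^sup>2 * A \<omega> + \<eta>\<^sup>2 * (norm (noise k \<omega>))\<^sup>2)"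
      by (intro Bochner_Integration.integrable_add int)
    show "lyap (X (Suc k) \<omega>) (V (Suc k) \<omega>) \<le> (1 - \<eta> * \<epsilon>) * lyap (X k \<omega>) (V k \<omega>)
        + drift (X k \<omega>) (V k \<omega>) \<bullet> noise k \<omega> + \<epsilon>5 * \<eta>\<^sup>2 * A \<omega> + \<eta>\<^sup>2 * (norm (noise k \<omega>))\<^sup>2"
      if "\<omega> \<in> space M" for \<omega>
      unfolding X_Suc[OF that] V_Suc[OF that] A_def by (rule lyap_step[OF cen_V[OF that]])
  qed
  also have "\<dots> = (1 - \<eta> * \<epsilon>) * (\<integral>\<omega>. lyap (X k \<omega>) (V k \<omega>) \<partial>M)
      + (\<integral>\<omega>. drift (X k \<omega>) (V k \<omega>) \<bullet> noise k \<omega> \<partial>M)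
      + \<epsilon>5 * \<eta>\<^sup>2 * (\<integral>\<omega>. A \<omega> \<partial>M) + \<eta>\<^sup>2 * (\<integral>\<omega>. (norm (noise k \<omega>))\<^sup>2 \<partial>M)"
    using int by simp
  also have "(\<integral>\<omega>. drift (X k \<omega>) (V k \<omega>) \<bullet> noise k \<omega> \<partial>M) = 0"
    by (rule noise_orthogonal[OF drift_past])
  finally have "(\<integral>\<omega>. lyap (X (Suc k) \<omega>) (V (Suc k) \<omega>) \<partial>M)
      \<le> (1 - \<eta> * \<epsilon>) * (\<integral>\<omega>. lyap (X k \<omega>) (V k \<omega>) \<partial>M)
        + \<epsilon>5 * \<eta>\<^sup>2 * (\<integral>\<omega>. A \<omega> \<partial>M) + \<eta>\<^sup>2 * (\<integral>\<omega>. (norm (noise k \<omega>))\<^sup>2 \<partial>M)" by simp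
  moreover have "\<epsilon>5 * \<eta>\<^sup>2 * (\<integral>\<omega>. A \<omega> \<partial>M) \<le> \<epsilon>5 * \<eta>\<^sup>2 * \<sigma>\<^sup>2"
    unfolding A_def using eps5_ge(1) by (intro mult_left_mono noise_second_moment) auto
  moreover have "\<eta>\<^sup>2 * (\<integral>\<omega>. (norm (noise k \<omega>))\<^sup>2 \<partial>M) \<le> \<eta>\<^sup>2 * (real CARD('n) * \<sigma>\<^sup>2)"
    by (intro mult_left_mono noise_second_moment) auto
  \<comment> \<open>The step itself costs \<open>\<epsilon>5 + CARD('n)\<close>; this term fills the
    difference to the factor 3 of the stated constant.\<close>
  moreover have "0 \<le> \<eta>\<^sup>2 * (real CARD('n) * \<sigma>\<^sup>2)" by simp
  moreover have "(\<epsilon>5 + 3 * real CARD('n)) * \<eta>\<^sup>2 * \<sigma>\<^sup>2 = \<epsilon>5 * \<eta>\<^sup>2 * \<sigma>\<^sup>2 + 3 * (\<eta>\<^sup>2 * (real CARD('n) * \<sigma>\<^sup>2))"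
    by (simp add: algebra_simps)
  ultimately show ?thesis by linarith
qed

lemma lyap_expectation:
  "(\<integral>\<omega>. lyap (X k \<omega>) (V k \<omega>) \<partial>M) \<le> (1 - \<eta> * \<epsilon>) ^ k * lyap (\<chi> i. x0 i) 0
     + (\<epsilon>5 + 3 * real CARD('n)) * \<eta> * \<sigma>\<^sup>2 / \<epsilon>"
proof (induction k)
  case 0
  have "(\<integral>\<omega>. lyap (X 0 \<omega>) (V 0 \<omega>) \<partial>M) = (\<integral>\<omega>. lyap (\<chi> i. x0 i) 0 \<partial>M)"
    by (intro Bochner_Integration.integral_cong) (auto simp: X_0 V_0)
  then show ?case using eps5_ge(1) eta_bounds(1) rate_bounds(1) by (simp add: prob_space)
next
  case (Suc k)
  define c where "c = (\<epsilon>5 + 3 * real CARD('n)) * \<eta> * \<sigma>\<^sup>2 / \<epsilon>"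
  have "(\<integral>\<omega>. lyap (X (Suc k) \<omega>) (V (Suc k) \<omega>) \<partial>M)
      \<le> (1 - \<eta> * \<epsilon>) * (\<integral>\<omega>. lyap (X k \<omega>) (V k \<omega>) \<partial>M) + (\<epsilon>5 + 3 * real CARD('n)) * \<eta>\<^sup>2 * \<sigma>\<^sup>2"
    by (rule lyap_recurrence)
  \<comment> \<open>\<open>c\<close> is the fixed point of the affine recurrence: (1 - \<eta>
    \<epsilon>) c + \<eta> \<epsilon> c = c.\<close>
  also have "(\<epsilon>5 + 3 * real CARD('n)) * \<eta>\<^sup>2 * \<sigma>\<^sup>2 = \<eta> * \<epsilon> * c"
    using rate_bounds(1) by (simp add: c_def power2_eq_square)
  also have "(1 - \<eta> * \<epsilon>) * (\<integral>\<omega>. lyap (X k \<omega>) (V k \<omega>) \<partial>M)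
      \<le> (1 - \<eta> * \<epsilon>) * ((1 - \<eta> * \<epsilon>) ^ k * lyap (\<chi> i. x0 i) 0 + c)"
    using rate_bounds(2) unfolding c_def by (intro mult_left_mono Suc.IH) auto
  finally show ?case unfolding c_def[symmetric] by (simp add: algebra_simps)
qed

section \<open>From the potential to the expected error\<close>

definition err :: "nat \<Rightarrow> 'w \<Rightarrow> real" where
  "err k \<omega> = avg (\<lambda>i. (norm (x i k \<omega> - avg (\<lambda>j. x j k \<omega>)))\<^sup>2) + favg f (avg (\<lambda>j. x j k \<omega>)) - fstar"

lemma err_eq:
  "real CARD('n) * err k \<omega> = (norm (cen (X k \<omega>)))\<^sup>2 + real CARD('n) * (favg f (avg (($) (X k \<omega>))) - fstar)"
proof -
  have a: "avg (\<lambda>j. x j k \<omega>) = avg (($) (X k \<omega>))" by (simp add: X_def avg_def)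
  have "(norm (cen (X k \<omega>)))\<^sup>2 = (\<Sum>i\<in>UNIV. (norm (x i k \<omega> - avg (\<lambda>j. x j k \<omega>)))\<^sup>2)"
    by (simp add: power2_norm_eq_inner inner_vec_def cen_def a) (simp add: X_def)
  moreover have "real CARD('n) * avg F = (\<Sum>i\<in>UNIV. F i)" for F :: "'n \<Rightarrow> real"
    by (simp add: avg_def)
  ultimately show ?thesis unfolding err_def a by (simp add: distrib_left right_diff_distrib)
qed

lemma err_le_lyap: "err k \<omega> \<le> lyap (X k \<omega>) (V k \<omega>) / (real CARD('n) * kappa6 L \<kappa>1)"
  using lyap_controls_error[of "X k \<omega>" "V k \<omega>"] kappa6_bounds(1)
  unfolding err_eq[symmetric] by (simp add: pos_le_divide_eq ac_simps)

lemma err_nonneg: "0 \<le> err k \<omega>"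
proof -
  have "0 \<le> real CARD('n) * err k \<omega>" unfolding err_eq using gap_nonneg by simp
  then show ?thesis by (simp add: zero_le_mult_iff)
qed

lemma err_integrable: "integrable M (err k)"
proof (rule Bochner_Integration.integrable_bound)
  show "integrable M (\<lambda>\<omega>. lyap (X k \<omega>) (V k \<omega>) / (real CARD('n) * kappa6 L \<kappa>1))"
    by (intro integrable_divide_zero lyap_integrable)
  have "err k = (\<lambda>\<omega>. ((norm (cen (X k \<omega>)))\<^sup>2 + real CARD('n) * (favg f (avg (($) (X k \<omega>))) - fstar)) / real CARD('n))"
    by (simp add: fun_eq_iff flip: err_eq)
  moreover have "(\<lambda>\<omega>. cen (X k \<omega>)) \<in> borel_measurable M"
    using L2_cen[OF subalgebra_self iterates_L2(1)] by (simp add: L2_def)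
  ultimately show "err k \<in> borel_measurable M" using favg_avg_measurable by simp
  show "AE \<omega> in M. norm (err k \<omega>) \<le> norm (lyap (X k \<omega>) (V k \<omega>) / (real CARD('n) * kappa6 L \<kappa>1))"
    using err_le_lyap[of k] err_nonneg[of k] by (intro AE_I2) (smt (verit) real_norm_def)
qed

lemma err_expectation:
  "(\<integral>\<omega>. err k \<omega> \<partial>M) \<le> (1 - \<eta> * \<epsilon>) ^ k * (lyap (\<chi> i. x0 i) 0 / (real CARD('n) * kappa6 L \<kappa>1))
     + (\<epsilon>5 + 3 * real CARD('n)) / (real CARD('n) * \<epsilon> * kappa6 L \<kappa>1) * \<eta> * \<sigma>\<^sup>2"
proof -
  define c where "c = \<epsilon>5 + 3 * real CARD('n)"
  have "(\<integral>\<omega>. err k \<omega> \<partial>M) \<le> (\<integral>\<omega>. lyap (X k \<omega>) (V k \<omega>) / (real CARD('n) * kappa6 L \<kappa>1) \<partial>M)"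
    by (intro integral_mono err_integrable integrable_divide_zero lyap_integrable err_le_lyap)
  also have "\<dots> = (\<integral>\<omega>. lyap (X k \<omega>) (V k \<omega>) \<partial>M) / (real CARD('n) * kappa6 L \<kappa>1)"
    by (rule integral_divide_zero)
  also have "\<dots> \<le> ((1 - \<eta> * \<epsilon>) ^ k * lyap (\<chi> i. x0 i) 0
      + c * \<eta> * \<sigma>\<^sup>2 / \<epsilon>) / (real CARD('n) * kappa6 L \<kappa>1)"
    using kappa6_bounds(1) unfolding c_def by (intro divide_right_mono lyap_expectation) auto
  also have "\<dots> = (1 - \<eta> * \<epsilon>) ^ k * (lyap (\<chi> i. x0 i) 0 / (real CARD('n) * kappa6 L \<kappa>1))
     + c / (real CARD('n) * \<epsilon> * kappa6 L \<kappa>1) * \<eta> * \<sigma>\<^sup>2"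
    by (simp add: add_divide_distrib ac_simps)
  finally show ?thesis unfolding c_def .
qed

end

theorem theorem4:
  fixes M :: "'w measure" and S :: "'n::finite \<Rightarrow> 's measure"
    and E :: "('n \<times> 'n) set" and L :: "real^'n^'n"
    and f :: "'n \<Rightarrow> real^'p::finite \<Rightarrow> real"
    and g :: "'n \<Rightarrow> real^'p \<Rightarrow> 's \<Rightarrow> real^'p"
    and \<xi> :: "'n \<Rightarrow> nat \<Rightarrow> 'w \<Rightarrow> 's"
    and x0 :: "'n \<Rightarrow> real^'p" and x v :: "'n \<Rightarrow> nat \<Rightarrow> 'w \<Rightarrow> real^'p"
    and fstar Lf \<sigma> \<nu> \<beta> \<kappa>1 \<kappa>2 \<eta> \<epsilon> c4 c5 :: real
  assumes M: "prob_space M"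
    and n: "CARD('n) \<ge> 2"
    and laplacian: "weighted_laplacian E L"
    and diff: "\<forall>i y. f i differentiable (at y)"
    and g_meas: "\<forall>i. (\<lambda>(y, s). g i y s) \<in> borel_measurable (borel \<Otimes>\<^sub>M S i)"
    and conn: "connected_graph E"
    and fstar_min: "\<exists>y. favg f y = fstar" "\<forall>y. fstar \<le> favg f y"
    and Lf: "Lf > 0"
    and smooth: "\<forall>i y z. norm (grad (f i) y - grad (f i) z) \<le> Lf * norm (y - z)"
    and indep: "prob_space.indep_vars M (\<lambda>(i, k). S i) (\<lambda>(i, k). \<xi> i k) UNIV"
    and unbiased: "\<forall>i k y. has_bochner_integral M (\<lambda>\<omega>. g i y (\<xi> i k \<omega>)) (grad (f i) y)"
    and variance: "\<forall>i k y.
          integrable M (\<lambda>\<omega>. (norm (g i y (\<xi> i k \<omega>) - grad (f i) y))^2) \<and>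
          (\<integral>\<omega>. (norm (g i y (\<xi> i k \<omega>) - grad (f i) y))^2 \<partial>M) \<le> \<sigma>^2"
    and nu: "\<nu> > 0"
    and PL: "\<forall>y. 1 / 2 * (norm (grad (favg f) y))^2 \<ge> \<nu> * (favg f y - fstar)"
    and kappa1: "\<kappa>1 > c1 L"
    and kappa2: "0 < \<kappa>2" "\<kappa>2 < c2 L \<kappa>1"
    and beta: "\<beta> \<ge> c0 L Lf \<kappa>1 \<kappa>2"
    and eta: "\<eta> = \<kappa>2 / \<beta>"
    and alg: "primal_dual_sgd M L g \<xi> (\<lambda>k. \<kappa>1 * \<beta>) (\<lambda>k. \<beta>) (\<lambda>k. \<eta>) x0 x v"
    and eps: "\<epsilon> = 1 / kappa5 L \<kappa>1 * Min {eps3 L \<kappa>1 \<kappa>2 / \<eta>, eps4 \<kappa>2 / \<eta>, \<nu> / 2}"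
    and c4: "c4 = W0 L f fstar \<kappa>1 \<beta> x0 (\<lambda>i. 0) / (real CARD('n) * kappa6 L \<kappa>1)"
    and c5: "c5 = (eps5 L Lf \<kappa>1 \<kappa>2 + 3 * real CARD('n)) / (real CARD('n) * \<epsilon> * kappa6 L \<kappa>1)"
  shows "0 < \<epsilon> \<and> \<epsilon> < 1 / \<eta> \<and> c5 > 0 \<and> c4 \<ge> 0 \<and>
         ((\<exists>i. x0 i \<noteq> avg x0 \<or> grad (f i) (avg x0) \<noteq> 0) \<longrightarrow> c4 > 0) \<and>
         (\<forall>k\<ge>1.
           integrable M (\<lambda>\<omega>. avg (\<lambda>i. (norm (x i k \<omega> - avg (\<lambda>j. x j k \<omega>)))^2)
              + favg f (avg (\<lambda>j. x j k \<omega>)) - fstar) \<and>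
           (\<integral>\<omega>. (avg (\<lambda>i. (norm (x i k \<omega> - avg (\<lambda>j. x j k \<omega>)))^2)
              + favg f (avg (\<lambda>j. x j k \<omega>)) - fstar) \<partial>M)
             \<le> (1 - \<eta> * \<epsilon>) ^ k * c4 + c5 * \<eta> * \<sigma>^2)"
proof -
  interpret sgd_process E L f fstar Lf \<nu> \<kappa>1 \<kappa>2 \<beta> \<eta> \<epsilon> M S g \<xi> \<sigma> x0 x v
    by (intro sgd_process.intro sgd_process_axioms.intro pd_system.intro pd_system_axioms.intro
        connected_laplacian.intro) (use assms in blast)+
  let ?x = "(\<chi> i. x0 i) :: (real^'p)^'n"
  have c4': "c4 = lyap ?x 0 / (real CARD('n) * kappa6 L \<kappa>1)"
    unfolding c4 W0_eq_lyap ..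
  have n\<kappa>: "0 < real CARD('n) * kappa6 L \<kappa>1" using kappa6_bounds(1) by simp
  have "\<epsilon> < 1 / \<eta>" using rate_bounds(2) eta_bounds(1) by (simp add: field_simps)
  moreover have "c5 > 0"
    unfolding c5 using eps5_ge(1) rate_bounds(1) kappa6_bounds(1)
    by (intro divide_pos_pos mult_pos_pos add_pos_nonneg) auto
  moreover have "c4 \<ge> 0" unfolding c4' using lyap_nonneg n\<kappa> by (intro divide_nonneg_pos)
  \<comment> \<open>Strict positivity is conditional: \<open>W0\<close> is zero when all agents
    start at one point where every local gradient vanishes, since the Polyak-Lojasiewicz condition
    then makes the gap zero too.\<close>
  moreover have "c4 > 0" if ex: "\<exists>i. x0 i \<noteq> avg x0 \<or> grad (f i) (avg x0) \<noteq> 0"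
  proof -
    obtain i where i: "x0 i \<noteq> avg x0 \<or> grad (f i) (avg x0) \<noteq> 0"
      using ex by blast
    have "avg (($) ?x) = avg x0" by (simp add: avg_def)
    then have "(\<chi> i. avg (($) ?x)) $ i = avg x0" "grads0 ?x $ i = grad (f i) (avg x0)" "?x $ i = x0 i"
      by (simp_all add: grads0_def)
    then have "?x \<noteq> (\<chi> i. avg (($) ?x)) \<or> grads0 ?x \<noteq> 0"
      using i by (metis zero_index)
    then show ?thesis unfolding c4' using n\<kappa> by (intro divide_pos_pos lyap_pos)
  qed
  ultimately show ?thesis
    using rate_bounds(1) err_integrable err_expectation unfolding err_def c4' c5 by blast
qed

end
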